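(* Let $(M,\nabla,\langle\cdot,\cdot\rangle)$ be an affine-Riemann manifold of dimension $n\ge 2$ with Koszul forms $\alpha,\xi$, let $\theta_0=\alpha-\xi$, and let $(TM,J_1,g_1)$ be its canonical Hermitian structure. 1. $(TM,J_1,g_1)$ is locally conformally Kähler if and only if, for all vector fields $X,Y$ on $M$, $$(n-1)(\gamma_X^*Y-\gamma_Y^*X)=\theta_0(X)Y-\theta_0(Y)X.\qquad(\ast)$$ 2. $(TM,J_1,g_1)$ is Vaisman if and only if $(\ast)$ holds for all vector fields $X,Y$ on $M$ and the vector field $\Pi:=\mathrm{tr}_{\langle,\rangle}(\gamma^*-\gamma)$ is parallel with respect to both $D$ and $\nabla$.
   Context: An affine-Riemann manifold $(M,\nabla,\langle\cdot,\cdot\rangle)$ is a manifold $M$ of dimension $n$ with a flat torsionless connection $\nabla$ and a Riemannian metric $\langle\cdot,\cdot\rangle$. $D$ is the Levi-Civita connection of the metric; the difference tensor is $\gamma_XY=D_XY-\nabla_XY$, and $\gamma^*$ is defined by $\langle\gamma^*_XY,Z\rangle=\langle Y,\gamma_XZ\rangle$. For a local orthonormal frame $(E_i)$ and $\beta=\gamma$, $\gamma^*$ or $\gamma^*-\gamma$, $\mathrm{tr}_{\langle,\rangle}(\beta)=\sum_i\beta_{E_i}E_i$. The Koszul forms are $\alpha(X)=\langle\mathrm{tr}_{\langle,\rangle}(\gamma^* ),X\rangle$ and $\xi(X)=\langle\mathrm{tr}_{\langle,\rangle}(\gamma),X\rangle$. Canonical Hermitian structure: $\pi_1:TM\to M$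 is the projection; for a vector field $X$ on $M$, $X^h$ is the horizontal lift with respect to $\nabla$ and $X^v$ the vertical lift; $J_1X^h=X^v$, $J_1X^v=-X^h$; $g_1(X^h,Y^h)=g_1(X^v,Y^v)=\langle X,Y\rangle\circ\pi_1$, $g_1(X^h,Y^v)=0$. For a Hermitian manifold $(N,J,g)$ of real dimension $2n$, $n\ge2$: fundamental form $\omega=g(J\cdot,\cdot)$; $d^*\eta(X_1,\dots,X_{p-1})=-\sum_i(\nabla^{LC}_{E_i}\eta)(E_i,X_1,\dots,X_{p-1})$ with $\nabla^{LC}$ the Levi-Civita connection of $g$; Lee form $\theta=-d^*\omega\circ J$. In this paper $(N,J,g)$ is called locally conformally Kähler if $d\omega=\frac1{n-1}\theta\wedge\omega$, and Vaisman if in addition $\nabla^{LC}\theta=0$. (Here $N=TM$ has real dimension $2n$ with $n=\dim M$.) *)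

theory Defs
  imports "HOL-Analysis.Analysis"
begin

section \<open>Smooth manifolds\<close>

text \<open>For open \<open>S\<close> in a Euclidean space: all iterated directional derivatives of order at most
  \<open>k\<close> exist and are continuous on \<open>S\<close>.\<close>

fun Ck_on :: "nat \<Rightarrow> ('a::real_normed_vector \<Rightarrow> 'b::real_normed_vector) \<Rightarrow> 'a set \<Rightarrow> bool" where
  "Ck_on 0 f S \<longleftrightarrow> continuous_on S f"
| "Ck_on (Suc k) f S \<longleftrightarrow> (\<forall>x\<in>S. f differentiable (at x)) \<and>
     (\<forall>v. Ck_on k (\<lambda>x. frechet_derivative f (at x) v) S)"

definition smooth_on :: "('a::real_normed_vector \<Rightarrow> 'b::real_normed_vector) \<Rightarrow> 'a set \<Rightarrow> bool" where
  "smooth_on f S \<longleftrightarrow> (\<forall>k. Ck_on k f S)"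

text \<open>A chart is a pair of its domain and its coordinate map. A manifold is given by an atlas \<open>A\<close>
  of charts with values in the Euclidean space \<open>'e\<close>, of dimension \<open>DIM('e)\<close>; the set of points is
  the union of the chart domains and the topology is the one induced by the charts.\<close>

type_synonym ('a, 'e) chart = "'a set \<times> ('a \<Rightarrow> 'e)"

definition chart_inv :: "('a, 'e) chart \<Rightarrow> 'e \<Rightarrow> 'a" where
  "chart_inv c = the_inv_into (fst c) (snd c)"

definition points :: "('a, 'e) chart set \<Rightarrow> 'a set" where
  "points A = \<Union> (fst ` A)"

definition smooth_atlas :: "('a, 'e::euclidean_space) chart set \<Rightarrow> bool" where
  "smooth_atlas A \<longleftrightarrow>
     (\<forall>c\<in>A. inj_on (snd c) (fst c) \<and> open (snd c ` fst c)) \<and>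
     (\<forall>c\<in>A. \<forall>d\<in>A. open (snd c ` (fst c \<inter> fst d)) \<and>
        smooth_on (snd d \<circ> chart_inv c) (snd c ` (fst c \<inter> fst d)))"

definition open_subset :: "('a, 'e::euclidean_space) chart set \<Rightarrow> 'a set \<Rightarrow> bool" where
  "open_subset A W \<longleftrightarrow> W \<subseteq> points A \<and> (\<forall>c\<in>A. open (snd c ` (W \<inter> fst c)))"

definition manifold_topology :: "('a, 'e::euclidean_space) chart set \<Rightarrow> 'a topology" where
  "manifold_topology A = topology (open_subset A)"

lemma openin_manifold_topology:
  assumes "smooth_atlas A"
  shows "openin (manifold_topology A) W \<longleftrightarrow> open_subset A W"
proof -
  have "istopology (open_subset A)"
    unfolding istopology_def
  proof (intro conjI allI impI)
    fix S T assume ST: "open_subset A S" "open_subset A T"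
    show "open_subset A (S \<inter> T)"
      unfolding open_subset_def
    proof (intro conjI ballI)
      show "S \<inter> T \<subseteq> points A" using ST by (auto simp: open_subset_def)
      fix c assume c: "c \<in> A"
      then have "inj_on (snd c) (fst c)" using assms by (auto simp: smooth_atlas_def)
      then have "snd c ` (S \<inter> T \<inter> fst c) = snd c ` (S \<inter> fst c) \<inter> snd c ` (T \<inter> fst c)"
        by (auto simp: inj_on_def)
      then show "open (snd c ` (S \<inter> T \<inter> fst c))"
        using ST c by (simp add: open_subset_def open_Int)
    qed
  next
    fix K assume K: "\<forall>S\<in>K. open_subset A S"
    show "open_subset A (\<Union> K)"
      unfolding open_subset_def
    proof (intro conjI ballI)
      show "\<Union> K \<subseteq> points A" using K by (auto simp: open_subset_def)
      fix c assume c: "c \<in> A"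
      have "snd c ` (\<Union> K \<inter> fst c) = (\<Union>S\<in>K. snd c ` (S \<inter> fst c))" by blast
      moreover have "open (\<Union>S\<in>K. snd c ` (S \<inter> fst c))"
        using K c by (intro open_UN) (simp add: open_subset_def)
      ultimately show "open (snd c ` (\<Union> K \<inter> fst c))" by simp
    qed
  qed
  then show ?thesis by (simp add: manifold_topology_def)
qed

definition smooth_manifold :: "('a, 'e::euclidean_space) chart set \<Rightarrow> bool" where
  "smooth_manifold A \<longleftrightarrow> smooth_atlas A \<and>
     Hausdorff_space (manifold_topology A) \<and> second_countable (manifold_topology A)"

section \<open>Tangent vectors and vector fields\<close>

text \<open>Every point \<open>p\<close> gets a preferred chart, and a tangent vector at \<open>p\<close> is represented by its
  coordinates in that chart; thus every tangent space is a copy of \<open>'e\<close>, and the set of points of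
  the tangent bundle is \<open>points A \<times> UNIV\<close> (with its own atlas, see below). As the preferred chart
  varies with the point in an uncontrolled way, smoothness of a vector field
  \<open>X :: 'a \<Rightarrow> 'e\<close> is not smoothness of this function, but of its coordinates in fixed charts.\<close>

definition chart_at :: "('a, 'e) chart set \<Rightarrow> 'a \<Rightarrow> ('a, 'e) chart" where
  "chart_at A p = (SOME c. c \<in> A \<and> p \<in> fst c)"

text \<open>The differential at \<open>p\<close> of a function with values in a normed space. In particular
  \<open>mderiv A (snd c) p v\<close> is the coordinate vector of \<open>v\<close> in the chart \<open>c\<close>.\<close>

definition mderiv ::
  "('a, 'e::euclidean_space) chart set \<Rightarrow> ('a \<Rightarrow> 'b::real_normed_vector) \<Rightarrow> 'a \<Rightarrow> 'e \<Rightarrow> 'b" where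
  "mderiv A f p v =
     frechet_derivative (f \<circ> chart_inv (chart_at A p)) (at (snd (chart_at A p) p)) v"

definition tangent_map ::
  "('a, 'e::euclidean_space) chart set \<Rightarrow> ('b, 'f::euclidean_space) chart set \<Rightarrow>
   ('a \<Rightarrow> 'b) \<Rightarrow> 'a \<Rightarrow> 'e \<Rightarrow> 'f" where
  "tangent_map A B f p v = mderiv A (snd (chart_at B (f p)) \<circ> f) p v"

definition smooth_fun ::
  "('a, 'e::euclidean_space) chart set \<Rightarrow> 'a set \<Rightarrow> ('a \<Rightarrow> 'b::real_normed_vector) \<Rightarrow> bool" where
  "smooth_fun A W f \<longleftrightarrow> (\<forall>c\<in>A. smooth_on (f \<circ> chart_inv c) (snd c ` (W \<inter> fst c)))"

definition vector_field ::
  "('a, 'e::euclidean_space) chart set \<Rightarrow> 'a set \<Rightarrow> ('a \<Rightarrow> 'e) \<Rightarrow> bool" where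
  "vector_field A W X \<longleftrightarrow> (\<forall>c\<in>A.
     smooth_on ((\<lambda>q. mderiv A (snd c) q (X q)) \<circ> chart_inv c) (snd c ` (W \<inter> fst c)))"

definition dir_deriv ::
  "('a, 'e::euclidean_space) chart set \<Rightarrow> ('a \<Rightarrow> 'e) \<Rightarrow> ('a \<Rightarrow> 'b::real_normed_vector) \<Rightarrow> 'a \<Rightarrow> 'b" where
  "dir_deriv A X f = (\<lambda>p. mderiv A f p (X p))"

text \<open>\<open>[X,Y]\<phi> = X(Y\<phi>) - Y(X\<phi>)\<close>, applied to the vector-valued coordinate map \<open>\<phi>\<close> of the
  preferred chart at \<open>p\<close>, in which tangent vectors at \<open>p\<close> are their own coordinates.\<close>

definition lie_bracket ::
  "('a, 'e::euclidean_space) chart set \<Rightarrow> ('a \<Rightarrow> 'e) \<Rightarrow> ('a \<Rightarrow> 'e) \<Rightarrow> 'a \<Rightarrow> 'e" where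
  "lie_bracket A X Y p = (let \<phi> = snd (chart_at A p) in
     dir_deriv A X (dir_deriv A Y \<phi>) p - dir_deriv A Y (dir_deriv A X \<phi>) p)"

text \<open>The local vector field with constant coordinates in the preferred chart at \<open>p\<close> and with
  value \<open>u\<close> at \<open>p\<close>. It is only used to evaluate at \<open>p\<close> expressions in vector fields which are
  tensorial, so that their value does not depend on the choice of this extension of \<open>u\<close>.\<close>

definition const_ext :: "('a, 'e::euclidean_space) chart set \<Rightarrow> 'a \<Rightarrow> 'e \<Rightarrow> 'a \<Rightarrow> 'e" where
  "const_ext A p u = (\<lambda>q.
     frechet_derivative (snd (chart_at A q) \<circ> chart_inv (chart_at A p)) (at (snd (chart_at A p) q)) u)"

section \<open>Metrics and connections\<close>

definition riemannian_metric ::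
  "('a, 'e::euclidean_space) chart set \<Rightarrow> ('a \<Rightarrow> 'e \<Rightarrow> 'e \<Rightarrow> real) \<Rightarrow> bool" where
  "riemannian_metric A g \<longleftrightarrow>
     (\<forall>p\<in>points A. bilinear (g p) \<and> (\<forall>u v. g p u v = g p v u) \<and> (\<forall>u. u \<noteq> 0 \<longrightarrow> 0 < g p u u)) \<and>
     (\<forall>W X Y. open_subset A W \<and> vector_field A W X \<and> vector_field A W Y \<longrightarrow>
        smooth_fun A W (\<lambda>p. g p (X p) (Y p)))"

text \<open>A connection acts on vector fields over arbitrary open subsets. Its values on functions
  that are not smooth near the point of evaluation are irrelevant, and its locality follows from the
  laws below, since \<open>f\<close> need be smooth on \<open>W\<close> only.\<close>

definition connection ::
  "('a, 'e::euclidean_space) chart set \<Rightarrow> (('a \<Rightarrow> 'e) \<Rightarrow> ('a \<Rightarrow> 'e) \<Rightarrow> 'a \<Rightarrow> 'e) \<Rightarrow> bool" where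
  "connection A nabla \<longleftrightarrow>
     (\<forall>W X Y Z f. open_subset A W \<and> vector_field A W X \<and> vector_field A W Y \<and>
        vector_field A W Z \<and> smooth_fun A W (f :: 'a \<Rightarrow> real) \<longrightarrow>
        vector_field A W (nabla X Y) \<and>
        (\<forall>p\<in>W.
           nabla (\<lambda>q. X q + Z q) Y p = nabla X Y p + nabla Z Y p \<and>
           nabla (\<lambda>q. f q *\<^sub>R X q) Y p = f p *\<^sub>R nabla X Y p \<and>
           nabla X (\<lambda>q. Y q + Z q) p = nabla X Y p + nabla X Z p \<and>
           nabla X (\<lambda>q. f q *\<^sub>R Y q) p = dir_deriv A X f p *\<^sub>R Y p + f p *\<^sub>R nabla X Y p))"

definition torsion_free ::
  "('a, 'e::euclidean_space) chart set \<Rightarrow> (('a \<Rightarrow> 'e) \<Rightarrow> ('a \<Rightarrow> 'e) \<Rightarrow> 'a \<Rightarrow> 'e) \<Rightarrow> bool" where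
  "torsion_free A nabla \<longleftrightarrow>
     (\<forall>W X Y. open_subset A W \<and> vector_field A W X \<and> vector_field A W Y \<longrightarrow>
        (\<forall>p\<in>W. nabla X Y p - nabla Y X p = lie_bracket A X Y p))"

definition flat_connection ::
  "('a, 'e::euclidean_space) chart set \<Rightarrow> (('a \<Rightarrow> 'e) \<Rightarrow> ('a \<Rightarrow> 'e) \<Rightarrow> 'a \<Rightarrow> 'e) \<Rightarrow> bool" where
  "flat_connection A nabla \<longleftrightarrow>
     (\<forall>W X Y Z. open_subset A W \<and> vector_field A W X \<and> vector_field A W Y \<and> vector_field A W Z \<longrightarrow>
        (\<forall>p\<in>W. nabla X (nabla Y Z) p - nabla Y (nabla X Z) p - nabla (lie_bracket A X Y) Z p = 0))"

definition metric_connection ::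
  "('a, 'e::euclidean_space) chart set \<Rightarrow> ('a \<Rightarrow> 'e \<Rightarrow> 'e \<Rightarrow> real) \<Rightarrow>
   (('a \<Rightarrow> 'e) \<Rightarrow> ('a \<Rightarrow> 'e) \<Rightarrow> 'a \<Rightarrow> 'e) \<Rightarrow> bool" where
  "metric_connection A g nabla \<longleftrightarrow>
     (\<forall>W X Y Z. open_subset A W \<and> vector_field A W X \<and> vector_field A W Y \<and> vector_field A W Z \<longrightarrow>
        (\<forall>p\<in>W. dir_deriv A X (\<lambda>q. g q (Y q) (Z q)) p =
           g p (nabla X Y p) (Z p) + g p (Y p) (nabla X Z p)))"

text \<open>Unique on smooth vector fields.\<close>

definition levi_civita ::
  "('a, 'e::euclidean_space) chart set \<Rightarrow> ('a \<Rightarrow> 'e \<Rightarrow> 'e \<Rightarrow> real) \<Rightarrow>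
   ('a \<Rightarrow> 'e) \<Rightarrow> ('a \<Rightarrow> 'e) \<Rightarrow> 'a \<Rightarrow> 'e" where
  "levi_civita A g =
     (SOME nabla. connection A nabla \<and> torsion_free A nabla \<and> metric_connection A g nabla)"

definition parallel_field ::
  "('a, 'e::euclidean_space) chart set \<Rightarrow> (('a \<Rightarrow> 'e) \<Rightarrow> ('a \<Rightarrow> 'e) \<Rightarrow> 'a \<Rightarrow> 'e) \<Rightarrow> ('a \<Rightarrow> 'e) \<Rightarrow> bool" where
  "parallel_field A nabla Y \<longleftrightarrow>
     (\<forall>X. vector_field A (points A) X \<longrightarrow> (\<forall>p\<in>points A. nabla X Y p = 0))"

text \<open>An orthonormal basis of the tangent space at \<open>p\<close>; metric traces of tensors do not depend on
  its choice, and may be computed with the values at \<open>p\<close> of a local orthonormal frame.\<close>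

definition onb :: "('a \<Rightarrow> 'e::euclidean_space \<Rightarrow> 'e \<Rightarrow> real) \<Rightarrow> 'a \<Rightarrow> 'e set" where
  "onb g p = (SOME B. finite B \<and> card B = DIM('e) \<and>
     (\<forall>b\<in>B. \<forall>c\<in>B. g p b c = (if b = c then 1 else 0)))"

definition metric_trace ::
  "('a \<Rightarrow> 'e::euclidean_space \<Rightarrow> 'e \<Rightarrow> real) \<Rightarrow> ('a \<Rightarrow> 'e \<Rightarrow> 'e \<Rightarrow> 'e) \<Rightarrow> 'a \<Rightarrow> 'e" where
  "metric_trace g \<beta> p = (\<Sum>e\<in>onb g p. \<beta> p e e)"

section \<open>Affine-Riemann manifolds\<close>

definition affine_riemann_manifold ::
  "('a, 'e::euclidean_space) chart set \<Rightarrow> (('a \<Rightarrow> 'e) \<Rightarrow> ('a \<Rightarrow> 'e) \<Rightarrow> 'a \<Rightarrow> 'e) \<Rightarrow>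
   ('a \<Rightarrow> 'e \<Rightarrow> 'e \<Rightarrow> real) \<Rightarrow> bool" where
  "affine_riemann_manifold A nabla g \<longleftrightarrow> smooth_manifold A \<and>
     connection A nabla \<and> flat_connection A nabla \<and> torsion_free A nabla \<and> riemannian_metric A g"

definition difference_tensor ::
  "('a, 'e::euclidean_space) chart set \<Rightarrow> (('a \<Rightarrow> 'e) \<Rightarrow> ('a \<Rightarrow> 'e) \<Rightarrow> 'a \<Rightarrow> 'e) \<Rightarrow>
   ('a \<Rightarrow> 'e \<Rightarrow> 'e \<Rightarrow> real) \<Rightarrow> 'a \<Rightarrow> 'e \<Rightarrow> 'e \<Rightarrow> 'e" where
  "difference_tensor A nabla g p u v =
     levi_civita A g (const_ext A p u) (const_ext A p v) p - nabla (const_ext A p u) (const_ext A p v) p"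

definition difference_tensor_adj ::
  "('a, 'e::euclidean_space) chart set \<Rightarrow> (('a \<Rightarrow> 'e) \<Rightarrow> ('a \<Rightarrow> 'e) \<Rightarrow> 'a \<Rightarrow> 'e) \<Rightarrow>
   ('a \<Rightarrow> 'e \<Rightarrow> 'e \<Rightarrow> real) \<Rightarrow> 'a \<Rightarrow> 'e \<Rightarrow> 'e \<Rightarrow> 'e" where
  "difference_tensor_adj A nabla g p u v =
     (THE w. \<forall>z. g p w z = g p v (difference_tensor A nabla g p u z))"

definition koszul_alpha ::
  "('a, 'e::euclidean_space) chart set \<Rightarrow> (('a \<Rightarrow> 'e) \<Rightarrow> ('a \<Rightarrow> 'e) \<Rightarrow> 'a \<Rightarrow> 'e) \<Rightarrow>
   ('a \<Rightarrow> 'e \<Rightarrow> 'e \<Rightarrow> real) \<Rightarrow> 'a \<Rightarrow> 'e \<Rightarrow> real" where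
  "koszul_alpha A nabla g p v = g p (metric_trace g (difference_tensor_adj A nabla g) p) v"

definition koszul_xi ::
  "('a, 'e::euclidean_space) chart set \<Rightarrow> (('a \<Rightarrow> 'e) \<Rightarrow> ('a \<Rightarrow> 'e) \<Rightarrow> 'a \<Rightarrow> 'e) \<Rightarrow>
   ('a \<Rightarrow> 'e \<Rightarrow> 'e \<Rightarrow> real) \<Rightarrow> 'a \<Rightarrow> 'e \<Rightarrow> real" where
  "koszul_xi A nabla g p v = g p (metric_trace g (difference_tensor A nabla g) p) v"

definition theta0 ::
  "('a, 'e::euclidean_space) chart set \<Rightarrow> (('a \<Rightarrow> 'e) \<Rightarrow> ('a \<Rightarrow> 'e) \<Rightarrow> 'a \<Rightarrow> 'e) \<Rightarrow>
   ('a \<Rightarrow> 'e \<Rightarrow> 'e \<Rightarrow> real) \<Rightarrow> 'a \<Rightarrow> 'e \<Rightarrow> real" where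
  "theta0 A nabla g p v = koszul_alpha A nabla g p v - koszul_xi A nabla g p v"

definition Pi_field ::
  "('a, 'e::euclidean_space) chart set \<Rightarrow> (('a \<Rightarrow> 'e) \<Rightarrow> ('a \<Rightarrow> 'e) \<Rightarrow> 'a \<Rightarrow> 'e) \<Rightarrow>
   ('a \<Rightarrow> 'e \<Rightarrow> 'e \<Rightarrow> real) \<Rightarrow> 'a \<Rightarrow> 'e" where
  "Pi_field A nabla g = metric_trace g
     (\<lambda>p u v. difference_tensor_adj A nabla g p u v - difference_tensor A nabla g p u v)"

text \<open>The identity \<open>(n-1)(\<gamma>\<^sup>*\<^sub>XY - \<gamma>\<^sup>*\<^sub>YX) = \<theta>\<^sub>0(X)Y - \<theta>\<^sub>0(Y)X\<close>.\<close>

definition star_identity ::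
  "('a, 'e::euclidean_space) chart set \<Rightarrow> (('a \<Rightarrow> 'e) \<Rightarrow> ('a \<Rightarrow> 'e) \<Rightarrow> 'a \<Rightarrow> 'e) \<Rightarrow>
   ('a \<Rightarrow> 'e \<Rightarrow> 'e \<Rightarrow> real) \<Rightarrow> ('a \<Rightarrow> 'e) \<Rightarrow> ('a \<Rightarrow> 'e) \<Rightarrow> bool" where
  "star_identity A nabla g X Y \<longleftrightarrow> (\<forall>p\<in>points A.
     (real DIM('e) - 1) *\<^sub>R
       (difference_tensor_adj A nabla g p (X p) (Y p) - difference_tensor_adj A nabla g p (Y p) (X p)) =
     theta0 A nabla g p (X p) *\<^sub>R Y p - theta0 A nabla g p (Y p) *\<^sub>R X p)"

section \<open>The tangent bundle and its canonical Hermitian structure\<close>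

definition tangent_atlas ::
  "('a, 'e::euclidean_space) chart set \<Rightarrow> ('a \<times> 'e, 'e \<times> 'e) chart set" where
  "tangent_atlas A = (\<lambda>c. (fst c \<times> UNIV, \<lambda>(p, v). (snd c p, mderiv A (snd c) p v))) ` A"

text \<open>The velocity at \<open>t = 0\<close> of the curve \<open>t \<mapsto> u + t w\<close> in the fibre over \<open>p\<close>.\<close>

definition vertical_lift ::
  "('a, 'e::euclidean_space) chart set \<Rightarrow> 'a \<times> 'e \<Rightarrow> 'e \<Rightarrow> 'e \<times> 'e" where
  "vertical_lift A P w = vector_derivative
     (\<lambda>t. snd (chart_at (tangent_atlas A) P) (fst P, snd P + t *\<^sub>R w)) (at 0)"

text \<open>The horizontal space at \<open>u \<in> T\<^sub>pM\<close> consists of the vectors \<open>dY(X\<^sub>p)\<close>, where \<open>Y\<close> is a local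
  section of the tangent bundle through \<open>u\<close> whose covariant derivative in the direction \<open>X\<close>
  vanishes at \<open>p\<close>.\<close>

definition horizontal_space ::
  "('a, 'e::euclidean_space) chart set \<Rightarrow> (('a \<Rightarrow> 'e) \<Rightarrow> ('a \<Rightarrow> 'e) \<Rightarrow> 'a \<Rightarrow> 'e) \<Rightarrow>
   'a \<times> 'e \<Rightarrow> ('e \<times> 'e) set" where
  "horizontal_space A nabla P =
     {tangent_map A (tangent_atlas A) (\<lambda>q. (q, Y q)) (fst P) (X (fst P)) | X Y.
        \<exists>W. open_subset A W \<and> fst P \<in> W \<and> vector_field A W X \<and> vector_field A W Y \<and>
          Y (fst P) = snd P \<and> nabla X Y (fst P) = 0}"

definition horizontal_lift ::
  "('a, 'e::euclidean_space) chart set \<Rightarrow> (('a \<Rightarrow> 'e) \<Rightarrow> ('a \<Rightarrow> 'e) \<Rightarrow> 'a \<Rightarrow> 'e) \<Rightarrow>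
   'a \<times> 'e \<Rightarrow> 'e \<Rightarrow> 'e \<times> 'e" where
  "horizontal_lift A nabla P w =
     (THE \<zeta>. \<zeta> \<in> horizontal_space A nabla P \<and> tangent_map (tangent_atlas A) A fst P \<zeta> = w)"

definition hv_components ::
  "('a, 'e::euclidean_space) chart set \<Rightarrow> (('a \<Rightarrow> 'e) \<Rightarrow> ('a \<Rightarrow> 'e) \<Rightarrow> 'a \<Rightarrow> 'e) \<Rightarrow>
   'a \<times> 'e \<Rightarrow> 'e \<times> 'e \<Rightarrow> 'e \<times> 'e" where
  "hv_components A nabla P \<zeta> =
     (THE ab. \<zeta> = horizontal_lift A nabla P (fst ab) + vertical_lift A P (snd ab))"

definition J1 ::
  "('a, 'e::euclidean_space) chart set \<Rightarrow> (('a \<Rightarrow> 'e) \<Rightarrow> ('a \<Rightarrow> 'e) \<Rightarrow> 'a \<Rightarrow> 'e) \<Rightarrow>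
   'a \<times> 'e \<Rightarrow> 'e \<times> 'e \<Rightarrow> 'e \<times> 'e" where
  "J1 A nabla P \<zeta> = (let (a, b) = hv_components A nabla P \<zeta> in
     vertical_lift A P a - horizontal_lift A nabla P b)"

definition g1 ::
  "('a, 'e::euclidean_space) chart set \<Rightarrow> (('a \<Rightarrow> 'e) \<Rightarrow> ('a \<Rightarrow> 'e) \<Rightarrow> 'a \<Rightarrow> 'e) \<Rightarrow>
   ('a \<Rightarrow> 'e \<Rightarrow> 'e \<Rightarrow> real) \<Rightarrow> 'a \<times> 'e \<Rightarrow> 'e \<times> 'e \<Rightarrow> 'e \<times> 'e \<Rightarrow> real" where
  "g1 A nabla g P \<zeta> \<eta> = (let (a, b) = hv_components A nabla P \<zeta>; (a', b') = hv_components A nabla P \<eta> in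
     g (fst P) a a' + g (fst P) b b')"

section \<open>Locally conformally Kaehler and Vaisman structures\<close>

definition fundamental_form ::
  "('b \<Rightarrow> 'f \<Rightarrow> 'f) \<Rightarrow> ('b \<Rightarrow> 'f \<Rightarrow> 'f \<Rightarrow> real) \<Rightarrow> 'b \<Rightarrow> 'f \<Rightarrow> 'f \<Rightarrow> real" where
  "fundamental_form J g p u v = g p (J p u) v"

definition cov_deriv_1form ::
  "('b, 'f::euclidean_space) chart set \<Rightarrow> (('b \<Rightarrow> 'f) \<Rightarrow> ('b \<Rightarrow> 'f) \<Rightarrow> 'b \<Rightarrow> 'f) \<Rightarrow>
   ('b \<Rightarrow> 'f \<Rightarrow> real) \<Rightarrow> ('b \<Rightarrow> 'f) \<Rightarrow> ('b \<Rightarrow> 'f) \<Rightarrow> 'b \<Rightarrow> real" where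
  "cov_deriv_1form A nabla \<eta> Z X p =
     dir_deriv A Z (\<lambda>q. \<eta> q (X q)) p - \<eta> p (nabla Z X p)"

definition cov_deriv_2form ::
  "('b, 'f::euclidean_space) chart set \<Rightarrow> (('b \<Rightarrow> 'f) \<Rightarrow> ('b \<Rightarrow> 'f) \<Rightarrow> 'b \<Rightarrow> 'f) \<Rightarrow>
   ('b \<Rightarrow> 'f \<Rightarrow> 'f \<Rightarrow> real) \<Rightarrow> ('b \<Rightarrow> 'f) \<Rightarrow> ('b \<Rightarrow> 'f) \<Rightarrow> ('b \<Rightarrow> 'f) \<Rightarrow> 'b \<Rightarrow> real" where
  "cov_deriv_2form A nabla \<eta> Z X Y p =
     dir_deriv A Z (\<lambda>q. \<eta> q (X q) (Y q)) p - \<eta> p (nabla Z X p) (Y p) - \<eta> p (X p) (nabla Z Y p)"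

definition codiff_2form ::
  "('b, 'f::euclidean_space) chart set \<Rightarrow> ('b \<Rightarrow> 'f \<Rightarrow> 'f \<Rightarrow> real) \<Rightarrow>
   ('b \<Rightarrow> 'f \<Rightarrow> 'f \<Rightarrow> real) \<Rightarrow> 'b \<Rightarrow> 'f \<Rightarrow> real" where
  "codiff_2form A g \<eta> p v = - (\<Sum>e\<in>onb g p. cov_deriv_2form A (levi_civita A g) \<eta>
     (const_ext A p e) (const_ext A p e) (const_ext A p v) p)"

definition lee_form ::
  "('b, 'f::euclidean_space) chart set \<Rightarrow> ('b \<Rightarrow> 'f \<Rightarrow> 'f) \<Rightarrow> ('b \<Rightarrow> 'f \<Rightarrow> 'f \<Rightarrow> real) \<Rightarrow>
   'b \<Rightarrow> 'f \<Rightarrow> real" where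
  "lee_form A J g p v = - codiff_2form A g (fundamental_form J g) p (J p v)"

definition ext_deriv_2form ::
  "('b, 'f::euclidean_space) chart set \<Rightarrow> ('b \<Rightarrow> 'f \<Rightarrow> 'f \<Rightarrow> real) \<Rightarrow>
   ('b \<Rightarrow> 'f) \<Rightarrow> ('b \<Rightarrow> 'f) \<Rightarrow> ('b \<Rightarrow> 'f) \<Rightarrow> 'b \<Rightarrow> real" where
  "ext_deriv_2form A \<eta> X Y Z p =
     dir_deriv A X (\<lambda>q. \<eta> q (Y q) (Z q)) p
     + dir_deriv A Y (\<lambda>q. \<eta> q (Z q) (X q)) p
     + dir_deriv A Z (\<lambda>q. \<eta> q (X q) (Y q)) p
     - \<eta> p (lie_bracket A X Y p) (Z p)
     - \<eta> p (lie_bracket A Y Z p) (X p)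
     - \<eta> p (lie_bracket A Z X p) (Y p)"

definition wedge12 :: "('f \<Rightarrow> real) \<Rightarrow> ('f \<Rightarrow> 'f \<Rightarrow> real) \<Rightarrow> 'f \<Rightarrow> 'f \<Rightarrow> 'f \<Rightarrow> real" where
  "wedge12 \<theta> \<eta> u v w = \<theta> u * \<eta> v w + \<theta> v * \<eta> w u + \<theta> w * \<eta> u v"

text \<open>With \<open>n = DIM('f) / 2\<close>.\<close>

definition locally_conformally_kaehler ::
  "('b, 'f::euclidean_space) chart set \<Rightarrow> ('b \<Rightarrow> 'f \<Rightarrow> 'f) \<Rightarrow> ('b \<Rightarrow> 'f \<Rightarrow> 'f \<Rightarrow> real) \<Rightarrow> bool" where
  "locally_conformally_kaehler A J g \<longleftrightarrow>
     (\<forall>X Y Z. vector_field A (points A) X \<and> vector_field A (points A) Y \<and> vector_field A (points A) Z \<longrightarrow>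
        (\<forall>p\<in>points A. ext_deriv_2form A (fundamental_form J g) X Y Z p =
           1 / (real DIM('f) / 2 - 1) *
           wedge12 (lee_form A J g p) (fundamental_form J g p) (X p) (Y p) (Z p)))"

definition vaisman ::
  "('b, 'f::euclidean_space) chart set \<Rightarrow> ('b \<Rightarrow> 'f \<Rightarrow> 'f) \<Rightarrow> ('b \<Rightarrow> 'f \<Rightarrow> 'f \<Rightarrow> real) \<Rightarrow> bool" where
  "vaisman A J g \<longleftrightarrow> locally_conformally_kaehler A J g \<and>
     (\<forall>X Y. vector_field A (points A) X \<and> vector_field A (points A) Y \<longrightarrow>
        (\<forall>p\<in>points A. cov_deriv_1form A (levi_civita A g) (lee_form A J g) X Y p = 0))"

end

theory Submission
  imports Defs
begin

text \<open>In the chart of \<open>TM\<close> induced by a chart of \<open>M\<close>, write \<open>\<Gamma>\<close> and \<open>\<Delta>\<close> for the Christoffel symbols of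
  \<open>\<nabla>\<close> and of the Levi-Civita connection, \<open>\<gamma> = \<Delta> - \<Gamma>\<close>, and decompose a tangent vector of \<open>TM\<close> at \<open>(x, u)\<close>
  as \<open>(a, b) = a\<^sup>h + \<beta>\<^sup>v\<close> with \<open>\<beta> = b + \<Gamma>(a, u)\<close>. Then \<open>\<omega> = \<langle>a, \<beta>'\<rangle> - \<langle>\<beta>, a'\<rangle>\<close>, and flatness removes all
  derivatives of \<open>\<Gamma>\<close> from \<open>d\<omega>\<close>, which becomes the cyclic sum of
  \<open>\<langle>a\<^sub>2, \<gamma>(a\<^sub>1, \<beta>\<^sub>3)\<rangle> - \<langle>a\<^sub>1, \<gamma>(a\<^sub>2, \<beta>\<^sub>3)\<rangle>\<close>. On any almost Hermitian manifold the Lee form is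
  \<open>\<theta>(v) = 1/2 \<Sum> d\<omega>(e, Je, v)\<close>, so that here \<open>\<theta>\<close> is the pullback of \<open>\<theta>\<^sub>0\<close>, and comparing \<open>d\<omega>\<close> with \<open>\<theta> \<and> \<omega>\<close>
  gives the first part. For the second, the Koszul formula yields
  \<open>(\<nabla>\<theta>)(\<zeta>\<^sub>1, \<zeta>\<^sub>2) = \<langle>D\<Pi>(a\<^sub>1), a\<^sub>2\<rangle> + 1/2 (\<langle>\<gamma>(\<Pi>, \<beta>\<^sub>1), \<beta>\<^sub>2\<rangle> + \<langle>\<beta>\<^sub>1, \<gamma>(\<Pi>, \<beta>\<^sub>2)\<rangle>)\<close>; the star identity makes
  \<open>\<gamma>\<^sub>\<Pi>\<close> self-adjoint, so the second summand vanishes exactly if \<open>\<gamma>\<^sub>\<Pi> = 0\<close>, and \<open>\<gamma>\<^sub>\<Pi> = D\<Pi> - \<nabla>\<Pi>\<close>.\<close>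

section \<open>Smooth maps between Euclidean spaces\<close>

text \<open>Tangent vectors live in a chart chosen point by point, and bases, adjoints and
  Levi-Civita connections are choices (\<open>SOME\<close>, \<open>THE\<close>), so neither
  smoothness nor chart independence can be read off the definitions. Everything is therefore moved
  to an arbitrary fixed chart, where vectors are identified by their pairings under the metric and
  smoothness comes from smooth orthonormal frames. The choice behind \<open>levi_civita\<close>
  forces an existence proof, applied to \<open>g\<close> and again to \<open>g1\<close>. The
  connection of \<open>g1\<close> never gets an explicit formula: its symbols enter only through
  symmetry and metric compatibility. Extracting a pointwise identity from a condition on global
  fields needs a global field through each tangent vector. On \<open>M\<close> a bump function and
  the Hausdorff property provide it; on \<open>TM\<close> lifts of fields from \<open>M\<close> do.
  The identities are read off at the zero vectors \<open>(p, 0)\<close>, where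
  \<open>\<beta> = b\<close>: purely horizontal and purely vertical arguments then isolate the terms
  that a general argument mixes.\<close>

abbreviation pd ::
  "('a::real_normed_vector \<Rightarrow> 'b::real_normed_vector) \<Rightarrow> 'a \<Rightarrow> 'a \<Rightarrow> 'b" where
  "pd f x v \<equiv> frechet_derivative f (at x) v"

lemma Ck_on_Suc_imp: "Ck_on (Suc k) f S \<Longrightarrow> Ck_on k f S"
proof (induction k arbitrary: f)
  case 0
  then show ?case
    by (auto intro!: continuous_at_imp_continuous_on differentiable_imp_continuous_within)
next
  case (Suc k)
  show ?case
    unfolding Ck_on.simps(2)[of k]
  proof (intro conjI allI)
    show "\<forall>x\<in>S. f differentiable at x" using Suc.prems by (subst (asm) Ck_on.simps(2)) blast
    show "Ck_on k (\<lambda>x. pd f x v) S" for v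
      by (rule Suc.IH) (use Suc.prems in \<open>subst (asm) Ck_on.simps(2), blast\<close>)
  qed
qed

lemma Ck_on_subset: "Ck_on k f S \<Longrightarrow> T \<subseteq> S \<Longrightarrow> Ck_on k f T"
  by (induction k arbitrary: f) (auto intro: continuous_on_subset)

lemma smooth_on_subset: "smooth_on f S \<Longrightarrow> T \<subseteq> S \<Longrightarrow> smooth_on f T"
  by (auto simp: smooth_on_def intro: Ck_on_subset)

text \<open>Openness of \<open>S\<close> makes \<open>f\<close> and \<open>g\<close> agree near each
  point, so their derivatives agree on \<open>S\<close> as well and the induction passes to
  them.\<close>

lemma Ck_on_cong:
  assumes "open S" "\<And>x. x \<in> S \<Longrightarrow> f x = g x" "Ck_on k f S"
  shows "Ck_on k g S"
  using assms
proof (induction k arbitrary: f g)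
  case 0
  then show ?case by (simp cong: continuous_on_cong)
next
  case (Suc k)
  have d: "pd f x = pd g x \<and> g differentiable (at x)"
    if "x \<in> S" for x
  proof -
    have "(f has_derivative pd f x) (at x)"
      using Suc.prems that by (simp add: frechet_derivative_works[symmetric])
    then have "(g has_derivative pd f x) (at x)"
      by (rule has_derivative_transform_within_open[OF _ Suc.prems(1) that Suc.prems(2)])
    then show ?thesis using frechet_derivative_at by (auto simp: differentiable_def)
  qed
  have "Ck_on k (\<lambda>x. pd g x v) S" for v
  proof (rule Suc.IH)
    show "Ck_on k (\<lambda>x. pd f x v) S" using Suc.prems(3) by simp
  qed (use Suc.prems d in auto)
  then show ?case using d by simp
qed

lemma smooth_on_cong:
  assumes "smooth_on f S" "open S" "\<And>x. x \<in> S \<Longrightarrow> f x = g x"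
  shows "smooth_on g S"
  using assms(1) Ck_on_cong[OF assms(2,3)] unfolding smooth_on_def by simp

text \<open>Lets smoothness be proved from any explicit derivative \<open>f'\<close>, which on an
  open set coincides with the \<open>frechet_derivative\<close> of the definition.\<close>

lemma Ck_on_SucI:
  assumes "open S" "\<And>x. x \<in> S \<Longrightarrow> (f has_derivative f' x) (at x)"
    and "\<And>v. Ck_on k (\<lambda>x. f' x v) S"
  shows "Ck_on (Suc k) f S"
proof -
  have "Ck_on k (\<lambda>x. pd f x v) S" for v
    by (rule Ck_on_cong[OF assms(1) _ assms(3)[of v]])
       (simp add: frechet_derivative_at[OF assms(2), symmetric])
  then show ?thesis using assms(2) by (auto simp: differentiable_def)
qed

lemma Ck_on_const: "Ck_on k (\<lambda>x. c) S"
  by (induction k arbitrary: c) (auto simp: continuous_on_const)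

lemma smooth_on_const [simp, intro]: "smooth_on (\<lambda>x. c) S"
  by (simp add: smooth_on_def Ck_on_const)

lemma Ck_on_SucD:
  "Ck_on (Suc k) f S \<Longrightarrow> x \<in> S \<Longrightarrow> (f has_derivative pd f x) (at x)"
  by (simp add: frechet_derivative_works[symmetric])

lemma Ck_on_bounded_linear:
  assumes "open S" "bounded_linear L" "Ck_on k f S"
  shows "Ck_on k (\<lambda>x. L (f x)) S"
  using assms(3)
proof (induction k arbitrary: f)
  case 0
  then show ?case by (simp add: bounded_linear.continuous_on assms)
next
  case (Suc k)
  show ?case
  proof (rule Ck_on_SucI[OF assms(1)])
    show "((\<lambda>x. L (f x)) has_derivative (\<lambda>v. L (pd f x v))) (at x)"
      if "x \<in> S" for x
      using bounded_linear.has_derivative[OF assms(2) Ck_on_SucD[OF Suc.prems that]] .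
    show "Ck_on k (\<lambda>x. L (pd f x v)) S" for v
      using Suc by simp
  qed
qed

lemma Ck_on_add:
  assumes "open S" "Ck_on k f S" "Ck_on k g S"
  shows "Ck_on k (\<lambda>x. f x + g x) S"
  using assms(2,3)
proof (induction k arbitrary: f g)
  case 0
  then show ?case by (simp add: continuous_on_add)
next
  case (Suc k)
  show ?case
  proof (rule Ck_on_SucI[OF assms(1)])
    show "((\<lambda>x. f x + g x) has_derivative
        (\<lambda>v. pd f x v + pd g x v)) (at x)"
      if "x \<in> S" for x
      using has_derivative_add[OF Ck_on_SucD[OF Suc.prems(1) that] Ck_on_SucD[OF Suc.prems(2) that]] .
  qed (use Suc in simp)
qed

lemma Ck_on_sum:
  assumes "open S" "\<And>i. i \<in> I \<Longrightarrow> Ck_on k (f i) S"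
  shows "Ck_on k (\<lambda>x. \<Sum>i\<in>I. f i x) S"
  using assms(2)
  by (induction I rule: infinite_finite_induct) (auto intro!: Ck_on_add assms(1) Ck_on_const)

text \<open>The product rule pairs a derivative of one factor with the other factor
  undifferentiated; the latter is known at order \<open>Suc k\<close> and has to be lowered to
  \<open>k\<close>, which is what \<open>Ck_on_Suc_imp\<close> is for.\<close>

lemma Ck_on_bilinear:
  assumes "open S" "bounded_bilinear B" "Ck_on k f S" "Ck_on k g S"
  shows "Ck_on k (\<lambda>x. B (f x) (g x)) S"
  using assms(3,4)
proof (induction k arbitrary: f g)
  case 0
  then show ?case by (simp add: bounded_bilinear.continuous_on[OF assms(2)])
next
  case (Suc k)
  show ?case
  proof (rule Ck_on_SucI[OF assms(1)])
    show "((\<lambda>x. B (f x) (g x)) has_derivative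
        (\<lambda>v. B (f x) (pd g x v) + B (pd f x v) (g x))) (at x)"
      if "x \<in> S" for x
      using bounded_bilinear.FDERIV[OF assms(2) Ck_on_SucD[OF Suc.prems(1) that] Ck_on_SucD[OF Suc.prems(2) that]] .
    show "Ck_on k (\<lambda>x. B (f x) (pd g x v) + B (pd f x v) (g x)) S" for v
      using Suc.prems by (intro Ck_on_add[OF assms(1)] Suc.IH) (auto intro: Ck_on_Suc_imp)
  qed
qed

lemma Ck_on_compose:
  fixes f :: "'a::real_normed_vector \<Rightarrow> 'b::euclidean_space"
  assumes "open S" "open T" "f ` S \<subseteq> T" "Ck_on k h T" "Ck_on k f S"
  shows "Ck_on k (\<lambda>x. h (f x)) S"
  using assms(4,5)
proof (induction k arbitrary: h)
  case 0
  then show ?case using continuous_on_compose2 assms(3) by auto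
next
  case (Suc k)
  have f: "(f has_derivative pd f x) (at x)" if "x \<in> S" for x
    using Ck_on_SucD[OF Suc.prems(2) that] .
  have h: "(h has_derivative pd h (f x)) (at (f x))" if "x \<in> S" for x
    using Ck_on_SucD[OF Suc.prems(1)] that assms(3) by blast
  show ?case
  proof (rule Ck_on_SucI[OF assms(1)])
    fix x assume x: "x \<in> S"
    have lin: "linear (pd h (f x))"
      using h[OF x] has_derivative_linear by blast
    have "((\<lambda>x. h (f x)) has_derivative
        (\<lambda>v. pd h (f x) (pd f x v))) (at x)"
      using has_derivative_compose[OF f[OF x] h[OF x]] .
    \<comment> \<open>The direction \<open>pd f x v\<close> moves with \<open>x\<close>, so the
      induction hypothesis does not apply to this expression. Expanding it in a basis leaves
      derivatives of \<open>h\<close> in fixed directions \<open>b\<close>, multiplied by scalar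
      functions.\<close>
    moreover have "(\<lambda>v. pd h (f x) (pd f x v)) =
        (\<lambda>v. \<Sum>b\<in>Basis. (pd f x v \<bullet> b) *\<^sub>R pd h (f x) b)"
    proof
      fix v
      let ?w = "pd f x v"
      have "pd h (f x) (\<Sum>b\<in>Basis. (?w \<bullet> b) *\<^sub>R b) =
          (\<Sum>b\<in>Basis. (?w \<bullet> b) *\<^sub>R pd h (f x) b)"
        by (simp only: linear_sum[OF lin] linear_scale[OF lin])
      then show "pd h (f x) ?w =
          (\<Sum>b\<in>Basis. (?w \<bullet> b) *\<^sub>R pd h (f x) b)"
        by (simp only: euclidean_representation)
    qed
    ultimately show "((\<lambda>x. h (f x)) has_derivative
        (\<lambda>v. \<Sum>b\<in>Basis. (pd f x v \<bullet> b) *\<^sub>R pd h (f x) b)) (at x)"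
      by (simp only:)
  next
    fix v
    have "Ck_on k f S" using Suc.prems(2) by (rule Ck_on_Suc_imp)
    then have "Ck_on k (\<lambda>x. pd h (f x) b) S" for b
      using Suc.prems(1) Suc.IH[of "\<lambda>y. pd h y b"] by simp
    moreover have "Ck_on k (\<lambda>x. pd f x v \<bullet> b) S" for b
      using Suc.prems(2) Ck_on_bounded_linear[OF assms(1) bounded_linear_inner_left[of b]] by simp
    ultimately show "Ck_on k (\<lambda>x. \<Sum>b\<in>Basis. (pd f x v \<bullet> b) *\<^sub>R pd h (f x) b) S"
      by (intro Ck_on_sum assms(1)) (rule Ck_on_bilinear[OF assms(1) bounded_bilinear_scaleR])
  qed
qed

lemma smooth_on_has_derivative:
  "smooth_on f S \<Longrightarrow> x \<in> S \<Longrightarrow> (f has_derivative pd f x) (at x)"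
  unfolding smooth_on_def by (rule Ck_on_SucD[of 0 f S x]) blast+

lemma smooth_on_differentiable: "smooth_on f S \<Longrightarrow> x \<in> S \<Longrightarrow> f differentiable (at x)"
  using smooth_on_has_derivative[of f S x] differentiable_def by blast

lemma smooth_on_frechet_derivative:
  "smooth_on f S \<Longrightarrow> smooth_on (\<lambda>x. pd f x v) S"
  unfolding smooth_on_def
proof
  fix k assume "\<forall>k. Ck_on k f S"
  then have "Ck_on (Suc k) f S" by blast
  then show "Ck_on k (\<lambda>x. pd f x v) S" by simp
qed

lemma smooth_on_bounded_linear:
  "smooth_on f S \<Longrightarrow> open S \<Longrightarrow> bounded_linear L \<Longrightarrow> smooth_on (\<lambda>x. L (f x)) S"
  unfolding smooth_on_def using Ck_on_bounded_linear[of S L _ f] by simp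

lemma smooth_on_linear:
  fixes f :: "'a::real_normed_vector \<Rightarrow> 'b::euclidean_space"
  shows "smooth_on f S \<Longrightarrow> open S \<Longrightarrow> linear L \<Longrightarrow> smooth_on (\<lambda>x. L (f x)) S"
  by (simp add: linear_conv_bounded_linear smooth_on_bounded_linear)

lemma smooth_on_add:
  "smooth_on f S \<Longrightarrow> smooth_on g S \<Longrightarrow> open S \<Longrightarrow> smooth_on (\<lambda>x. f x + g x) S"
  unfolding smooth_on_def using Ck_on_add[of S _ f g] by simp

lemma smooth_on_sum:
  "(\<And>i. i \<in> I \<Longrightarrow> smooth_on (f i) S) \<Longrightarrow> open S \<Longrightarrow> smooth_on (\<lambda>x. \<Sum>i\<in>I. f i x) S"
  unfolding smooth_on_def using Ck_on_sum[of S I _ f] by simp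

lemma smooth_on_bilinear:
  "smooth_on f S \<Longrightarrow> smooth_on g S \<Longrightarrow> open S \<Longrightarrow> bounded_bilinear B \<Longrightarrow>
   smooth_on (\<lambda>x. B (f x) (g x)) S"
  unfolding smooth_on_def using Ck_on_bilinear[of S B _ f g] by simp

lemmas smooth_on_scaleR = smooth_on_bilinear[OF _ _ _ bounded_bilinear_scaleR]
lemmas smooth_on_mult = smooth_on_bilinear[OF _ _ _ bounded_bilinear_mult]
lemmas smooth_on_inner = smooth_on_bilinear[OF _ _ _ bounded_bilinear_inner]

lemma smooth_on_minus: "smooth_on f S \<Longrightarrow> open S \<Longrightarrow> smooth_on (\<lambda>x. - f x) S"
  using smooth_on_bounded_linear[OF _ _ bounded_linear_minus[OF bounded_linear_ident]] .

lemma smooth_on_diff: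
  "smooth_on f S \<Longrightarrow> smooth_on g S \<Longrightarrow> open S \<Longrightarrow> smooth_on (\<lambda>x. f x - g x) S"
  using smooth_on_add[of f S "\<lambda>x. - g x"] smooth_on_minus[of g S] by simp

lemma smooth_on_compose:
  fixes f :: "'a::real_normed_vector \<Rightarrow> 'b::euclidean_space"
  shows "smooth_on h T \<Longrightarrow> smooth_on f S \<Longrightarrow> open S \<Longrightarrow> open T \<Longrightarrow> f ` S \<subseteq> T \<Longrightarrow>
    smooth_on (\<lambda>x. h (f x)) S"
  unfolding smooth_on_def using Ck_on_compose[of S T f _ h] by simp

lemma smooth_on_id: "open S \<Longrightarrow> smooth_on (\<lambda>x. x) S"
  unfolding smooth_on_def
proof
  fix k assume "open S"
  then show "Ck_on k (\<lambda>x. x) S"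
    by (cases k) (auto intro!: Ck_on_const)
qed

lemma smooth_on_Pair:
  "smooth_on f S \<Longrightarrow> smooth_on g S \<Longrightarrow> open S \<Longrightarrow> smooth_on (\<lambda>x. (f x, g x)) S"
proof -
  assume a: "smooth_on f S" "smooth_on g S" "open S"
  have "smooth_on (\<lambda>x. (f x, 0) + (0, g x)) S"
    using a by (intro smooth_on_add smooth_on_bounded_linear[where L = "\<lambda>x. (x, 0)"]
        smooth_on_bounded_linear[where L = "\<lambda>x. (0, x)"] bounded_linear_Pair
        bounded_linear_ident bounded_linear_zero)
  then show ?thesis by simp
qed

lemma smooth_on_fst: "smooth_on f S \<Longrightarrow> open S \<Longrightarrow> smooth_on (\<lambda>x. fst (f x)) S"
  by (rule smooth_on_bounded_linear[OF _ _ bounded_linear_fst])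

lemma smooth_on_snd: "smooth_on f S \<Longrightarrow> open S \<Longrightarrow> smooth_on (\<lambda>x. snd (f x)) S"
  by (rule smooth_on_bounded_linear[OF _ _ bounded_linear_snd])

text \<open>\<open>frechet_derivative\<close> is taken at the point and not relative to the set, so
  restricting to \<open>S \<inter> U\<close> affects only the continuity statement at order
  0.\<close>

lemma Ck_on_local:
  assumes "\<And>x. x \<in> S \<Longrightarrow> \<exists>U. open U \<and> x \<in> U \<and> Ck_on k f (S \<inter> U)"
  shows "Ck_on k f S"
  using assms
proof (induction k arbitrary: f)
  case 0
  show ?case
    unfolding Ck_on.simps continuous_on_eq_continuous_within
  proof
    fix x assume x: "x \<in> S"
    then obtain U where U: "open U" "x \<in> U" "continuous_on (S \<inter> U) f" using 0 by auto
    then have "continuous (at x within S \<inter> U) f"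
      using x by (auto simp: continuous_on_eq_continuous_within)
    moreover have "at x within S \<inter> U = at x within S"
      by (rule at_within_nhd[OF U(2,1)]) auto
    ultimately show "continuous (at x within S) f" by simp
  qed
next
  case (Suc k)
  have "f differentiable (at x)" if "x \<in> S" for x using Suc.prems[OF that] that by auto
  moreover have "Ck_on k (\<lambda>x. pd f x v) S" for v
  proof (rule Suc.IH)
    fix x assume "x \<in> S"
    then obtain U where "open U" "x \<in> U" "Ck_on (Suc k) f (S \<inter> U)" using Suc.prems by blast
    then show "\<exists>U. open U \<and> x \<in> U \<and> Ck_on k (\<lambda>x. pd f x v) (S \<inter> U)"
      by auto
  qed
  ultimately show ?case by simp
qed

lemma smooth_on_local:
  assumes "\<And>x. x \<in> S \<Longrightarrow> \<exists>U. open U \<and> x \<in> U \<and> smooth_on f (S \<inter> U)"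
  shows "smooth_on f S"
  unfolding smooth_on_def
proof (intro allI Ck_on_local)
  fix k x assume "x \<in> S"
  then show "\<exists>U. open U \<and> x \<in> U \<and> Ck_on k f (S \<inter> U)"
    using assms unfolding smooth_on_def by blast
qed

text \<open>The exponent varies in the induction because each derivative lowers it by one. The
  exponent -1/2 will normalise vectors in the Gram-Schmidt process.\<close>

lemma Ck_on_powr: "Ck_on k (\<lambda>x::real. x powr a) {0<..}"
proof (induction k arbitrary: a)
  case 0
  then show ?case by (auto intro!: continuous_intros)
next
  case (Suc k)
  show ?case
  proof (rule Ck_on_SucI)
    show "((\<lambda>x. x powr a) has_derivative (\<lambda>v. v * (a * x powr (a - 1)))) (at x)" if "x \<in> {0<..}" for x
      using has_real_derivative_powr[of x a] that
      by (simp add: has_field_derivative_def mult.commute[of _ "a * x powr (a - 1)"])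
    show "Ck_on k (\<lambda>x. v * (a * x powr (a - 1))) {0<..}" for v
      using Ck_on_bounded_linear[OF _ bounded_linear_mult_right[of "v * a"] Suc[of "a - 1"]]
      by (simp add: mult.assoc)
  qed auto
qed

lemma smooth_on_powr:
  fixes f :: "'a::real_normed_vector \<Rightarrow> real"
  shows "smooth_on f S \<Longrightarrow> open S \<Longrightarrow> (\<And>x. x \<in> S \<Longrightarrow> 0 < f x) \<Longrightarrow> smooth_on (\<lambda>x. f x powr a) S"
  using smooth_on_compose[of "\<lambda>x::real. x powr a" "{0<..}" f S] Ck_on_powr[of _ a]
  by (auto simp: smooth_on_def)

section \<open>Symmetry of second derivatives\<close>

lemma has_derivative_along_line:
  assumes "(f has_derivative f') (at (x + r *\<^sub>R u))"
  shows "((\<lambda>r. f (x + r *\<^sub>R u)) has_vector_derivative f' u) (at r)"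
proof -
  have "((\<lambda>r. x + r *\<^sub>R u) has_derivative (\<lambda>h. h *\<^sub>R u)) (at r)"
    by (auto intro!: derivative_eq_intros)
  from has_derivative_compose[OF this assms]
  show ?thesis
    by (simp add: has_vector_derivative_def linear_scale[OF has_derivative_linear[OF assms]])
qed

text \<open>The mean value theorem twice: in direction \<open>u\<close> for the difference between
  \<open>f\<close> and its translate by \<open>s *\<^sub>R v\<close>, then in direction
  \<open>v\<close> for the derivative \<open>F\<close>. The left side is symmetric in
  \<open>u\<close> and \<open>v\<close>, while the right side singles out an order of
  differentiation.\<close>

lemma second_difference_mean_value:
  fixes f :: "'a::real_normed_vector \<Rightarrow> real"
  assumes f: "smooth_on f S" and s: "s > 0"
    and sub: "\<And>a b. 0 \<le> a \<Longrightarrow> a \<le> s \<Longrightarrow> 0 \<le> b \<Longrightarrow> b \<le> s \<Longrightarrow> x + a *\<^sub>R u + b *\<^sub>R v \<in> S"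
  shows "\<exists>a b. 0 \<le> a \<and> a \<le> s \<and> 0 \<le> b \<and> b \<le> s \<and>
    f (x + s *\<^sub>R u + s *\<^sub>R v) - f (x + s *\<^sub>R u) - f (x + s *\<^sub>R v) + f x =
    s * s * pd (\<lambda>y. pd f y u) (x + a *\<^sub>R u + b *\<^sub>R v) v"
proof -
  define F where "F = (\<lambda>y. pd f y u)"
  have F: "smooth_on F S" unfolding F_def by (rule smooth_on_frechet_derivative[OF f])
  have d: "((\<lambda>r. f (y + r *\<^sub>R u)) has_real_derivative F (y + r *\<^sub>R u)) (at r)"
    if "y + r *\<^sub>R u \<in> S" for y r
    using has_derivative_along_line[OF smooth_on_has_derivative[OF f that]]
    by (simp add: has_real_derivative_iff_has_vector_derivative F_def)
  have e: "((\<lambda>r. F (y + r *\<^sub>R v)) has_real_derivative pd F (y + r *\<^sub>R v) v) (at r)"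
    if "y + r *\<^sub>R v \<in> S" for y r
    using has_derivative_along_line[OF smooth_on_has_derivative[OF F that]]
    by (simp add: has_real_derivative_iff_has_vector_derivative)
  have "\<exists>a>0. a < s \<and> (f ((x + s *\<^sub>R v) + s *\<^sub>R u) - f (x + s *\<^sub>R u)) -
      (f ((x + s *\<^sub>R v) + 0 *\<^sub>R u) - f (x + 0 *\<^sub>R u)) =
      (s - 0) * (F ((x + s *\<^sub>R v) + a *\<^sub>R u) - F (x + a *\<^sub>R u))"
  proof (rule MVT2[OF s])
    fix r assume r: "0 \<le> r" "r \<le> s"
    have "(x + s *\<^sub>R v) + r *\<^sub>R u \<in> S" "x + r *\<^sub>R u \<in> S"
      using sub[of r s] sub[of r 0] r s by (auto simp: algebra_simps)
    then show "((\<lambda>r. f ((x + s *\<^sub>R v) + r *\<^sub>R u) - f (x + r *\<^sub>R u)) has_real_derivative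
      (F ((x + s *\<^sub>R v) + r *\<^sub>R u) - F (x + r *\<^sub>R u))) (at r)"
      by (intro DERIV_diff d)
  qed
  then obtain a where a: "0 < a" "a < s" and aeq:
    "(f ((x + s *\<^sub>R v) + s *\<^sub>R u) - f (x + s *\<^sub>R u)) -
      (f ((x + s *\<^sub>R v) + 0 *\<^sub>R u) - f (x + 0 *\<^sub>R u)) =
      s * (F ((x + s *\<^sub>R v) + a *\<^sub>R u) - F (x + a *\<^sub>R u))" by auto
  have "\<exists>b>0. b < s \<and> F ((x + a *\<^sub>R u) + s *\<^sub>R v) - F ((x + a *\<^sub>R u) + 0 *\<^sub>R v) =
      (s - 0) * pd F ((x + a *\<^sub>R u) + b *\<^sub>R v) v"
    by (rule MVT2[OF s]) (use sub a in \<open>auto intro!: e\<close>)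
  then obtain b where "0 < b" "b < s" "F ((x + a *\<^sub>R u) + s *\<^sub>R v) - F (x + a *\<^sub>R u) =
      s * pd F ((x + a *\<^sub>R u) + b *\<^sub>R v) v" by auto
  with aeq a show ?thesis
    by (intro exI[of _ a] exI[of _ b]) (auto simp: F_def algebra_simps)
qed

text \<open>The second difference is symmetric in \<open>u\<close> and \<open>v\<close>, so some
  value of one mixed derivative near \<open>x\<close> equals some value of the other near
  \<open>x\<close>. Continuity at \<open>x\<close> then bounds their difference at \<open>x\<close>
  by every positive \<open>e\<close>.\<close>

lemma frechet_derivative_symmetric_real:
  fixes f :: "'a::real_normed_vector \<Rightarrow> real"
  assumes "open S" "smooth_on f S" "x \<in> S"
  shows "pd (\<lambda>y. pd f y u) x v =
    pd (\<lambda>y. pd f y v) x u"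
proof -
  define D where "D u v y = pd (\<lambda>y. pd f y u) y v" for u v y
  have cont: "continuous (at x) (D u v)" for u v
  proof -
    have "smooth_on (D u v) S"
      unfolding D_def by (intro smooth_on_frechet_derivative assms)
    then show ?thesis
      using assms(3) differentiable_imp_continuous_within smooth_on_differentiable by blast
  qed
  have "\<bar>D u v x - D v u x\<bar> \<le> e" if e: "e > 0" for e
  proof -
    have "\<exists>d>0. \<forall>y. dist y x < d \<longrightarrow> \<bar>D u v y - D u v x\<bar> < e / 2"
      "\<exists>d>0. \<forall>y. dist y x < d \<longrightarrow> \<bar>D v u y - D v u x\<bar> < e / 2"
      using cont e unfolding continuous_at_eps_delta dist_real_def by (meson half_gt_zero)+
    then obtain d1 d2 where d: "d1 > 0" "d2 > 0"
      "\<And>y. dist y x < d1 \<Longrightarrow> \<bar>D u v y - D u v x\<bar> < e / 2"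
      "\<And>y. dist y x < d2 \<Longrightarrow> \<bar>D v u y - D v u x\<bar> < e / 2" by blast
    obtain d3 where d3: "d3 > 0" "ball x d3 \<subseteq> S"
      using assms(1,3) open_contains_ball by blast
    define d where "d = min d3 (min d1 d2)"
    \<comment> \<open>With this \<open>s\<close> every combination of \<open>u\<close> and
      \<open>v\<close> with coefficients in \<open>[0, s]\<close> has norm at most
      \<open>d / 2\<close>; the summand 1 keeps the denominator positive when \<open>u\<close> and
      \<open>v\<close> are zero.\<close>
    define s where "s = d / (2 * (norm u + norm v + 1))"
    have dpos: "d > 0" using d d3 by (simp add: d_def)
    have spos: "s > 0" using dpos by (simp add: s_def add_nonneg_pos)
    have near: "dist (x + a *\<^sub>R u + b *\<^sub>R v) x < d" "dist (x + a *\<^sub>R v + b *\<^sub>R u) x < d"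
      if "0 \<le> a" "a \<le> s" "0 \<le> b" "b \<le> s" for a b
    proof -
      have *: "norm (a *\<^sub>R u + b *\<^sub>R v) < d" if "0 \<le> a" "a \<le> s" "0 \<le> b" "b \<le> s" for a b
      proof -
        have "norm (a *\<^sub>R u + b *\<^sub>R v) \<le> a * norm u + b * norm v"
          using norm_triangle_ineq[of "a *\<^sub>R u" "b *\<^sub>R v"] that by simp
        also have "\<dots> \<le> s * (norm u + norm v + 1)"
          using that mult_right_mono[of a s "norm u"] mult_right_mono[of b s "norm v"]
          by (simp add: algebra_simps)
        also have "\<dots> = d / 2"
          using add_nonneg_pos[of "norm u + norm v" 1] by (simp add: s_def field_simps)
        also have "\<dots> < d" using dpos by simp
        finally show ?thesis .
      qed
      show "dist (x + a *\<^sub>R u + b *\<^sub>R v) x < d" using *[OF that] by (simp add: dist_norm add.assoc)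
      show "dist (x + a *\<^sub>R v + b *\<^sub>R u) x < d"
        using *[of b a] that by (simp add: dist_norm add.assoc add.commute)
    qed
    have inS: "y \<in> S" if "dist y x < d" for y
      using that d3 by (auto simp: d_def dist_commute subset_eq)
    obtain a b where ab: "0 \<le> a" "a \<le> s" "0 \<le> b" "b \<le> s"
      "f (x + s *\<^sub>R u + s *\<^sub>R v) - f (x + s *\<^sub>R u) - f (x + s *\<^sub>R v) + f x =
        s * s * D u v (x + a *\<^sub>R u + b *\<^sub>R v)"
      using second_difference_mean_value[OF assms(2) spos, of x u v] near inS unfolding D_def by blast
    obtain a' b' where ab': "0 \<le> a'" "a' \<le> s" "0 \<le> b'" "b' \<le> s"
      "f (x + s *\<^sub>R v + s *\<^sub>R u) - f (x + s *\<^sub>R v) - f (x + s *\<^sub>R u) + f x =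
        s * s * D v u (x + a' *\<^sub>R v + b' *\<^sub>R u)"
      using second_difference_mean_value[OF assms(2) spos, of x v u] near inS unfolding D_def by blast
    have "s * s * D u v (x + a *\<^sub>R u + b *\<^sub>R v) = s * s * D v u (x + a' *\<^sub>R v + b' *\<^sub>R u)"
      using ab(5) ab'(5) by (simp add: algebra_simps)
    then have "D u v (x + a *\<^sub>R u + b *\<^sub>R v) = D v u (x + a' *\<^sub>R v + b' *\<^sub>R u)"
      using spos by simp
    moreover have "\<bar>D u v (x + a *\<^sub>R u + b *\<^sub>R v) - D u v x\<bar> < e / 2"
      using near(1)[OF ab(1-4)] by (intro d) (simp add: d_def)
    moreover have "\<bar>D v u (x + a' *\<^sub>R v + b' *\<^sub>R u) - D v u x\<bar> < e / 2"
      using near(2)[OF ab'(1-4)] by (intro d) (simp add: d_def)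
    ultimately show ?thesis by linarith
  qed
  then have "D u v x = D v u x"
    using field_le_epsilon[of "\<bar>D u v x - D v u x\<bar>" 0] by simp
  then show ?thesis by (simp add: D_def)
qed

lemma frechet_derivative_bounded_linear:
  assumes "f differentiable (at x)" "bounded_linear L"
  shows "pd (\<lambda>y. L (f y)) x = (\<lambda>v. L (pd f x v))"
  by (rule frechet_derivative_at[OF bounded_linear.has_derivative[OF assms(2)
        assms(1)[unfolded frechet_derivative_works]], symmetric])

lemma frechet_derivative_symmetric:
  fixes f :: "'a::real_normed_vector \<Rightarrow> 'b::euclidean_space"
  assumes "open S" "smooth_on f S" "x \<in> S"
  shows "pd (\<lambda>y. pd f y u) x v =
    pd (\<lambda>y. pd f y v) x u"
proof (rule euclidean_eqI)
  fix b :: 'b assume "b \<in> Basis"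
  have sm: "smooth_on (\<lambda>y. f y \<bullet> b) S"
    by (rule smooth_on_bounded_linear[OF assms(2,1) bounded_linear_inner_left])
  have *: "pd (\<lambda>y. pd f y u) x v \<bullet> b =
      pd (\<lambda>y. pd (\<lambda>y. f y \<bullet> b) y u) x v" for u v
  proof -
    have "pd (\<lambda>y. pd f y u \<bullet> b) x =
        pd (\<lambda>y. pd (\<lambda>y. f y \<bullet> b) y u) x"
    proof (rule frechet_derivative_transform_within_open[OF _ assms(1,3)])
      show "(\<lambda>y. pd f y u \<bullet> b) differentiable at x"
        by (rule smooth_on_differentiable[OF _ assms(3)])
           (rule smooth_on_bounded_linear[OF smooth_on_frechet_derivative[OF assms(2)] assms(1) bounded_linear_inner_left])
    next
      fix y assume "y \<in> S"
      then show "pd f y u \<bullet> b = pd (\<lambda>y. f y \<bullet> b) y u"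
        by (simp add: frechet_derivative_bounded_linear[OF smooth_on_differentiable[OF assms(2)]
              bounded_linear_inner_left])
    qed
    moreover have "pd (\<lambda>y. pd f y u \<bullet> b) x =
        (\<lambda>v. pd (\<lambda>y. pd f y u) x v \<bullet> b)"
      by (rule frechet_derivative_bounded_linear[OF smooth_on_differentiable[OF
              smooth_on_frechet_derivative[OF assms(2)] assms(3)] bounded_linear_inner_left])
    ultimately show ?thesis by metis
  qed
  show "pd (\<lambda>y. pd f y u) x v \<bullet> b =
    pd (\<lambda>y. pd f y v) x u \<bullet> b"
    unfolding * by (rule frechet_derivative_symmetric_real[OF assms(1) sm assms(3)])
qed

section \<open>Linear and bilinear maps depending on a point\<close>

lemma linear_basis_expansion:
  fixes L :: "'a::euclidean_space \<Rightarrow> 'b::real_vector"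
  assumes "linear L"
  shows "L u = (\<Sum>i\<in>Basis. (u \<bullet> i) *\<^sub>R L i)"
proof -
  have "L (\<Sum>i\<in>Basis. (u \<bullet> i) *\<^sub>R i) = (\<Sum>i\<in>Basis. (u \<bullet> i) *\<^sub>R L i)"
    by (simp only: linear_sum[OF assms] linear_scale[OF assms])
  then show ?thesis by (simp only: euclidean_representation)
qed

text \<open>Tensors are known to be smooth on constant arguments; the basis expansion, a finite sum
  of products, transfers this to arguments that vary with the point.\<close>

lemma smooth_on_linear_family:
  fixes L :: "'a::real_normed_vector \<Rightarrow> 'b::euclidean_space \<Rightarrow> 'c::real_normed_vector"
  assumes "open S" "\<And>x. x \<in> S \<Longrightarrow> linear (L x)" "\<And>u. smooth_on (\<lambda>x. L x u) S" "smooth_on h S"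
  shows "smooth_on (\<lambda>x. L x (h x)) S"
proof (rule smooth_on_cong[OF _ assms(1)])
  show "smooth_on (\<lambda>x. \<Sum>i\<in>Basis. (h x \<bullet> i) *\<^sub>R L x i) S"
    using assms(1,3,4)
    by (intro smooth_on_sum smooth_on_scaleR smooth_on_bounded_linear[OF _ _ bounded_linear_inner_left])
  show "(\<Sum>i\<in>Basis. (h x \<bullet> i) *\<^sub>R L x i) = L x (h x)" if "x \<in> S" for x
    using linear_basis_expansion[OF assms(2)[OF that], of "h x"] by simp
qed

text \<open>Product rule for evaluation: the first summand differentiates the family with the
  argument frozen at \<open>h x\<close>.\<close>

lemma has_derivative_linear_family:
  fixes L :: "'a::real_normed_vector \<Rightarrow> 'b::euclidean_space \<Rightarrow> 'c::real_normed_vector"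
  assumes "open S" "x \<in> S" "\<And>x. x \<in> S \<Longrightarrow> linear (L x)"
    and "\<And>u. (\<lambda>x. L x u) differentiable (at x)" "(h has_derivative h') (at x)"
  shows "((\<lambda>x. L x (h x)) has_derivative
    (\<lambda>v. pd (\<lambda>y. L y (h x)) x v + L x (h' v))) (at x)"
proof -
  have L: "((\<lambda>x. L x u) has_derivative pd (\<lambda>x. L x u) x) (at x)" for u
    using assms(4) by (simp add: frechet_derivative_works)
  have 1: "((\<lambda>y. \<Sum>i\<in>Basis. (h y \<bullet> i) *\<^sub>R L y i) has_derivative
      (\<lambda>v. \<Sum>i\<in>Basis. (h x \<bullet> i) *\<^sub>R pd (\<lambda>y. L y i) x v + (h' v \<bullet> i) *\<^sub>R L x i)) (at x)"
    by (intro has_derivative_sum has_derivative_scaleR L has_derivative_inner_left assms(5))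
  have 2: "((\<lambda>y. \<Sum>i\<in>Basis. (h x \<bullet> i) *\<^sub>R L y i) has_derivative
      (\<lambda>v. \<Sum>i\<in>Basis. (h x \<bullet> i) *\<^sub>R pd (\<lambda>y. L y i) x v)) (at x)"
    by (intro has_derivative_sum has_derivative_scaleR_right L)
  have "((\<lambda>y. L y (h x)) has_derivative
      (\<lambda>v. \<Sum>i\<in>Basis. (h x \<bullet> i) *\<^sub>R pd (\<lambda>y. L y i) x v)) (at x)"
    by (rule has_derivative_transform_within_open[OF 2 assms(1,2)])
       (rule linear_basis_expansion[OF assms(3), symmetric])
  from frechet_derivative_at[OF this, symmetric]
  have 3: "pd (\<lambda>y. L y (h x)) x =
      (\<lambda>v. \<Sum>i\<in>Basis. (h x \<bullet> i) *\<^sub>R pd (\<lambda>y. L y i) x v)" .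
  have 4: "(\<lambda>v. pd (\<lambda>y. L y (h x)) x v + L x (h' v)) =
      (\<lambda>v. \<Sum>i\<in>Basis. (h x \<bullet> i) *\<^sub>R pd (\<lambda>y. L y i) x v + (h' v \<bullet> i) *\<^sub>R L x i)"
    unfolding 3 sum.distrib
    by (subst linear_basis_expansion[OF assms(3)[OF assms(2)]]) (rule refl)
  show ?thesis
    unfolding 4
    by (rule has_derivative_transform_within_open[OF 1 assms(1,2)])
       (rule linear_basis_expansion[OF assms(3), symmetric])
qed

text \<open>The coordinate expression of a bilinear tensor field. Asking for smoothness on constant
  arguments is enough because the argument spaces are finite-dimensional; see
  \<open>smooth_bil_apply\<close>.\<close>

definition smooth_bil ::
  "('a::real_normed_vector \<Rightarrow> 'b::euclidean_space \<Rightarrow> 'c::euclidean_space \<Rightarrow> 'd::real_normed_vector) \<Rightarrow> 'a set \<Rightarrow> bool" where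
  "smooth_bil B S \<longleftrightarrow> open S \<and> (\<forall>x\<in>S. bilinear (B x)) \<and> (\<forall>u v. smooth_on (\<lambda>x. B x u v) S)"

lemma smooth_bil_bilinear: "smooth_bil B S \<Longrightarrow> x \<in> S \<Longrightarrow> bilinear (B x)"
  by (simp add: smooth_bil_def)

lemma smooth_bil_subset: "smooth_bil B S \<Longrightarrow> open T \<Longrightarrow> T \<subseteq> S \<Longrightarrow> smooth_bil B T"
  unfolding smooth_bil_def by (meson smooth_on_subset subsetD)

lemma smooth_bil_linear:
  assumes "smooth_bil B S" "x \<in> S"
  shows "linear (B x u)" "linear (\<lambda>u. B x u v)"
  using assms by (auto simp: smooth_bil_def bilinear_def)

lemma smooth_bil_apply:
  assumes B: "smooth_bil B S" and "smooth_on f S" "smooth_on h S"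
  shows "smooth_on (\<lambda>x. B x (f x) (h x)) S"
proof -
  have 1: "smooth_on (\<lambda>x. B x (f x) v) S" for v
    by (rule smooth_on_linear_family[of S "\<lambda>x u. B x u v"])
       (use B assms(2) smooth_bil_linear(2)[OF B] in \<open>auto simp: smooth_bil_def\<close>)
  show ?thesis
    by (rule smooth_on_linear_family[of S "\<lambda>x. B x (f x)"])
       (use B assms 1 smooth_bil_linear(1)[OF B] in \<open>auto simp: smooth_bil_def\<close>)
qed

lemma has_derivative_smooth_bil:
  assumes B: "smooth_bil B S" and x: "x \<in> S"
    and f: "(f has_derivative f') (at x)" and h: "(h has_derivative h') (at x)"
  shows "((\<lambda>y. B y (f y) (h y)) has_derivative
    (\<lambda>v. pd (\<lambda>y. B y (f x) (h x)) x v + B x (f' v) (h x) + B x (f x) (h' v))) (at x)"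
proof -
  have S: "open S" using B by (simp add: smooth_bil_def)
  have d: "(\<lambda>y. B y u v) differentiable (at x)" for u v
    using B x by (intro smooth_on_differentiable[where S = S]) (auto simp: smooth_bil_def)
  have 1: "((\<lambda>y. B y (f y) v) has_derivative
      (\<lambda>w. pd (\<lambda>y. B y (f x) v) x w + B x (f' w) v)) (at x)" for v
    by (rule has_derivative_linear_family[OF S x, of "\<lambda>x u. B x u v"])
       (use smooth_bil_linear(2)[OF B] d f in auto)
  have "((\<lambda>y. B y (f y) (h y)) has_derivative
      (\<lambda>w. pd (\<lambda>y. B y (f y) (h x)) x w + B x (f x) (h' w))) (at x)"
    by (rule has_derivative_linear_family[OF S x, of "\<lambda>x. B x (f x)"])
       (use smooth_bil_linear(1)[OF B] 1 h in \<open>auto simp: differentiable_def\<close>)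
  then show ?thesis unfolding frechet_derivative_at[OF 1, symmetric] .
qed

lemma pd_smooth_bil:
  assumes "smooth_bil B S" "x \<in> S" "f differentiable (at x)" "h differentiable (at x)"
  shows "pd (\<lambda>y. B y (f y) (h y)) x v =
    pd (\<lambda>y. B y (f x) (h x)) x v + B x (pd f x v) (h x) + B x (f x) (pd h x v)"
  by (simp only: frechet_derivative_at[OF has_derivative_smooth_bil[OF assms(1,2)
          assms(3,4)[unfolded frechet_derivative_works]], symmetric])

lemma smooth_bil_differentiable:
  "smooth_bil B S \<Longrightarrow> x \<in> S \<Longrightarrow> (\<lambda>y. B y u v) differentiable (at x)"
  by (rule smooth_on_differentiable[where S = S]) (auto simp: smooth_bil_def)

lemma linear_pd: "f differentiable (at x) \<Longrightarrow> linear (pd f x)"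
  by (rule linear_frechet_derivative)

text \<open>Additivity and homogeneity hold identically on the open set \<open>S\<close>, so they
  can be differentiated in the base point.\<close>

lemma bilinear_pd_smooth_bil:
  assumes B: "smooth_bil B S" and x: "x \<in> S"
  shows "bilinear (\<lambda>u v. pd (\<lambda>y. B y u v) x w)"
proof -
  have S: "open S" using B by (simp add: smooth_bil_def)
  have eqI: "pd F x w = pd G x w" if "G differentiable (at x)" "\<And>y. y \<in> S \<Longrightarrow> G y = F y" for F G :: "'a \<Rightarrow> 'd"
    using frechet_derivative_transform_within_open[OF that(1) S x that(2)] by simp
  note D = smooth_bil_differentiable[OF B x]
  have a: "pd (\<lambda>y. f y + h y) x w = pd f x w + pd h x w"
    if "f differentiable (at x)" "h differentiable (at x)" for f h :: "'a \<Rightarrow> 'd"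
    by (simp only: frechet_derivative_at[OF has_derivative_add[OF that[unfolded frechet_derivative_works]], symmetric])
  have s: "pd (\<lambda>y. r *\<^sub>R f y) x w = r *\<^sub>R pd f x w"
    if "f differentiable (at x)" for f :: "'a \<Rightarrow> 'd" and r
    by (simp only: frechet_derivative_at[OF has_derivative_scaleR_right[OF that[unfolded frechet_derivative_works]], symmetric])
  note BB = smooth_bil_bilinear[OF B]
  show ?thesis
    unfolding bilinear_def
  proof (intro conjI allI linearI)
    fix u v v'
    show "pd (\<lambda>y. B y u (v + v')) x w = pd (\<lambda>y. B y u v) x w + pd (\<lambda>y. B y u v') x w"
      by (rule trans[OF eqI a[OF D D]]) (auto intro!: differentiable_add D simp: bilinear_radd[OF BB])
    show "pd (\<lambda>y. B y u (r *\<^sub>R v)) x w = r *\<^sub>R pd (\<lambda>y. B y u v) x w" for r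
      by (rule trans[OF eqI s[OF D]]) (auto intro!: differentiable_scaleR D simp: bilinear_rmul[OF BB])
  next
    fix u u' v
    show "pd (\<lambda>y. B y (u + u') v) x w = pd (\<lambda>y. B y u v) x w + pd (\<lambda>y. B y u' v) x w"
      by (rule trans[OF eqI a[OF D D]]) (auto intro!: differentiable_add D simp: bilinear_ladd[OF BB])
    show "pd (\<lambda>y. B y (r *\<^sub>R u) v) x w = r *\<^sub>R pd (\<lambda>y. B y u v) x w" for r
      by (rule trans[OF eqI s[OF D]]) (auto intro!: differentiable_scaleR D simp: bilinear_lmul[OF BB])
  qed
qed

section \<open>Orthonormal frames and bump functions\<close>

definition posdef :: "('e::euclidean_space \<Rightarrow> 'e \<Rightarrow> real) \<Rightarrow> bool" where
  "posdef g \<longleftrightarrow> bilinear g \<and> (\<forall>u v. g u v = g v u) \<and> (\<forall>u. u \<noteq> 0 \<longrightarrow> 0 < g u u)"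

text \<open>The property selected by \<open>SOME\<close> in \<open>onb\<close>, named so that bases
  other than the chosen one can be used.\<close>

definition is_onb :: "('e::euclidean_space \<Rightarrow> 'e \<Rightarrow> real) \<Rightarrow> 'e set \<Rightarrow> bool" where
  "is_onb g B \<longleftrightarrow> finite B \<and> card B = DIM('e) \<and>
     (\<forall>b\<in>B. \<forall>c\<in>B. g b c = (if b = c then 1 else 0))"

lemma bilinear_sum_left: "bilinear h \<Longrightarrow> h (\<Sum>i\<in>I. f i) v = (\<Sum>i\<in>I. h (f i) v)"
  unfolding bilinear_def using linear_sum[of "\<lambda>u. h u v" f I] by auto

lemma bilinear_sum_right: "bilinear h \<Longrightarrow> h u (\<Sum>i\<in>I. f i) = (\<Sum>i\<in>I. h u (f i))"
  unfolding bilinear_def using linear_sum[of "\<lambda>v. h u v" f I] by auto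

lemma posdefD:
  assumes "posdef g"
  shows "bilinear g" "g u v = g v u" "u \<noteq> 0 \<Longrightarrow> 0 < g u u"
  using assms by (auto simp: posdef_def)

lemma posdef_eqI:
  assumes "posdef g" "\<And>z. g u z = g v z"
  shows "u = v"
proof (rule ccontr)
  assume "u \<noteq> v"
  then have "0 < g (u - v) (u - v)" using posdefD(3)[OF assms(1)] by simp
  moreover have "g (u - v) (u - v) = 0"
    using assms(2) by (simp add: bilinear_lsub[OF posdefD(1)[OF assms(1)]])
  ultimately show False by simp
qed

text \<open>Orthonormal vectors are independent, and their number is the dimension, so they span;
  pairing with a basis vector then picks out its coefficient.\<close>

lemma is_onb_expansion:
  fixes g :: "'e::euclidean_space \<Rightarrow> 'e \<Rightarrow> real"
  assumes g: "posdef g" and B: "is_onb g B"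
  shows "w = (\<Sum>b\<in>B. g w b *\<^sub>R b)"
proof -
  note bl = posdefD(1)[OF g]
  have fin: "finite B" and card: "card B = DIM('e)" using B by (auto simp: is_onb_def)
  have on: "g b c = (if b = c then 1 else 0)" if "b \<in> B" "c \<in> B" for b c
    using B that by (auto simp: is_onb_def)
  have coeff: "g (\<Sum>b\<in>B. u b *\<^sub>R b) c = u c" if "c \<in> B" for u c
  proof -
    have "g (\<Sum>b\<in>B. u b *\<^sub>R b) c = (\<Sum>b\<in>B. u b * g b c)"
      by (simp add: bilinear_sum_left[OF bl] bilinear_lmul[OF bl])
    also have "\<dots> = (\<Sum>b\<in>B. if b = c then u b else 0)"
      by (rule sum.cong) (use on that in auto)
    also have "\<dots> = u c" using fin that by simp
    finally show ?thesis .
  qed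
  have "independent B"
  proof (rule independent_if_scalars_zero[OF fin])
    fix f x assume "(\<Sum>x\<in>B. f x *\<^sub>R x) = 0" "x \<in> B"
    then show "f x = 0" using coeff[of x f] by (simp add: bilinear_lzero[OF bl])
  qed
  then have "span B = UNIV"
    using card_ge_dim_independent[of B UNIV] card by auto
  then obtain u where w: "w = (\<Sum>b\<in>B. u b *\<^sub>R b)"
    using span_finite[OF fin] by (metis (no_types, lifting) UNIV_I imageE)
  have "(\<Sum>b\<in>B. g w b *\<^sub>R b) = (\<Sum>b\<in>B. u b *\<^sub>R b)"
    using coeff unfolding w by (intro sum.cong) auto
  then show ?thesis using w by simp
qed

text \<open>Expand the first slot in \<open>C\<close>, exchange the sums, and collapse the expansion
  of each \<open>c\<close> in \<open>B\<close> in the second slot. This allows every trace over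
  \<open>onb\<close> to be evaluated in a smooth frame or in an adapted basis.\<close>

lemma trace_is_onb_eq:
  assumes g: "posdef g" and B: "is_onb g B" and C: "is_onb g C" and h: "bilinear h"
  shows "(\<Sum>b\<in>B. h b b) = (\<Sum>c\<in>C. h c c)"
proof -
  have "(\<Sum>b\<in>B. h b b) = (\<Sum>b\<in>B. \<Sum>c\<in>C. g b c *\<^sub>R h c b)"
  proof (rule sum.cong)
    fix b
    have "h b b = h (\<Sum>c\<in>C. g b c *\<^sub>R c) b" using is_onb_expansion[OF g C, of b] by simp
    then show "h b b = (\<Sum>c\<in>C. g b c *\<^sub>R h c b)"
      by (simp add: bilinear_sum_left[OF h] bilinear_lmul[OF h])
  qed simp
  also have "\<dots> = (\<Sum>c\<in>C. \<Sum>b\<in>B. g c b *\<^sub>R h c b)"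
    by (subst sum.swap) (simp add: posdefD(2)[OF g])
  also have "\<dots> = (\<Sum>c\<in>C. h c c)"
  proof (rule sum.cong)
    fix c
    have "h c c = h c (\<Sum>b\<in>B. g c b *\<^sub>R b)" using is_onb_expansion[OF g B, of c] by simp
    then show "(\<Sum>b\<in>B. g c b *\<^sub>R h c b) = h c c"
      by (simp add: bilinear_sum_right[OF h] bilinear_rmul[OF h])
  qed simp
  finally show ?thesis .
qed

lemma orthonormal_family_is_onb:
  fixes F :: "'i \<Rightarrow> 'e::euclidean_space"
  assumes "finite I" "card I = DIM('e)"
    and on: "\<And>b c. b \<in> I \<Longrightarrow> c \<in> I \<Longrightarrow> g (F b) (F c) = (if b = c then 1 else 0)"
  shows "is_onb g (F ` I)" "inj_on F I"
proof -
  show inj: "inj_on F I"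
  proof
    fix b c assume "b \<in> I" "c \<in> I" "F b = F c"
    then show "b = c" using on[of b c] on[of b b] by (auto split: if_splits)
  qed
  then show "is_onb g (F ` I)"
    using assms by (auto simp: is_onb_def card_image inj_on_def)
qed

text \<open>Gram-Schmidt on the standard basis, for all points at once. That \<open>F b x\<close>
  stays in \<open>span I\<close> is carried through the induction because it keeps the next basis
  vector independent of the vectors already built, so that its remainder can be normalised.\<close>

lemma smooth_gram_schmidt:
  fixes G :: "'x::real_normed_vector \<Rightarrow> 'e::euclidean_space \<Rightarrow> 'e \<Rightarrow> real"
  assumes G: "smooth_bil G S" and pd: "\<And>x. x \<in> S \<Longrightarrow> posdef (G x)"
    and I: "finite I" "I \<subseteq> Basis"
  shows "\<exists>F. (\<forall>b\<in>I. smooth_on (F b) S) \<and> (\<forall>x\<in>S. \<forall>b\<in>I. F b x \<in> span I \<and>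
    (\<forall>c\<in>I. G x (F b x) (F c x) = (if b = c then 1 else 0)))"
  using I
proof (induction I rule: finite_induct)
  case empty
  then show ?case by auto
next
  case (insert c I)
  then obtain F where F: "\<And>b. b \<in> I \<Longrightarrow> smooth_on (F b) S"
    "\<And>x b. x \<in> S \<Longrightarrow> b \<in> I \<Longrightarrow> F b x \<in> span I"
    "\<And>x b d. x \<in> S \<Longrightarrow> b \<in> I \<Longrightarrow> d \<in> I \<Longrightarrow> G x (F b x) (F d x) = (if b = d then 1 else 0)"
    unfolding insert_subset by metis
  have S: "open S" using G by (simp add: smooth_bil_def)
  define W where "W x = c - (\<Sum>b\<in>I. G x c (F b x) *\<^sub>R F b x)" for x
  define n where "n x = G x (W x) (W x)" for x
  define H where "H = (\<lambda>b x. if b = c then (n x powr (-1/2)) *\<^sub>R W x else F b x)"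
  have Wsm: "smooth_on W S"
    unfolding W_def
    by (intro smooth_on_diff smooth_on_sum smooth_on_scaleR smooth_on_const S F(1)
        smooth_bil_apply[OF G smooth_on_const F(1)])
  have W0: "W x \<noteq> 0" if "x \<in> S" for x
  proof
    assume "W x = 0"
    then have "c = (\<Sum>b\<in>I. G x c (F b x) *\<^sub>R F b x)" by (simp add: W_def)
    also have "\<dots> \<in> span I" using F(2) that by (intro span_sum span_scale)
    finally have "c \<in> span I" .
    moreover have "independent (insert c I)"
      using insert.prems independent_Basis independent_mono by blast
    ultimately show False using insert.hyps
      by (simp add: dependent_insertD independent_insert)
  qed
  have npos: "0 < n x" if "x \<in> S" for x
    using posdefD(3)[OF pd[OF that] W0[OF that]] by (simp add: n_def)
  have nsm: "smooth_on (\<lambda>x. n x powr a) S" for a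
    using npos S by (intro smooth_on_powr) (auto simp: n_def intro: smooth_bil_apply[OF G Wsm Wsm])
  have WF: "G x (W x) (F d x) = 0" if "x \<in> S" "d \<in> I" for x d
  proof -
    note bl = posdefD(1)[OF pd[OF that(1)]]
    have "(\<Sum>b\<in>I. G x c (F b x) * G x (F b x) (F d x)) =
        (\<Sum>b\<in>I. if b = d then G x c (F b x) else 0)"
      by (rule sum.cong) (use F(3) that in auto)
    also have "\<dots> = G x c (F d x)" using insert.hyps that by simp
    finally show ?thesis
      by (simp add: W_def bilinear_lsub[OF bl] bilinear_sum_left[OF bl] bilinear_lmul[OF bl])
  qed
  have "smooth_on (H b) S" if "b \<in> insert c I" for b
    using that F(1) S nsm Wsm by (cases "b = c") (auto simp: H_def intro!: smooth_on_scaleR)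
  moreover have "H b x \<in> span (insert c I)" if "x \<in> S" "b \<in> insert c I" for x b
  proof -
    have sub: "span I \<subseteq> span (insert c I)" by (intro span_mono) auto
    have "W x \<in> span (insert c I)"
      unfolding W_def using F(2) that sub
      by (intro span_diff span_sum span_scale) (auto intro: span_base)
    then show ?thesis using that F(2) sub by (auto simp: H_def intro: span_scale)
  qed
  moreover have "G x (H b x) (H d x) = (if b = d then 1 else 0)"
    if x: "x \<in> S" and "b \<in> insert c I" "d \<in> insert c I" for x b d
  proof -
    note bl = posdefD(1)[OF pd[OF x]]
    have "n x powr (-1/2) * (n x powr (-1/2) * n x) = 1"
    proof -
      have "n x powr (-1/2) * (n x powr (-1/2) * n x) = n x powr (-1/2) * n x powr (-1/2) * n x powr 1"
        using npos[OF x] by simp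
      also have "\<dots> = n x powr (-1/2 + -1/2 + 1)" by (simp only: powr_add)
      also have "\<dots> = 1" using npos[OF x] by simp
      finally show ?thesis .
    qed
    moreover have "G x (F d x) (W x) = 0" if "d \<in> I" for d
      using WF[OF x that] posdefD(2)[OF pd[OF x]] by simp
    ultimately show ?thesis
      using that insert.hyps WF[OF x] F(3)[OF x]
      by (auto simp: H_def bilinear_lmul[OF bl] bilinear_rmul[OF bl] n_def)
  qed
  ultimately show ?case by (intro exI[of _ H]) blast
qed

lemma smooth_orthonormal_frame:
  fixes G :: "'x::real_normed_vector \<Rightarrow> 'e::euclidean_space \<Rightarrow> 'e \<Rightarrow> real"
  assumes "smooth_bil G S" "\<And>x. x \<in> S \<Longrightarrow> posdef (G x)"
  obtains F :: "'e \<Rightarrow> 'x \<Rightarrow> 'e" where "\<And>b. b \<in> Basis \<Longrightarrow> smooth_on (F b) S"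
    "\<And>x. x \<in> S \<Longrightarrow> is_onb (G x) ((\<lambda>b. F b x) ` Basis)"
    "\<And>x. x \<in> S \<Longrightarrow> inj_on (\<lambda>b. F b x) Basis"
proof -
  obtain F :: "'e \<Rightarrow> 'x \<Rightarrow> 'e" where F: "\<forall>b\<in>Basis. smooth_on (F b) S" "\<forall>x\<in>S. \<forall>b\<in>Basis. F b x \<in> span Basis \<and>
      (\<forall>c\<in>Basis. G x (F b x) (F c x) = (if b = c then 1 else 0))"
    using smooth_gram_schmidt[of G S Basis] assms by auto
  show ?thesis
  proof (rule that[of F])
    fix x assume "x \<in> S"
    then have "G x (F b x) (F c x) = (if b = c then 1 else 0)" if "b \<in> Basis" "c \<in> Basis" for b c
      using F that by blast
    from orthonormal_family_is_onb[of Basis "G x" "\<lambda>b. F b x", OF finite_Basis refl this]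
    show "is_onb (G x) ((\<lambda>b. F b x) ` Basis)" "inj_on (\<lambda>b. F b x) Basis" by auto
  qed (use F in auto)
qed

lemma is_onb_exists:
  fixes g :: "'e::euclidean_space \<Rightarrow> 'e \<Rightarrow> real"
  assumes "posdef g"
  shows "\<exists>B. is_onb g B"
proof -
  \<comment> \<open>A single scalar product is regarded as a constant family over the real line, so
    that the frame construction applies.\<close>
  have "smooth_bil (\<lambda>x::real. g) UNIV"
    using posdefD(1)[OF assms] by (auto simp: smooth_bil_def)
  then obtain F :: "'e \<Rightarrow> real \<Rightarrow> 'e" where "\<And>x. x \<in> UNIV \<Longrightarrow> is_onb g ((\<lambda>b. F b x) ` Basis)"
    using smooth_orthonormal_frame[of "\<lambda>x::real. g" UNIV] assms by metis
  then show ?thesis by blast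
qed

lemma is_onb_onb:
  assumes "posdef (g p)"
  shows "is_onb (g p) (onb g p)"
  using someI_ex[OF is_onb_exists[OF assms]] unfolding onb_def is_onb_def .

text \<open>For \<open>m = 0\<close> this is \<open>exp (- 1 / t)\<close> continued by zero. The
  powers of \<open>1 / t\<close> are included because the derivative of each member is a combination
  of members with larger \<open>m\<close>, so that one induction covers the whole family.\<close>

definition flat_exp :: "nat \<Rightarrow> real \<Rightarrow> real" where
  "flat_exp m t = (if t > 0 then exp (- inverse t) * inverse t ^ m else 0)"

lemma flat_exp_tendsto_0: "(flat_exp m \<longlongrightarrow> 0) (at 0)"
proof (subst filterlim_at_split, intro conjI)
  have "((\<lambda>x::real. x ^ m / exp x) \<longlongrightarrow> 0) at_top" by (rule tendsto_power_div_exp_0)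
  then have "((\<lambda>t::real. inverse t ^ m / exp (inverse t)) \<longlongrightarrow> 0) (at_right 0)"
    by (rule filterlim_compose[OF _ filterlim_inverse_at_top_right])
  then show "(flat_exp m \<longlongrightarrow> 0) (at_right 0)"
    by (rule Lim_transform_eventually)
       (auto simp: eventually_at_filter flat_exp_def exp_minus field_simps)
  show "(flat_exp m \<longlongrightarrow> 0) (at_left 0)"
    by (rule Lim_transform_eventually[of "\<lambda>_. 0"])
       (auto simp: eventually_at_filter flat_exp_def)
qed

lemma flat_exp_has_derivative:
  "(flat_exp m has_real_derivative flat_exp (m + 2) t - real m * flat_exp (m + 1) t) (at t)"
proof -
  consider "t > 0" | "t < 0" | "t = 0" by linarith
  then show ?thesis
  proof cases
    case 1
    have "((\<lambda>t. exp (- inverse t) * inverse t ^ m) has_real_derivative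
        flat_exp (m + 2) t - real m * flat_exp (m + 1) t) (at t)"
      using 1 power_eq_if[of t "m - 1"]
      by (cases m) (auto intro!: derivative_eq_intros simp: flat_exp_def field_simps power2_eq_square split: if_splits)
    then show ?thesis
      by (rule has_field_derivative_transform_within_open[of _ _ _ "{0<..}"])
         (use 1 in \<open>auto simp: flat_exp_def\<close>)
  next
    case 2
    have "((\<lambda>t. 0) has_real_derivative flat_exp (m + 2) t - real m * flat_exp (m + 1) t) (at t)"
      using 2 by (simp add: flat_exp_def)
    then show ?thesis
      by (rule has_field_derivative_transform_within_open[of _ _ _ "{..<0}"])
         (use 2 in \<open>auto simp: flat_exp_def\<close>)
  next
    case 3
    \<comment> \<open>At 0 the difference quotient is the next member of the family, with one more
      power of \<open>1 / t\<close>, and that tends to 0.\<close>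
    have "((\<lambda>y. (flat_exp m y - flat_exp m 0) / (y - 0)) \<longlongrightarrow> 0) (at 0)"
      by (rule Lim_transform_eventually[OF flat_exp_tendsto_0[of "Suc m"]])
         (auto simp: eventually_at_filter flat_exp_def field_simps)
    then show ?thesis using 3 by (simp add: has_field_derivative_iff flat_exp_def)
  qed
qed

lemma smooth_on_flat_exp: "smooth_on (flat_exp m) UNIV"
  unfolding smooth_on_def
proof
  fix k show "Ck_on k (flat_exp m) UNIV"
  proof (induction k arbitrary: m)
    case 0
    then show ?case
      by (auto intro!: continuous_at_imp_continuous_on DERIV_isCont[OF flat_exp_has_derivative])
  next
    case (Suc k)
    show ?case
    proof (rule Ck_on_SucI)
      show "(flat_exp m has_derivative (\<lambda>v. v * (flat_exp (m + 2) t + (- real m) * flat_exp (m + 1) t))) (at t)" for t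
        using flat_exp_has_derivative[of m t]
        by (simp add: has_field_derivative_def mult_commute_abs)
      show "Ck_on k (\<lambda>t. v * (flat_exp (m + 2) t + (- real m) * flat_exp (m + 1) t)) UNIV" for v
        by (rule Ck_on_bounded_linear[OF open_UNIV bounded_linear_mult_right Ck_on_add[OF open_UNIV Suc
              Ck_on_bounded_linear[OF open_UNIV bounded_linear_mult_right Suc]]])
    qed auto
  qed
qed

text \<open>\<open>flat_exp 0\<close> is composed with the squared radius minus the squared distance
  from \<open>x0\<close>, which is positive only inside the ball. The result is normalised at the
  centre alone, since just one value of a vector field will be prescribed.\<close>

lemma smooth_bump_exists:
  fixes x0 :: "'e::euclidean_space"
  assumes "r > 0"
  obtains \<psi> :: "'e \<Rightarrow> real" where "smooth_on \<psi> UNIV" "\<psi> x0 = 1" "\<And>x. x \<notin> ball x0 r \<Longrightarrow> \<psi> x = 0"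
proof -
  define q where "q x = r\<^sup>2 + - ((x - x0) \<bullet> (x - x0))" for x
  have q: "smooth_on q UNIV"
    unfolding q_def
    by (intro smooth_on_add smooth_on_minus smooth_on_inner smooth_on_diff smooth_on_id smooth_on_const open_UNIV)
  have "smooth_on (\<lambda>x. flat_exp 0 (q x)) UNIV"
    by (rule smooth_on_compose[OF smooth_on_flat_exp q]) auto
  then have sm: "smooth_on (\<lambda>x. inverse (flat_exp 0 (q x0)) * flat_exp 0 (q x)) UNIV"
    by (intro smooth_on_mult smooth_on_const open_UNIV)
  show ?thesis
  proof (rule that[OF sm])
    show "inverse (flat_exp 0 (q x0)) * flat_exp 0 (q x0) = 1"
      using assms by (simp add: flat_exp_def q_def)
    fix x assume "x \<notin> ball x0 r"
    then have "r\<^sup>2 \<le> (norm (x - x0))\<^sup>2"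
      using assms by (intro power_mono) (auto simp: dist_norm norm_minus_commute)
    then show "inverse (flat_exp 0 (q x0)) * flat_exp 0 (q x) = 0"
      by (simp add: flat_exp_def q_def power2_norm_eq_inner)
  qed
qed

section \<open>Local coordinates\<close>

text \<open>The inverse of \<open>vec_coord\<close>: it turns chart coordinates into the
  representation in the preferred chart of \<open>q\<close>. Constant \<open>u\<close> gives the
  coordinate fields of \<open>c\<close>, and \<open>const_ext\<close> is the case where
  \<open>c\<close> is a preferred chart.\<close>

definition chart_vec :: "('a, 'e::euclidean_space) chart set \<Rightarrow> ('a, 'e) chart \<Rightarrow> 'a \<Rightarrow> 'e \<Rightarrow> 'e" where
  "chart_vec A c q u = pd (snd (chart_at A q) \<circ> chart_inv c) (snd c q) u"

abbreviation vec_coord :: "('a, 'e::euclidean_space) chart set \<Rightarrow> ('a, 'e) chart \<Rightarrow> 'a \<Rightarrow> 'e \<Rightarrow> 'e" where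
  "vec_coord A c q v \<equiv> mderiv A (snd c) q v"

definition field_rep ::
  "('a, 'e::euclidean_space) chart set \<Rightarrow> ('a, 'e) chart \<Rightarrow> ('a \<Rightarrow> 'e) \<Rightarrow> 'e \<Rightarrow> 'e" where
  "field_rep A c X x = vec_coord A c (chart_inv c x) (X (chart_inv c x))"

lemma const_ext_eq: "const_ext A p u = (\<lambda>q. chart_vec A (chart_at A p) q u)"
  by (simp add: const_ext_def chart_vec_def fun_eq_iff)

lemma vector_field_iff:
  "vector_field A W X \<longleftrightarrow> (\<forall>c\<in>A. smooth_on (field_rep A c X) (snd c ` (W \<inter> fst c)))"
  by (simp add: vector_field_def field_rep_def[abs_def] o_def)

lemma pd_eq: "(f has_derivative f') (at x) \<Longrightarrow> pd f x v = f' v"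
  using frechet_derivative_at[of f f' x] by simp

locale atlas =
  fixes A :: "('a, 'e::euclidean_space) chart set"
  assumes atlas: "smooth_atlas A"
begin

lemma chart_inj: "c \<in> A \<Longrightarrow> inj_on (snd c) (fst c)"
  using atlas by (auto simp: smooth_atlas_def)

lemma chart_at_props:
  assumes "p \<in> points A"
  shows "chart_at A p \<in> A" "p \<in> fst (chart_at A p)"
proof -
  have "\<exists>c. c \<in> A \<and> p \<in> fst c" using assms by (auto simp: points_def)
  from someI_ex[OF this] show "chart_at A p \<in> A" "p \<in> fst (chart_at A p)"
    by (auto simp: chart_at_def)
qed

lemma in_points: "c \<in> A \<Longrightarrow> q \<in> fst c \<Longrightarrow> q \<in> points A"
  by (auto simp: points_def)

lemma chart_inv_chart [simp]: "c \<in> A \<Longrightarrow> q \<in> fst c \<Longrightarrow> chart_inv c (snd c q) = q"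
  unfolding chart_inv_def by (rule the_inv_into_f_f[OF chart_inj])

lemma chart_image_open: "c \<in> A \<Longrightarrow> open (snd c ` fst c)"
  using atlas by (auto simp: smooth_atlas_def)

lemma open_subset_image: "open_subset A W \<Longrightarrow> c \<in> A \<Longrightarrow> open (snd c ` (W \<inter> fst c))"
  by (auto simp: open_subset_def)

lemma open_subset_fst: "c \<in> A \<Longrightarrow> open_subset A (fst c)"
  using atlas by (auto simp: smooth_atlas_def open_subset_def points_def Int_commute)

lemma open_subset_points: "open_subset A (points A)"
proof -
  have "points A \<inter> fst c = fst c" if "c \<in> A" for c using that by (auto simp: points_def)
  then show ?thesis using chart_image_open by (auto simp: open_subset_def)
qed

lemma open_subset_Int: "open_subset A S \<Longrightarrow> open_subset A T \<Longrightarrow> open_subset A (S \<inter> T)"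
  using openin_manifold_topology[OF atlas] by (metis openin_Int)

lemma transition_smooth:
  "c \<in> A \<Longrightarrow> d \<in> A \<Longrightarrow> smooth_on (snd d \<circ> chart_inv c) (snd c ` (fst c \<inter> fst d))"
  using atlas by (auto simp: smooth_atlas_def)

lemma transition_open: "c \<in> A \<Longrightarrow> d \<in> A \<Longrightarrow> open (snd c ` (fst c \<inter> fst d))"
  using atlas by (auto simp: smooth_atlas_def)

lemma transition_differentiable:
  "c \<in> A \<Longrightarrow> d \<in> A \<Longrightarrow> q \<in> fst c \<Longrightarrow> q \<in> fst d \<Longrightarrow> (snd d \<circ> chart_inv c) differentiable (at (snd c q))"
  by (rule smooth_on_differentiable[OF transition_smooth]) auto

text \<open>The chain rule through the transition map; the comparison of tangent vectors in two
  charts, in particular in a fixed and a preferred one, rests on it.\<close>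

lemma chart_change:
  fixes f :: "'a \<Rightarrow> 'b::real_normed_vector"
  assumes c: "c \<in> A" "q \<in> fst c" and d: "d \<in> A" "q \<in> fst d"
    and f: "(f \<circ> chart_inv d) differentiable (at (snd d q))"
  shows "((f \<circ> chart_inv c) has_derivative
    (\<lambda>v. pd (f \<circ> chart_inv d) (snd d q) (pd (snd d \<circ> chart_inv c) (snd c q) v))) (at (snd c q))"
proof (rule has_derivative_transform_within_open[OF _ transition_open[OF c(1) d(1)]])
  have "(snd d \<circ> chart_inv c) (snd c q) = snd d q" using c by simp
  then have "((f \<circ> chart_inv d) has_derivative pd (f \<circ> chart_inv d) (snd d q))
      (at ((snd d \<circ> chart_inv c) (snd c q)))"
    using f by (simp add: frechet_derivative_works)
  from has_derivative_compose[OF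
      transition_differentiable[OF c(1) d(1) c(2) d(2), unfolded frechet_derivative_works] this]
  show "((\<lambda>x. (f \<circ> chart_inv d) ((snd d \<circ> chart_inv c) x)) has_derivative
      (\<lambda>v. pd (f \<circ> chart_inv d) (snd d q) (pd (snd d \<circ> chart_inv c) (snd c q) v))) (at (snd c q))" .
qed (use c d in auto)

lemma mderiv_in_chart:
  fixes f :: "'a \<Rightarrow> 'b::real_normed_vector"
  assumes c: "c \<in> A" "p \<in> fst c" and f: "(f \<circ> chart_inv c) differentiable (at (snd c p))"
  shows "mderiv A f p v = pd (f \<circ> chart_inv c) (snd c p) (vec_coord A c p v)"
  unfolding mderiv_def
  by (rule pd_eq[OF chart_change[OF chart_at_props[OF in_points[OF c]] c f]])

lemma linear_vec_coord:
  assumes c: "c \<in> A" "q \<in> fst c"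
  shows "linear (vec_coord A c q)"
  unfolding mderiv_def
  by (rule linear_pd[OF transition_differentiable]) (use c chart_at_props[OF in_points[OF c]] in auto)

lemma linear_chart_vec:
  assumes c: "c \<in> A" "q \<in> fst c"
  shows "linear (chart_vec A c q)"
  unfolding chart_vec_def[abs_def]
  by (rule linear_pd[OF transition_differentiable]) (use c chart_at_props[OF in_points[OF c]] in auto)

lemma pd_transition_self:
  assumes c: "c \<in> A" "q \<in> fst c"
  shows "pd (snd c \<circ> chart_inv c) (snd c q) u = u"
proof -
  have "((snd c \<circ> chart_inv c) has_derivative (\<lambda>v. v)) (at (snd c q))"
    by (rule has_derivative_transform_within_open[OF has_derivative_ident chart_image_open[OF c(1)]])
       (use c in auto)
  then show ?thesis by (rule pd_eq)
qed

lemma vec_coord_chart_vec [simp]: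
  assumes c: "c \<in> A" "q \<in> fst c"
  shows "vec_coord A c q (chart_vec A c q u) = u"
proof -
  let ?d = "chart_at A q"
  have d: "?d \<in> A" "q \<in> fst ?d" using chart_at_props[OF in_points[OF c]] .
  show ?thesis
    using pd_eq[OF chart_change[OF c d transition_differentiable[OF d(1) c(1) d(2) c(2)]], of u]
      pd_transition_self[OF c, of u]
    unfolding mderiv_def chart_vec_def by simp
qed

lemma chart_vec_vec_coord [simp]:
  assumes c: "c \<in> A" "q \<in> fst c"
  shows "chart_vec A c q (vec_coord A c q v) = v"
proof -
  let ?d = "chart_at A q"
  have d: "?d \<in> A" "q \<in> fst ?d" using chart_at_props[OF in_points[OF c]] .
  show ?thesis
    using pd_eq[OF chart_change[OF d c transition_differentiable[OF c(1) d(1) c(2) d(2)]], of v]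
      pd_transition_self[OF d, of v]
    unfolding mderiv_def chart_vec_def by simp
qed

lemma vec_coord_change:
  assumes c: "c \<in> A" "q \<in> fst c" and d: "d \<in> A" "q \<in> fst d"
  shows "vec_coord A d q v = pd (snd d \<circ> chart_inv c) (snd c q) (vec_coord A c q v)"
  by (rule mderiv_in_chart[OF c transition_differentiable[OF c(1) d(1) c(2) d(2)]])

lemma vec_coord_chart_at: "p \<in> points A \<Longrightarrow> vec_coord A (chart_at A p) p v = v"
  unfolding mderiv_def using pd_transition_self chart_at_props by blast

lemma field_rep_at: "c \<in> A \<Longrightarrow> q \<in> fst c \<Longrightarrow> field_rep A c X (snd c q) = vec_coord A c q (X q)"
  by (simp add: field_rep_def)

lemma vector_field_smooth_rep:
  "vector_field A W X \<Longrightarrow> c \<in> A \<Longrightarrow> smooth_on (field_rep A c X) (snd c ` (W \<inter> fst c))"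
  by (simp add: vector_field_iff)

lemma vector_field_subset: "vector_field A W X \<Longrightarrow> W' \<subseteq> W \<Longrightarrow> vector_field A W' X"
  unfolding vector_field_iff by (auto elim!: ballE intro: smooth_on_subset)

lemma transition_image:
  assumes "c \<in> A" "d \<in> A" "W \<subseteq> fst c"
  shows "(snd c \<circ> chart_inv d) ` (snd d ` (W \<inter> fst d)) \<subseteq> snd c ` W"
  using assms by auto

lemma smooth_on_transition_compose:
  assumes c: "c \<in> A" and d: "d \<in> A" and W: "W \<subseteq> fst c" "open_subset A W"
    and f: "smooth_on f (snd c ` W)"
  shows "smooth_on (\<lambda>y. f ((snd c \<circ> chart_inv d) y)) (snd d ` (W \<inter> fst d))"
proof (rule smooth_on_compose[OF f])
  show "smooth_on (snd c \<circ> chart_inv d) (snd d ` (W \<inter> fst d))"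
    by (rule smooth_on_subset[OF transition_smooth[OF d c]]) (use W in auto)
  show "open (snd d ` (W \<inter> fst d))" using open_subset_image[OF W(2) d] .
  show "open (snd c ` W)" using open_subset_image[OF W(2) c] W(1) by (simp add: Int_absorb2)
qed (use transition_image[OF c d W(1)] in auto)

text \<open>One chart suffices: in any other chart the coordinates are multiplied by the Jacobian of
  the transition map, a smooth family of linear maps.\<close>

lemma vector_fieldI_chart:
  assumes c: "c \<in> A" and W: "W \<subseteq> fst c" "open_subset A W"
    and X: "smooth_on (field_rep A c X) (snd c ` W)"
  shows "vector_field A W X"
  unfolding vector_field_iff
proof
  fix d assume d: "d \<in> A"
  let ?S = "snd d ` (W \<inter> fst d)" and ?t = "snd c \<circ> chart_inv d"
  have S: "open ?S" using open_subset_image[OF W(2) d] .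
  have Wd: "W \<inter> fst d \<subseteq> fst c" "open_subset A (W \<inter> fst d)"
    using W open_subset_Int[OF W(2) open_subset_fst[OF d]] by auto
  have tr: "smooth_on (\<lambda>x. pd (snd d \<circ> chart_inv c) x u) (snd c ` (W \<inter> fst d))" for u
    by (rule smooth_on_frechet_derivative, rule smooth_on_subset[OF transition_smooth[OF c d]])
       (use W in auto)
  have 1: "smooth_on (\<lambda>y. pd (snd d \<circ> chart_inv c) (?t y) u) ?S" for u
    using smooth_on_transition_compose[OF c d Wd tr] by simp
  have 2: "smooth_on (\<lambda>y. field_rep A c X (?t y)) ?S"
    by (rule smooth_on_transition_compose[OF c d W X])
  show "smooth_on (field_rep A d X) ?S"
  proof (rule smooth_on_cong[OF _ S])
    show "smooth_on (\<lambda>y. pd (snd d \<circ> chart_inv c) (?t y) (field_rep A c X (?t y))) ?S"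
    proof (rule smooth_on_linear_family[OF S _ 1 2])
      fix y assume "y \<in> ?S"
      then show "linear (pd (snd d \<circ> chart_inv c) (?t y))"
        using W d c by (auto intro!: linear_pd[OF transition_differentiable])
    qed
    fix y assume "y \<in> ?S"
    then obtain q where q: "q \<in> W" "q \<in> fst d" "y = snd d q" by auto
    then show "pd (snd d \<circ> chart_inv c) (?t y) (field_rep A c X (?t y)) = field_rep A d X y"
      using W d c vec_coord_change[OF c _ d] by (auto simp: field_rep_at)
  qed
qed

lemma smooth_funI_chart:
  assumes c: "c \<in> A" and W: "W \<subseteq> fst c" "open_subset A W"
    and f: "smooth_on (f \<circ> chart_inv c) (snd c ` W)"
  shows "smooth_fun A W f"
  unfolding smooth_fun_def
proof
  fix d assume d: "d \<in> A"
  show "smooth_on (f \<circ> chart_inv d) (snd d ` (W \<inter> fst d))"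
  proof (rule smooth_on_cong[OF smooth_on_transition_compose[OF c d W f]])
    show "open (snd d ` (W \<inter> fst d))" using open_subset_image[OF W(2) d] .
    show "(f \<circ> chart_inv c) ((snd c \<circ> chart_inv d) y) = (f \<circ> chart_inv d) y"
      if "y \<in> snd d ` (W \<inter> fst d)" for y
      using that W d c by auto
  qed
qed

lemma field_rep_chart_vec:
  "c \<in> A \<Longrightarrow> x \<in> snd c ` fst c \<Longrightarrow> field_rep A c (\<lambda>q. chart_vec A c q (h (snd c q))) x = h x"
  by (auto simp: field_rep_at)

lemma vector_field_chart_vec:
  assumes c: "c \<in> A" and h: "smooth_on h (snd c ` fst c)"
  shows "vector_field A (fst c) (\<lambda>q. chart_vec A c q (h (snd c q)))"
  by (rule vector_fieldI_chart[OF c subset_refl open_subset_fst[OF c]],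
      rule smooth_on_cong[OF h chart_image_open[OF c]])
     (use field_rep_chart_vec[OF c] in auto)

lemmas vector_field_chart_vec_const = vector_field_chart_vec[OF _ smooth_on_const]

lemma field_rep_chart_vec_const:
  "c \<in> A \<Longrightarrow> x \<in> snd c ` fst c \<Longrightarrow> field_rep A c (\<lambda>q. chart_vec A c q u) x = u"
  by (auto simp: field_rep_at)

lemma vector_field_add:
  assumes W: "open_subset A W" and X: "vector_field A W X" and Y: "vector_field A W Y"
  shows "vector_field A W (\<lambda>q. X q + Y q)"
  unfolding vector_field_iff
proof
  fix c assume c: "c \<in> A"
  note op = open_subset_image[OF W c]
  show "smooth_on (field_rep A c (\<lambda>q. X q + Y q)) (snd c ` (W \<inter> fst c))"
    by (rule smooth_on_cong[OF smooth_on_add[OF vector_field_smooth_rep[OF X c] vector_field_smooth_rep[OF Y c] op] op])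
       (use c in \<open>auto simp: field_rep_at linear_add[OF linear_vec_coord]\<close>)
qed

lemma vector_field_scaleR:
  assumes W: "open_subset A W" and f: "smooth_fun A W f" and Y: "vector_field A W Y"
  shows "vector_field A W (\<lambda>q. f q *\<^sub>R Y q)"
  unfolding vector_field_iff
proof
  fix c assume c: "c \<in> A"
  note op = open_subset_image[OF W c]
  have "smooth_on (f \<circ> chart_inv c) (snd c ` (W \<inter> fst c))" using f c by (simp add: smooth_fun_def)
  show "smooth_on (field_rep A c (\<lambda>q. f q *\<^sub>R Y q)) (snd c ` (W \<inter> fst c))"
    by (rule smooth_on_cong[OF smooth_on_scaleR[OF \<open>smooth_on (f \<circ> chart_inv c) _\<close>
            vector_field_smooth_rep[OF Y c] op] op])
       (use c in \<open>auto simp: field_rep_at linear_scale[OF linear_vec_coord]\<close>)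
qed

lemma vector_field_zero: "open_subset A W \<Longrightarrow> vector_field A W (\<lambda>q. 0)"
  unfolding vector_field_iff
proof
  fix c assume W: "open_subset A W" and c: "c \<in> A"
  show "smooth_on (field_rep A c (\<lambda>q. 0)) (snd c ` (W \<inter> fst c))"
    by (rule smooth_on_cong[OF smooth_on_const[of 0] open_subset_image[OF W c]])
       (use c in \<open>auto simp: field_rep_at linear_0[OF linear_vec_coord]\<close>)
qed

lemma vector_field_sum:
  assumes "open_subset A W" "\<And>i. i \<in> I \<Longrightarrow> vector_field A W (X i)"
  shows "vector_field A W (\<lambda>q. \<Sum>i\<in>I. X i q)"
  using assms(2)
  by (induction I rule: infinite_finite_induct)
     (auto intro: vector_field_zero vector_field_add assms(1))

lemma vector_field_cong:
  assumes "open_subset A W" "vector_field A W X" "\<And>q. q \<in> W \<Longrightarrow> X q = Y q"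
  shows "vector_field A W Y"
  unfolding vector_field_iff
proof
  fix c assume c: "c \<in> A"
  show "smooth_on (field_rep A c Y) (snd c ` (W \<inter> fst c))"
    by (rule smooth_on_cong[OF vector_field_smooth_rep[OF assms(2) c] open_subset_image[OF assms(1) c]])
       (use assms(3) c in \<open>auto simp: field_rep_at\<close>)
qed

lemma field_rep_differentiable:
  assumes "vector_field A W X" "c \<in> A" "p \<in> W" "p \<in> fst c"
  shows "field_rep A c X differentiable (at (snd c p))"
  by (rule smooth_on_differentiable[OF vector_field_smooth_rep[OF assms(1,2)]]) (use assms in auto)

lemma dir_deriv_in_chart:
  fixes f :: "'a \<Rightarrow> 'b::real_normed_vector"
  assumes "c \<in> A" "p \<in> fst c" "(f \<circ> chart_inv c) differentiable (at (snd c p))"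
  shows "dir_deriv A X f p = pd (f \<circ> chart_inv c) (snd c p) (field_rep A c X (snd c p))"
  using mderiv_in_chart[OF assms] assms by (simp add: dir_deriv_def field_rep_at)

text \<open>Applying a field to the preferred coordinate map multiplies its coordinates in
  \<open>c\<close> by the Jacobian of the transition map. A second application brings in second
  derivatives of that map, which cancel in the bracket by their symmetry.\<close>

lemma lie_bracket_in_chart:
  assumes W: "open_subset A W" "p \<in> W" and X: "vector_field A W X" and Y: "vector_field A W Y"
    and c: "c \<in> A" "p \<in> fst c"
  defines "x \<equiv> snd c p"
  shows "vec_coord A c p (lie_bracket A X Y p) =
    pd (field_rep A c Y) x (field_rep A c X x) - pd (field_rep A c X) x (field_rep A c Y x)"
proof -
  let ?d = "chart_at A p"
  let ?t = "snd ?d \<circ> chart_inv c"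
  have d: "?d \<in> A" "p \<in> fst ?d" using chart_at_props[OF in_points[OF c]] .
  define S where "S = snd c ` (fst c \<inter> fst ?d \<inter> W)"
  have S: "open S"
    unfolding S_def using open_subset_image[OF open_subset_Int[OF open_subset_fst[OF d(1)] W(1)] c(1)]
    by (simp add: Int_ac)
  have xS: "x \<in> S" using W c d by (auto simp: S_def x_def)
  have t: "smooth_on ?t S"
    by (rule smooth_on_subset[OF transition_smooth[OF c(1) d(1)]]) (auto simp: S_def)
  have t2: "smooth_on (\<lambda>y. pd ?t y v) S" for v by (rule smooth_on_frechet_derivative[OF t])
  have inner: "((\<lambda>y. pd ?t y (field_rep A c Y y)) has_derivative
      (\<lambda>v. pd (\<lambda>y. pd ?t y (field_rep A c Y x)) x v + pd ?t x (pd (field_rep A c Y) x v))) (at x)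
    \<and> (\<forall>y\<in>S. pd ?t y (field_rep A c Y y) = (dir_deriv A Y (snd ?d) \<circ> chart_inv c) y)"
    if Y: "vector_field A W Y" for Y
  proof
    show "((\<lambda>y. pd ?t y (field_rep A c Y y)) has_derivative
      (\<lambda>v. pd (\<lambda>y. pd ?t y (field_rep A c Y x)) x v + pd ?t x (pd (field_rep A c Y) x v))) (at x)"
    proof (rule has_derivative_linear_family[OF S xS])
      show "linear (pd ?t y)" if "y \<in> S" for y
        by (rule linear_pd[OF smooth_on_differentiable[OF t that]])
      show "(\<lambda>y. pd ?t y u) differentiable (at x)" for u
        by (rule smooth_on_differentiable[OF t2 xS])
      show "(field_rep A c Y has_derivative pd (field_rep A c Y) x) (at x)"
        using field_rep_differentiable[OF Y c(1) W(2) c(2)]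
        by (simp add: frechet_derivative_works x_def)
    qed
    show "\<forall>y\<in>S. pd ?t y (field_rep A c Y y) = (dir_deriv A Y (snd ?d) \<circ> chart_inv c) y"
      using c d by (auto simp: S_def dir_deriv_def field_rep_at vec_coord_change[OF c(1) _ d(1)])
  qed
  have key: "dir_deriv A X (dir_deriv A Y (snd ?d)) p =
      pd (\<lambda>y. pd ?t y (field_rep A c Y x)) x (field_rep A c X x) +
      pd ?t x (pd (field_rep A c Y) x (field_rep A c X x))"
    if Y: "vector_field A W Y" for X Y
  proof -
    have h: "((dir_deriv A Y (snd ?d) \<circ> chart_inv c) has_derivative
      (\<lambda>v. pd (\<lambda>y. pd ?t y (field_rep A c Y x)) x v + pd ?t x (pd (field_rep A c Y) x v))) (at x)"
      by (rule has_derivative_transform_within_open[OF conjunct1[OF inner[OF Y]] S xS])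
         (use inner[OF Y] in blast)
    then have "(dir_deriv A Y (snd ?d) \<circ> chart_inv c) differentiable (at (snd c p))"
      unfolding x_def by (rule differentiableI)
    from dir_deriv_in_chart[OF c this, of X] show ?thesis
      using pd_eq[OF h] unfolding x_def by simp
  qed
  have lin: "linear (pd ?t x)" using smooth_on_differentiable[OF t xS] by (rule linear_pd)
  have "lie_bracket A X Y p =
      pd ?t x (pd (field_rep A c Y) x (field_rep A c X x) - pd (field_rep A c X) x (field_rep A c Y x))"
    unfolding lie_bracket_def Let_def key[OF X] key[OF Y] linear_diff[OF lin]
    using frechet_derivative_symmetric[OF S t xS, of "field_rep A c Y x" "field_rep A c X x"]
    by simp
  moreover have "pd ?t x v = chart_vec A c p v" for v by (simp add: chart_vec_def x_def)
  ultimately show ?thesis using c by simp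
qed

text \<open>Compact sets are closed in a Hausdorff space, so the complement of a closed coordinate
  ball is open in the manifold. A field supported in the ball can therefore be continued by
  zero.\<close>

lemma chart_compact_image_closed:
  assumes c: "c \<in> A" and H: "Hausdorff_space (manifold_topology A)"
    and K: "compact K" "K \<subseteq> snd c ` fst c"
  shows "open_subset A (points A - chart_inv c ` K)"
proof -
  note op = openin_manifold_topology[OF atlas]
  have top: "topspace (manifold_topology A) = points A"
  proof
    show "topspace (manifold_topology A) \<subseteq> points A"
      using op[of "topspace (manifold_topology A)"] by (simp add: open_subset_def)
    show "points A \<subseteq> topspace (manifold_topology A)"
      using op open_subset_points openin_subset by blast
  qed
  have "continuous_map (top_of_set (snd c ` fst c)) (manifold_topology A) (chart_inv c)"
    unfolding continuous_map_def
  proof (intro conjI allI impI)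
    show "chart_inv c \<in> topspace (top_of_set (snd c ` fst c)) \<rightarrow> topspace (manifold_topology A)"
      using c in_points[OF c] by (auto simp: top)
    fix U assume "openin (manifold_topology A) U"
    then have "open (snd c ` (U \<inter> fst c))" using open_subset_image c op by blast
    moreover have "{x \<in> topspace (top_of_set (snd c ` fst c)). chart_inv c x \<in> U} = snd c ` (U \<inter> fst c)"
      using c by auto
    ultimately show "openin (top_of_set (snd c ` fst c))
        {x \<in> topspace (top_of_set (snd c ` fst c)). chart_inv c x \<in> U}"
      by (auto simp: openin_open_eq[OF chart_image_open[OF c]])
  qed
  moreover have "compactin (top_of_set (snd c ` fst c)) K"
    using K by (simp add: compactin_subtopology)
  ultimately have "compactin (manifold_topology A) (chart_inv c ` K)"
    by (metis image_compactin)
  then have "closedin (manifold_topology A) (chart_inv c ` K)"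
    using H compactin_imp_closedin by blast
  then have "openin (manifold_topology A) (points A - chart_inv c ` K)"
    unfolding top[symmetric] by blast
  then show ?thesis using op by simp
qed

text \<open>Conditions such as \<open>star_identity\<close> are imposed on global fields, and can be
  used at a point only if every tangent vector there is a value of one. A coordinate field is
  multiplied by a bump function and continued by zero.\<close>

lemma global_field_through:
  assumes H: "Hausdorff_space (manifold_topology A)" and p: "p \<in> points A"
  obtains X where "vector_field A (points A) X" "X p = v"
proof -
  let ?c = "chart_at A p"
  have c: "?c \<in> A" "p \<in> fst ?c" using chart_at_props[OF p] .
  have "snd ?c p \<in> snd ?c ` fst ?c" using c by blast
  then obtain r where r: "r > 0" "cball (snd ?c p) r \<subseteq> snd ?c ` fst ?c"
    using chart_image_open[OF c(1)] open_contains_cball by blast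
  obtain \<psi> :: "'e \<Rightarrow> real" where \<psi>: "smooth_on \<psi> UNIV" "\<psi> (snd ?c p) = 1"
    "\<And>x. x \<notin> ball (snd ?c p) r \<Longrightarrow> \<psi> x = 0"
    using smooth_bump_exists[OF r(1), of "snd ?c p"] by metis
  define u where "u = vec_coord A ?c p v"
  define X where "X q = (if q \<in> fst ?c then chart_vec A ?c q (\<psi> (snd ?c q) *\<^sub>R u) else 0)" for q
  define N where "N = points A - chart_inv ?c ` cball (snd ?c p) r"
  have N: "open_subset A N"
    unfolding N_def by (rule chart_compact_image_closed[OF c(1) H compact_cball r(2)])
  have XN: "X q = 0" if "q \<in> N" for q
  proof (cases "q \<in> fst ?c")
    case True
    have "snd ?c q \<notin> cball (snd ?c p) r"
    proof
      assume "snd ?c q \<in> cball (snd ?c p) r"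
      then have "chart_inv ?c (snd ?c q) \<in> chart_inv ?c ` cball (snd ?c p) r" by (rule imageI)
      with that c True show False unfolding N_def by simp
    qed
    then have "\<psi> (snd ?c q) = 0" using \<psi>(3) ball_subset_cball by blast
    then show ?thesis using linear_0[OF linear_chart_vec[OF c(1) True]] True by (simp add: X_def)
  qed (simp add: X_def)
  have XN': "vector_field A N X"
    by (rule vector_field_cong[OF N vector_field_zero[OF N]]) (simp add: XN)
  have sm: "smooth_on (\<lambda>x. \<psi> x *\<^sub>R u) (snd ?c ` fst ?c)"
    by (intro smooth_on_scaleR smooth_on_const chart_image_open[OF c(1)] smooth_on_subset[OF \<psi>(1)]) auto
  have Xc: "vector_field A (fst ?c) X"
    by (rule vector_field_cong[OF open_subset_fst[OF c(1)] vector_field_chart_vec[OF c(1) sm]])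
       (simp add: X_def)
  \<comment> \<open>Both open sets carry a smooth restriction of \<open>X\<close>: zero on
    \<open>N\<close>, the cut-off coordinate field on the chart domain. Together they cover the
    manifold, and smoothness is local.\<close>
  have cov: "points A \<subseteq> N \<union> fst ?c"
    using r(2) c by (auto simp: N_def)
  have "vector_field A (points A) X"
    unfolding vector_field_iff
  proof
    fix d assume d: "d \<in> A"
    show "smooth_on (field_rep A d X) (snd d ` (points A \<inter> fst d))"
    proof (rule smooth_on_local)
      fix y assume "y \<in> snd d ` (points A \<inter> fst d)"
      then obtain q where q: "q \<in> points A" "q \<in> fst d" "y = snd d q" by auto
      have *: "\<exists>U. open U \<and> y \<in> U \<and> smooth_on (field_rep A d X) (snd d ` (points A \<inter> fst d) \<inter> U)"
        if W: "open_subset A W" "vector_field A W X" "q \<in> W" for W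
        by (intro exI[of _ "snd d ` (W \<inter> fst d)"] conjI open_subset_image[OF W(1) d]
              smooth_on_subset[OF vector_field_smooth_rep[OF W(2) d]]) (use q W in auto)
      show "\<exists>U. open U \<and> y \<in> U \<and> smooth_on (field_rep A d X) (snd d ` (points A \<inter> fst d) \<inter> U)"
        using *[OF N XN'] *[OF open_subset_fst[OF c(1)] Xc] cov q by blast
    qed
  qed
  moreover have "X p = v" using c \<psi>(2) by (simp add: X_def u_def)
  ultimately show ?thesis using that by blast
qed

end

section \<open>Connections in local coordinates\<close>

lemma pd_cong_open:
  assumes "open S" "x \<in> S" "\<And>y. y \<in> S \<Longrightarrow> f y = h y" "h differentiable (at x)"
  shows "pd f x v = pd h x v"
proof -
  have "frechet_derivative h (at x) = frechet_derivative f (at x)"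
    by (rule frechet_derivative_transform_within_open[OF assms(4,1,2)]) (simp add: assms(3))
  then show ?thesis by simp
qed

lemma differentiable_cong_open:
  assumes "open S" "x \<in> S" "\<And>y. y \<in> S \<Longrightarrow> f y = h y" "h differentiable (at x)"
  shows "f differentiable (at x)"
  using has_derivative_transform_within_open[OF assms(4)[unfolded frechet_derivative_works] assms(1,2)] assms(3)
  by (metis differentiableI)

text \<open>The Christoffel symbols without indices, as a bilinear map in the constant coordinates
  of two coordinate fields.\<close>

definition christoffel ::
  "('a, 'e::euclidean_space) chart set \<Rightarrow> (('a \<Rightarrow> 'e) \<Rightarrow> ('a \<Rightarrow> 'e) \<Rightarrow> 'a \<Rightarrow> 'e) \<Rightarrow> ('a, 'e) chart \<Rightarrow>
   'e \<Rightarrow> 'e \<Rightarrow> 'e \<Rightarrow> 'e" where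
  "christoffel A nabla c x u v =
     field_rep A c (nabla (\<lambda>q. chart_vec A c q u) (\<lambda>q. chart_vec A c q v)) x"

definition metric_rep ::
  "('a, 'e::euclidean_space) chart set \<Rightarrow> ('a \<Rightarrow> 'e \<Rightarrow> 'e \<Rightarrow> real) \<Rightarrow> ('a, 'e) chart \<Rightarrow> 'e \<Rightarrow> 'e \<Rightarrow> 'e \<Rightarrow> real" where
  "metric_rep A g c x u v =
     g (chart_inv c x) (chart_vec A c (chart_inv c x) u) (chart_vec A c (chart_inv c x) v)"

context atlas
begin

lemma connectionD:
  assumes "connection A nabla" "open_subset A W" "vector_field A W X" "vector_field A W Y"
  shows "vector_field A W (nabla X Y)"
    and "\<And>Z p. vector_field A W Z \<Longrightarrow> p \<in> W \<Longrightarrow> nabla (\<lambda>q. X q + Z q) Y p = nabla X Y p + nabla Z Y p"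
    and "\<And>Z p. vector_field A W Z \<Longrightarrow> p \<in> W \<Longrightarrow> nabla X (\<lambda>q. Y q + Z q) p = nabla X Y p + nabla X Z p"
    and "\<And>f p. smooth_fun A W f \<Longrightarrow> p \<in> W \<Longrightarrow> nabla (\<lambda>q. f q *\<^sub>R X q) Y p = f p *\<^sub>R nabla X Y p"
    and "\<And>f p. smooth_fun A W f \<Longrightarrow> p \<in> W \<Longrightarrow>
      nabla X (\<lambda>q. f q *\<^sub>R Y q) p = dir_deriv A X f p *\<^sub>R Y p + f p *\<^sub>R nabla X Y p"
proof -
  have c0: "smooth_fun A W (\<lambda>q. 0::real)" by (simp add: smooth_fun_def o_def)
  note * = assms(1)[unfolded connection_def, rule_format]
  show "vector_field A W (nabla X Y)" using *[of W X Y X "\<lambda>q. 0"] assms c0 by blast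
  show "nabla (\<lambda>q. X q + Z q) Y p = nabla X Y p + nabla Z Y p" if "vector_field A W Z" "p \<in> W" for Z p
    using *[of W X Y Z "\<lambda>q. 0"] assms c0 that by blast
  show "nabla X (\<lambda>q. Y q + Z q) p = nabla X Y p + nabla X Z p" if "vector_field A W Z" "p \<in> W" for Z p
    using *[of W X Y Z "\<lambda>q. 0"] assms c0 that by blast
  show "nabla (\<lambda>q. f q *\<^sub>R X q) Y p = f p *\<^sub>R nabla X Y p" if "smooth_fun A W f" "p \<in> W" for f p
    using *[of W X Y X f] assms that by blast
  show "nabla X (\<lambda>q. f q *\<^sub>R Y q) p = dir_deriv A X f p *\<^sub>R Y p + f p *\<^sub>R nabla X Y p"
    if "smooth_fun A W f" "p \<in> W" for f p
    using *[of W X Y X f] assms that by blast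
qed

text \<open>Multiplying by the indicator function of \<open>W\<close>, which is smooth on \<open>W\<close>, makes fields that agree
  on \<open>W\<close> equal.\<close>

lemma connection_cong:
  assumes N: "connection A nabla" and W: "open_subset A W" "p \<in> W"
    and XY: "vector_field A W X" "vector_field A W Y"
    and eq: "\<And>q. q \<in> W \<Longrightarrow> X q = X' q" "\<And>q. q \<in> W \<Longrightarrow> Y q = Y' q"
  shows "nabla X' Y' p = nabla X Y p"
proof -
  define f where "f q = (if q \<in> W then 1 else 0 :: real)" for q
  have f: "smooth_fun A W f"
    unfolding smooth_fun_def
  proof
    fix c assume c: "c \<in> A"
    show "smooth_on (f \<circ> chart_inv c) (snd c ` (W \<inter> fst c))"
      by (rule smooth_on_cong[OF smooth_on_const[of 1] open_subset_image[OF W(1) c]])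
         (use c in \<open>auto simp: f_def\<close>)
  qed
  have X': "vector_field A W X'" and Y': "vector_field A W Y'"
    using vector_field_cong[OF W(1)] XY eq by blast+
  have fX: "(\<lambda>q. f q *\<^sub>R X q) = (\<lambda>q. f q *\<^sub>R X' q)" "(\<lambda>q. f q *\<^sub>R Y q) = (\<lambda>q. f q *\<^sub>R Y' q)"
    using eq by (auto simp: f_def)
  have fp: "f p = 1" using W by (simp add: f_def)
  have "nabla X' Y' p = nabla X Y' p"
    using connectionD(4)[OF N W(1) X' Y' f W(2)] connectionD(4)[OF N W(1) XY(1) Y' f W(2)] fp
    by (simp add: fX)
  also have "nabla X Y' p = nabla X Y p"
    using connectionD(5)[OF N W(1) XY(1) Y' f W(2)] connectionD(5)[OF N W(1) XY f W(2)] fp eq(2)[OF W(2)]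
    by (simp add: fX)
  finally show ?thesis .
qed

lemma connection_zero_left:
  assumes N: "connection A nabla" and W: "open_subset A W" "p \<in> W" and Y: "vector_field A W Y"
  shows "nabla (\<lambda>q. 0) Y p = 0"
  using connectionD(2)[OF N W(1) vector_field_zero[OF W(1)] Y vector_field_zero[OF W(1)] W(2)] by simp

lemma connection_zero_right:
  assumes N: "connection A nabla" and W: "open_subset A W" "p \<in> W" and X: "vector_field A W X"
  shows "nabla X (\<lambda>q. 0) p = 0"
  using connectionD(3)[OF N W(1) X vector_field_zero[OF W(1)] vector_field_zero[OF W(1)] W(2)] by simp

lemma connection_sum_left:
  assumes N: "connection A nabla" and W: "open_subset A W" "p \<in> W" and Y: "vector_field A W Y"
    and X: "\<And>i. i \<in> I \<Longrightarrow> vector_field A W (X i)"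
  shows "nabla (\<lambda>q. \<Sum>i\<in>I. X i q) Y p = (\<Sum>i\<in>I. nabla (X i) Y p)"
  using X
proof (induction I rule: infinite_finite_induct)
  case (insert i I)
  have "vector_field A W (\<lambda>q. \<Sum>i\<in>I. X i q)"
    using insert.prems by (intro vector_field_sum W(1)) auto
  then show ?case
    using insert connectionD(2)[OF N W(1) _ Y _ W(2), of "X i"] by simp
qed (use connection_zero_left[OF N W Y] in simp_all)

lemma connection_sum_right:
  assumes N: "connection A nabla" and W: "open_subset A W" "p \<in> W" and X: "vector_field A W X"
    and Y: "\<And>i. i \<in> I \<Longrightarrow> vector_field A W (Y i)"
  shows "nabla X (\<lambda>q. \<Sum>i\<in>I. Y i q) p = (\<Sum>i\<in>I. nabla X (Y i) p)"
  using Y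
proof (induction I rule: infinite_finite_induct)
  case (insert i I)
  have "vector_field A W (\<lambda>q. \<Sum>i\<in>I. Y i q)"
    using insert.prems by (intro vector_field_sum W(1)) auto
  then show ?case
    using insert connectionD(3)[OF N W(1) X _ _ W(2), of "Y i"] by simp
qed (use connection_zero_right[OF N W X] in simp_all)

lemma vector_field_components:
  assumes c: "c \<in> A" and W: "open_subset A W" "W \<subseteq> fst c" and X: "vector_field A W X"
  shows "smooth_fun A W (\<lambda>q. vec_coord A c q (X q) \<bullet> b)"
    and "q \<in> W \<Longrightarrow> (\<Sum>b\<in>Basis. (vec_coord A c q (X q) \<bullet> b) *\<^sub>R chart_vec A c q b) = X q"
proof -
  have Wc: "snd c ` (W \<inter> fst c) = snd c ` W" using W by (simp add: Int_absorb2)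
  have op: "open (snd c ` W)" using open_subset_image[OF W(1) c] Wc by simp
  have "smooth_on (\<lambda>x. field_rep A c X x \<bullet> b) (snd c ` W)"
    using smooth_on_bounded_linear[OF vector_field_smooth_rep[OF X c] _ bounded_linear_inner_left] op Wc by simp
  then show "smooth_fun A W (\<lambda>q. vec_coord A c q (X q) \<bullet> b)"
    by (intro smooth_funI_chart[OF c W(2,1)]) (simp add: o_def field_rep_def)
  assume q: "q \<in> W"
  then have qc: "q \<in> fst c" using W by auto
  show "(\<Sum>b\<in>Basis. (vec_coord A c q (X q) \<bullet> b) *\<^sub>R chart_vec A c q b) = X q"
    using linear_basis_expansion[OF linear_chart_vec[OF c qc], of "vec_coord A c q (X q)"] c qc by simp
qed

text \<open>Tensoriality in the first argument: on \<open>W \<inter> fst c\<close> the field is a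
  combination of coordinate fields, whose smooth coefficients can be pulled out.\<close>

lemma connection_left_in_chart:
  assumes N: "connection A nabla" and W: "open_subset A W" "p \<in> W" and c: "c \<in> A" "p \<in> fst c"
    and X: "vector_field A W X" and Y: "vector_field A W Y"
  shows "nabla X Y p = (\<Sum>b\<in>Basis. (vec_coord A c p (X p) \<bullet> b) *\<^sub>R nabla (\<lambda>q. chart_vec A c q b) Y p)"
proof -
  define W' where "W' = W \<inter> fst c"
  have W': "open_subset A W'" "W' \<subseteq> fst c" "p \<in> W'"
    using open_subset_Int[OF W(1) open_subset_fst[OF c(1)]] W c by (auto simp: W'_def)
  have X': "vector_field A W' X" and Y': "vector_field A W' Y"
    using X Y vector_field_subset by (auto simp: W'_def)
  note comp = vector_field_components[OF c(1) W'(1,2) X']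
  have cv: "vector_field A W' (\<lambda>q. chart_vec A c q b)" for b
    by (rule vector_field_subset[OF vector_field_chart_vec_const[OF c(1)] W'(2)])
  have s: "vector_field A W' (\<lambda>q. (vec_coord A c q (X q) \<bullet> b) *\<^sub>R chart_vec A c q b)" for b
    by (rule vector_field_scaleR[OF W'(1) comp(1) cv])
  have "nabla X Y p = nabla (\<lambda>q. \<Sum>b\<in>Basis. (vec_coord A c q (X q) \<bullet> b) *\<^sub>R chart_vec A c q b) Y p"
    by (rule connection_cong[OF N W'(1,3) vector_field_sum[OF W'(1) s] Y']) (auto simp: comp(2))
  also have "\<dots> = (\<Sum>b\<in>Basis. nabla (\<lambda>q. (vec_coord A c q (X q) \<bullet> b) *\<^sub>R chart_vec A c q b) Y p)"
    by (rule connection_sum_left[OF N W'(1,3) Y' s])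
  also have "\<dots> = (\<Sum>b\<in>Basis. (vec_coord A c p (X p) \<bullet> b) *\<^sub>R nabla (\<lambda>q. chart_vec A c q b) Y p)"
    by (rule sum.cong[OF refl]) (rule connectionD(4)[OF N W'(1) cv Y' comp(1) W'(3)])
  finally show ?thesis .
qed

text \<open>The same expansion of the second argument; here the Leibniz rule contributes the
  derivatives of the components.\<close>

lemma connection_right_in_chart:
  assumes N: "connection A nabla" and W: "open_subset A W" "p \<in> W" and c: "c \<in> A" "p \<in> fst c"
    and Y: "vector_field A W Y"
  defines "x \<equiv> snd c p"
  shows "nabla (\<lambda>q. chart_vec A c q u) Y p = chart_vec A c p (pd (field_rep A c Y) x u) +
    (\<Sum>d\<in>Basis. (vec_coord A c p (Y p) \<bullet> d) *\<^sub>R nabla (\<lambda>q. chart_vec A c q u) (\<lambda>q. chart_vec A c q d) p)"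
proof -
  define W' where "W' = W \<inter> fst c"
  have W': "open_subset A W'" "W' \<subseteq> fst c" "p \<in> W'"
    using open_subset_Int[OF W(1) open_subset_fst[OF c(1)]] W c by (auto simp: W'_def)
  have Y': "vector_field A W' Y"
    using Y vector_field_subset by (auto simp: W'_def)
  let ?h = "\<lambda>d q. vec_coord A c q (Y q) \<bullet> d"
  let ?U = "\<lambda>q. chart_vec A c q u"
  note comp = vector_field_components[OF c(1) W'(1,2) Y']
  have cv: "vector_field A W' (\<lambda>q. chart_vec A c q b)" for b
    by (rule vector_field_subset[OF vector_field_chart_vec_const[OF c(1)] W'(2)])
  have s: "vector_field A W' (\<lambda>q. ?h b q *\<^sub>R chart_vec A c q b)" for b
    by (rule vector_field_scaleR[OF W'(1) comp(1) cv])
  have dd: "dir_deriv A ?U (?h d) p = pd (field_rep A c Y) x u \<bullet> d" for d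
  proof -
    have o: "?h d \<circ> chart_inv c = (\<lambda>y. field_rep A c Y y \<bullet> d)" by (simp add: o_def field_rep_def)
    note df = field_rep_differentiable[OF Y c(1) W(2) c(2)]
    have "(?h d \<circ> chart_inv c) differentiable (at (snd c p))"
      unfolding o using df by (auto intro: differentiable_inner)
    from dir_deriv_in_chart[OF c this, of ?U] show ?thesis
      unfolding o x_def using c
      by (simp add: frechet_derivative_bounded_linear[OF df bounded_linear_inner_left] field_rep_at)
  qed
  have "nabla ?U Y p = nabla ?U (\<lambda>q. \<Sum>d\<in>Basis. ?h d q *\<^sub>R chart_vec A c q d) p"
    by (rule connection_cong[OF N W'(1,3) cv vector_field_sum[OF W'(1) s]]) (auto simp: comp(2))
  also have "\<dots> = (\<Sum>d\<in>Basis. nabla ?U (\<lambda>q. ?h d q *\<^sub>R chart_vec A c q d) p)"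
    by (rule connection_sum_right[OF N W'(1,3) cv s])
  also have "\<dots> = (\<Sum>d\<in>Basis. dir_deriv A ?U (?h d) p *\<^sub>R chart_vec A c p d +
      ?h d p *\<^sub>R nabla ?U (\<lambda>q. chart_vec A c q d) p)"
    by (rule sum.cong[OF refl]) (rule connectionD(5)[OF N W'(1) cv cv comp(1) W'(3)])
  also have "\<dots> = (\<Sum>d\<in>Basis. (pd (field_rep A c Y) x u \<bullet> d) *\<^sub>R chart_vec A c p d) +
      (\<Sum>d\<in>Basis. ?h d p *\<^sub>R nabla ?U (\<lambda>q. chart_vec A c q d) p)"
    by (simp add: dd sum.distrib)
  finally show ?thesis
    using linear_basis_expansion[OF linear_chart_vec[OF c], of "pd (field_rep A c Y) x u"] by simp
qed

lemma pd_field_rep_chart_vec [simp]: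
  assumes "c \<in> A" "x \<in> snd c ` fst c"
  shows "pd (field_rep A c (\<lambda>q. chart_vec A c q u)) x v = 0"
  by (rule trans[OF pd_cong_open[OF chart_image_open[OF assms(1)] assms(2)]])
     (use field_rep_chart_vec_const[OF assms(1)] in auto)

lemma christoffel_at:
  "c \<in> A \<Longrightarrow> p \<in> fst c \<Longrightarrow> christoffel A nabla c (snd c p) u v =
    vec_coord A c p (nabla (\<lambda>q. chart_vec A c q u) (\<lambda>q. chart_vec A c q v) p)"
  by (simp add: christoffel_def field_rep_at)

text \<open>The laws of a connection concern fields, not vectors. Bilinearity in \<open>u\<close>
  and \<open>v\<close> comes from expanding coordinate fields in those of the basis: the
  coefficients are constant, so no derivative term appears.\<close>

lemma smooth_bil_christoffel:
  assumes N: "connection A nabla" and c: "c \<in> A"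
  shows "smooth_bil (christoffel A nabla c) (snd c ` fst c)"
  unfolding smooth_bil_def
proof (intro conjI ballI allI)
  show "open (snd c ` fst c)" by (rule chart_image_open[OF c])
  have cv: "vector_field A (fst c) (\<lambda>q. chart_vec A c q u)" for u
    by (rule vector_field_chart_vec_const[OF c])
  show "smooth_on (\<lambda>x. christoffel A nabla c x u v) (snd c ` fst c)" for u v
    using vector_field_smooth_rep[OF connectionD(1)[OF N open_subset_fst[OF c] cv cv] c]
    by (simp add: christoffel_def[abs_def])
  fix x assume x: "x \<in> snd c ` fst c"
  then obtain p where p: "p \<in> fst c" "x = snd c p" by auto
  note lin = linear_vec_coord[OF c p(1)]
  have left: "christoffel A nabla c x u v = (\<Sum>b\<in>Basis. (u \<bullet> b) *\<^sub>R christoffel A nabla c x b v)" for u v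
    unfolding p(2) christoffel_at[OF c p(1)]
    by (subst connection_left_in_chart[OF N open_subset_fst[OF c] p(1) c p(1) cv cv])
       (use c p in \<open>simp add: linear_sum[OF lin] linear_scale[OF lin]\<close>)
  have right: "christoffel A nabla c x u v = (\<Sum>b\<in>Basis. (v \<bullet> b) *\<^sub>R christoffel A nabla c x u b)" for u v
    unfolding p(2) christoffel_at[OF c p(1)]
    by (subst connection_right_in_chart[OF N open_subset_fst[OF c] p(1) c p(1) cv])
       (use c p in \<open>simp add: linear_sum[OF lin] linear_scale[OF lin] linear_add[OF lin] linear_0[OF linear_chart_vec]\<close>)
  have L: "linear (\<lambda>u::'e. \<Sum>b\<in>Basis. (u \<bullet> b) *\<^sub>R h b)" for h :: "'e \<Rightarrow> 'e"
    by (auto intro!: linearI simp: inner_add_left scaleR_add_left sum.distrib scaleR_sum_right)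
  show "bilinear (christoffel A nabla c x)"
    unfolding bilinear_def
  proof (intro conjI allI)
    show "linear (christoffel A nabla c x u)" for u
    proof -
      have "christoffel A nabla c x u = (\<lambda>v. \<Sum>b\<in>Basis. (v \<bullet> b) *\<^sub>R christoffel A nabla c x u b)"
        using right by blast
      then show ?thesis using L by metis
    qed
    show "linear (\<lambda>u. christoffel A nabla c x u v)" for v
      by (subst left) (rule L)
  qed
qed

text \<open>By tensoriality the first field may be replaced by the coordinate field with the same
  value at \<open>p\<close>; the Leibniz expansion of the second then yields a derivative and a
  Christoffel term.\<close>

lemma connection_in_chart:
  assumes N: "connection A nabla" and W: "open_subset A W" "p \<in> W" and c: "c \<in> A" "p \<in> fst c"
    and X: "vector_field A W X" and Y: "vector_field A W Y"
  defines "x \<equiv> snd c p"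
  shows "vec_coord A c p (nabla X Y p) = pd (field_rep A c Y) x (field_rep A c X x) +
    christoffel A nabla c x (field_rep A c X x) (field_rep A c Y x)"
proof -
  have cv: "vector_field A (fst c) (\<lambda>q. chart_vec A c q u)" for u
    by (rule vector_field_chart_vec_const[OF c(1)])
  let ?u = "vec_coord A c p (X p)"
  define W' where "W' = W \<inter> fst c"
  have W': "open_subset A W'" "p \<in> W'"
    using open_subset_Int[OF W(1) open_subset_fst[OF c(1)]] W c by (auto simp: W'_def)
  have Y': "vector_field A W' Y"
    using Y vector_field_subset by (auto simp: W'_def)
  have cv': "vector_field A W' (\<lambda>q. chart_vec A c q u)" for u
    by (rule vector_field_subset[OF cv]) (auto simp: W'_def)
  have "nabla X Y p = nabla (\<lambda>q. chart_vec A c q ?u) Y p"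
    using connection_left_in_chart[OF N W c X Y] connection_left_in_chart[OF N W' c cv' Y', of ?u] c by simp
  also have "\<dots> = chart_vec A c p (pd (field_rep A c Y) x ?u) +
    (\<Sum>d\<in>Basis. (vec_coord A c p (Y p) \<bullet> d) *\<^sub>R nabla (\<lambda>q. chart_vec A c q ?u) (\<lambda>q. chart_vec A c q d) p)"
    unfolding x_def by (rule connection_right_in_chart[OF N W c Y])
  finally have eq: "nabla X Y p = \<dots>" .
  note lin = linear_vec_coord[OF c]
  have bil: "linear (christoffel A nabla c x ?u)"
    using smooth_bil_linear(1)[OF smooth_bil_christoffel[OF N c(1)]] c by (simp add: x_def)
  show ?thesis
    unfolding eq
    using linear_basis_expansion[OF bil, of "vec_coord A c p (Y p)"] c
    by (simp add: linear_add[OF lin] linear_sum[OF lin] linear_scale[OF lin] x_def christoffel_at field_rep_at)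
qed

text \<open>Coordinate fields commute, so on them vanishing torsion is symmetry of the
  symbols.\<close>

lemma christoffel_symmetric:
  assumes N: "connection A nabla" and T: "torsion_free A nabla" and c: "c \<in> A" and x: "x \<in> snd c ` fst c"
  shows "christoffel A nabla c x u v = christoffel A nabla c x v u"
proof -
  obtain p where p: "p \<in> fst c" "x = snd c p" using x by auto
  have cv: "vector_field A (fst c) (\<lambda>q. chart_vec A c q u)" for u
    by (rule vector_field_chart_vec_const[OF c])
  have "vec_coord A c p (lie_bracket A (\<lambda>q. chart_vec A c q u) (\<lambda>q. chart_vec A c q v) p) = 0"
    by (subst lie_bracket_in_chart[OF open_subset_fst[OF c] p(1) cv cv c p(1)]) (use c p in simp)
  moreover have "nabla (\<lambda>q. chart_vec A c q u) (\<lambda>q. chart_vec A c q v) p -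
      nabla (\<lambda>q. chart_vec A c q v) (\<lambda>q. chart_vec A c q u) p =
      lie_bracket A (\<lambda>q. chart_vec A c q u) (\<lambda>q. chart_vec A c q v) p"
    using T cv open_subset_fst[OF c] p unfolding torsion_free_def by blast
  ultimately show ?thesis
    unfolding p(2) christoffel_at[OF c p(1)]
    using linear_diff[OF linear_vec_coord[OF c p(1)]] by (metis right_minus_eq)
qed

text \<open>Vanishing of the curvature on three coordinate fields, whose brackets are zero.\<close>

lemma christoffel_flat:
  assumes N: "connection A nabla" and F: "flat_connection A nabla" and c: "c \<in> A" and x: "x \<in> snd c ` fst c"
  shows "pd (\<lambda>y. christoffel A nabla c y b u) x a + christoffel A nabla c x a (christoffel A nabla c x b u) =
    pd (\<lambda>y. christoffel A nabla c y a u) x b + christoffel A nabla c x b (christoffel A nabla c x a u)"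
proof -
  obtain p where p: "p \<in> fst c" "x = snd c p" using x by auto
  let ?V = "\<lambda>u q. chart_vec A c q u"
  have cv: "vector_field A (fst c) (?V u)" for u
    by (rule vector_field_chart_vec_const[OF c])
  note op = open_subset_fst[OF c]
  note lin = linear_vec_coord[OF c p(1)]
  have nn: "vec_coord A c p (nabla (?V a) (nabla (?V b) (?V u)) p) =
      pd (\<lambda>y. christoffel A nabla c y b u) x a + christoffel A nabla c x a (christoffel A nabla c x b u)" for a b
    by (subst connection_in_chart[OF N op p(1) c p(1) cv connectionD(1)[OF N op cv cv]])
       (use x c p in \<open>simp add: christoffel_def[abs_def] field_rep_chart_vec_const\<close>)
  have lb: "lie_bracket A (?V a) (?V b) q = 0" if q: "q \<in> fst c" for q
  proof -
    have "vec_coord A c q (lie_bracket A (?V a) (?V b) q) = 0"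
      by (subst lie_bracket_in_chart[OF op q cv cv c q]) (use c q in simp)
    then show ?thesis
      using chart_vec_vec_coord[OF c q] linear_0[OF linear_chart_vec[OF c q]] by metis
  qed
  \<comment> \<open>The bracket is known to vanish on the chart domain only, so the locality of the
    connection is used to insert the zero field.\<close>
  have "nabla (lie_bracket A (?V a) (?V b)) (?V u) p = nabla (\<lambda>q. 0) (?V u) p"
    by (rule connection_cong[OF N op p(1) vector_field_zero[OF op] cv]) (auto simp: lb)
  then have z: "nabla (lie_bracket A (?V a) (?V b)) (?V u) p = 0"
    using connection_zero_left[OF N op p(1) cv] by simp
  have "nabla (?V a) (nabla (?V b) (?V u)) p - nabla (?V b) (nabla (?V a) (?V u)) p -
      nabla (lie_bracket A (?V a) (?V b)) (?V u) p = 0"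
    using F cv op p(1) unfolding flat_connection_def by blast
  then have "nabla (?V a) (nabla (?V b) (?V u)) p = nabla (?V b) (nabla (?V a) (?V u)) p"
    using z by simp
  then show ?thesis using nn[of a b] nn[of b a] by simp
qed

section \<open>Metrics and two-forms in a chart\<close>

lemma riemannian_posdef:
  "riemannian_metric A g \<Longrightarrow> p \<in> points A \<Longrightarrow> posdef (g p)"
  by (auto simp: riemannian_metric_def posdef_def)

lemma metric_rep_at:
  assumes "c \<in> A" "p \<in> fst c"
  shows "metric_rep A g c (snd c p) u v = g p (chart_vec A c p u) (chart_vec A c p v)"
    and "g p v w = metric_rep A g c (snd c p) (vec_coord A c p v) (vec_coord A c p w)"
  using assms by (auto simp: metric_rep_def)

lemma posdef_metric_rep:
  assumes g: "riemannian_metric A g" and c: "c \<in> A" and x: "x \<in> snd c ` fst c"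
  shows "posdef (metric_rep A g c x)"
proof -
  obtain p where p: "p \<in> fst c" "x = snd c p" using x by auto
  note P = riemannian_posdef[OF g in_points[OF c p(1)]]
  note lin = linear_chart_vec[OF c p(1)]
  have inj: "chart_vec A c p u = 0 \<Longrightarrow> u = 0" for u
    using vec_coord_chart_vec[OF c p(1), of u] linear_0[OF linear_vec_coord[OF c p(1)]] by metis
  have 1: "linear (\<lambda>v. g p (chart_vec A c p u) (chart_vec A c p v))" for u
    using linear_compose[OF lin, of "g p (chart_vec A c p u)"] posdefD(1)[OF P]
    by (auto simp: o_def bilinear_def)
  have 2: "linear (\<lambda>u. g p (chart_vec A c p u) (chart_vec A c p v))" for v
    using linear_compose[OF lin, of "\<lambda>u. g p u (chart_vec A c p v)"] posdefD(1)[OF P]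
    by (auto simp: o_def bilinear_def)
  show ?thesis
    unfolding posdef_def bilinear_def p(2) metric_rep_at(1)[OF c p(1)]
  proof (intro conjI allI impI)
    fix u :: 'e assume "u \<noteq> 0"
    then have "chart_vec A c p u \<noteq> 0" using inj by blast
    then show "0 < g p (chart_vec A c p u) (chart_vec A c p u)" by (rule posdefD(3)[OF P])
  qed (use 1 2 posdefD(2)[OF P] in auto)
qed

lemma smooth_bil_metric_rep:
  assumes g: "riemannian_metric A g" and c: "c \<in> A"
  shows "smooth_bil (metric_rep A g c) (snd c ` fst c)"
  unfolding smooth_bil_def
proof (intro conjI ballI allI)
  show "open (snd c ` fst c)" by (rule chart_image_open[OF c])
  show "bilinear (metric_rep A g c x)" if "x \<in> snd c ` fst c" for x
    using posdef_metric_rep[OF g c that] posdefD(1) by blast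
  fix u v
  have cv: "vector_field A (fst c) (\<lambda>q. chart_vec A c q u)" for u
    by (rule vector_field_chart_vec_const[OF c])
  have "smooth_fun A (fst c) (\<lambda>p. g p (chart_vec A c p u) (chart_vec A c p v))"
    using g cv open_subset_fst[OF c] unfolding riemannian_metric_def by blast
  then show "smooth_on (\<lambda>x. metric_rep A g c x u v) (snd c ` fst c)"
    using c unfolding smooth_fun_def by (auto simp: metric_rep_def[abs_def] o_def)
qed

text \<open>Product rule for a bilinear tensor, stated for any \<open>\<eta>\<close> with a smooth
  coordinate expression so that it serves both metrics and fundamental forms.\<close>

lemma dir_deriv_tensor_in_chart:
  assumes W: "p \<in> W" and c: "c \<in> A" "p \<in> fst c"
    and B: "smooth_bil B (snd c ` fst c)"
    and \<eta>: "\<And>q v w. q \<in> fst c \<Longrightarrow> \<eta> q v w = B (snd c q) (vec_coord A c q v) (vec_coord A c q w)"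
    and Y: "vector_field A W Y" and Z: "vector_field A W Z"
  defines "x \<equiv> snd c p"
  shows "dir_deriv A X (\<lambda>q. \<eta> q (Y q) (Z q)) p =
    pd (\<lambda>y. B y (field_rep A c Y x) (field_rep A c Z x)) x (field_rep A c X x) +
    B x (pd (field_rep A c Y) x (field_rep A c X x)) (field_rep A c Z x) +
    B x (field_rep A c Y x) (pd (field_rep A c Z) x (field_rep A c X x))"
proof -
  have x: "x \<in> snd c ` fst c" using c by (simp add: x_def)
  note op = chart_image_open[OF c(1)]
  have dY: "field_rep A c Y differentiable (at x)" and dZ: "field_rep A c Z differentiable (at x)"
    using field_rep_differentiable[OF Y c(1) W c(2)] field_rep_differentiable[OF Z c(1) W c(2)]
    by (auto simp: x_def)
  have d: "(\<lambda>y. B y (field_rep A c Y y) (field_rep A c Z y)) differentiable (at x)"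
    using has_derivative_smooth_bil[OF B x dY[unfolded frechet_derivative_works] dZ[unfolded frechet_derivative_works]]
    by (rule differentiableI)
  have eq: "((\<lambda>q. \<eta> q (Y q) (Z q)) \<circ> chart_inv c) y = B y (field_rep A c Y y) (field_rep A c Z y)"
    if "y \<in> snd c ` fst c" for y
    using that c(1) by (auto simp: \<eta> field_rep_at)
  have "dir_deriv A X (\<lambda>q. \<eta> q (Y q) (Z q)) p =
      pd ((\<lambda>q. \<eta> q (Y q) (Z q)) \<circ> chart_inv c) x (field_rep A c X x)"
    unfolding x_def
    by (rule dir_deriv_in_chart[OF c differentiable_cong_open[OF op x[unfolded x_def] eq d[unfolded x_def]]])
  also have "\<dots> = pd (\<lambda>y. B y (field_rep A c Y y) (field_rep A c Z y)) x (field_rep A c X x)"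
    by (rule pd_cong_open[OF op x eq d])
  finally show ?thesis using pd_smooth_bil[OF B x dY dZ] by simp
qed

lemma dir_deriv_metric_in_chart:
  assumes g: "riemannian_metric A g" and W: "p \<in> W" and c: "c \<in> A" "p \<in> fst c"
    and Y: "vector_field A W Y" and Z: "vector_field A W Z"
  defines "x \<equiv> snd c p" and "G \<equiv> metric_rep A g c"
  shows "dir_deriv A X (\<lambda>q. g q (Y q) (Z q)) p =
    pd (\<lambda>y. G y (field_rep A c Y x) (field_rep A c Z x)) x (field_rep A c X x) +
    G x (pd (field_rep A c Y) x (field_rep A c X x)) (field_rep A c Z x) +
    G x (field_rep A c Y x) (pd (field_rep A c Z) x (field_rep A c X x))"
  unfolding x_def G_def
  by (rule dir_deriv_tensor_in_chart[OF W c smooth_bil_metric_rep[OF g c(1)] metric_rep_at(2)[OF c(1)] Y Z])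

text \<open>The derivatives of the fields that arise from the three pairings cancel against the
  bracket terms by skewness, and only the derivatives of the coefficients remain.\<close>

lemma ext_deriv_2form_in_chart:
  assumes W: "open_subset A W" "p \<in> W" and c: "c \<in> A" "p \<in> fst c"
    and B: "smooth_bil B (snd c ` fst c)" and skew: "\<And>u v. B (snd c p) u v = - B (snd c p) v u"
    and \<eta>: "\<And>q v w. q \<in> fst c \<Longrightarrow> \<eta> q v w = B (snd c q) (vec_coord A c q v) (vec_coord A c q w)"
    and X: "vector_field A W X" and Y: "vector_field A W Y" and Z: "vector_field A W Z"
  defines "x \<equiv> snd c p"
  defines "X' \<equiv> field_rep A c X x" and "Y' \<equiv> field_rep A c Y x" and "Z' \<equiv> field_rep A c Z x"
  shows "ext_deriv_2form A \<eta> X Y Z p =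
    pd (\<lambda>y. B y Y' Z') x X' + pd (\<lambda>y. B y Z' X') x Y' + pd (\<lambda>y. B y X' Y') x Z'"
proof -
  have x: "x \<in> snd c ` fst c" using c by (simp add: x_def)
  note bl = smooth_bil_bilinear[OF B x]
  have D: "dir_deriv A U (\<lambda>q. \<eta> q (Y q) (Z q)) p =
      pd (\<lambda>y. B y (field_rep A c Y x) (field_rep A c Z x)) x (field_rep A c U x) +
      B x (pd (field_rep A c Y) x (field_rep A c U x)) (field_rep A c Z x) +
      B x (field_rep A c Y x) (pd (field_rep A c Z) x (field_rep A c U x))"
    if "vector_field A W Y" "vector_field A W Z" for U Y Z
    unfolding x_def by (rule dir_deriv_tensor_in_chart[OF W(2) c B \<eta> that])
  note L = lie_bracket_in_chart[OF W _ _ c, folded x_def]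
  have f: "vec_coord A c p (U p) = field_rep A c U x" for U
    using c by (simp add: x_def field_rep_at)
  show ?thesis
    unfolding ext_deriv_2form_def D[OF Y Z] D[OF Z X] D[OF X Y] \<eta>[OF c(2)] L[OF X Y] L[OF Y Z] L[OF Z X]
      f[of X] f[of Y] f[of Z] x_def[symmetric] X'_def[symmetric] Y'_def[symmetric] Z'_def[symmetric]
    using skew[folded x_def, of X'] skew[folded x_def, of Y'] skew[folded x_def, of Z']
    by (simp add: bilinear_lsub[OF bl])
qed

lemma metric_christoffel:
  assumes N: "connection A nabla" and M: "metric_connection A g nabla" and g: "riemannian_metric A g"
    and c: "c \<in> A" and x: "x \<in> snd c ` fst c"
  defines "G \<equiv> metric_rep A g c" and "\<Gamma> \<equiv> christoffel A nabla c"
  shows "pd (\<lambda>y. G y v w) x u = G x (\<Gamma> x u v) w + G x v (\<Gamma> x u w)"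
proof -
  obtain p where p: "p \<in> fst c" "x = snd c p" using x by auto
  let ?V = "\<lambda>u q. chart_vec A c q u"
  have cv: "vector_field A (fst c) (?V u)" for u
    by (rule vector_field_chart_vec_const[OF c])
  have "dir_deriv A (?V u) (\<lambda>q. g q (?V v q) (?V w q)) p =
      g p (nabla (?V u) (?V v) p) (?V w p) + g p (?V v p) (nabla (?V u) (?V w) p)"
    using M cv open_subset_fst[OF c] p(1) unfolding metric_connection_def by blast
  moreover have "dir_deriv A (?V u) (\<lambda>q. g q (?V v q) (?V w q)) p = pd (\<lambda>y. G y v w) x u"
    using dir_deriv_metric_in_chart[OF g p(1) c p(1) cv cv, of "?V u" v w] x c p
      posdefD(1)[OF posdef_metric_rep[OF g c x]]
    by (simp add: field_rep_chart_vec_const G_def bilinear_lzero bilinear_rzero)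
  ultimately show ?thesis
    using metric_rep_at(2)[OF c p(1), of g] c p by (simp add: G_def \<Gamma>_def christoffel_at)
qed

end

section \<open>Existence of the Levi-Civita connection\<close>

text \<open>The representing vector is given by a formula and not merely by existence: inserted into
  a smooth frame, the formula shows that the vector depends smoothly on the point.\<close>

lemma riesz_onb:
  fixes g :: "'e::euclidean_space \<Rightarrow> 'e \<Rightarrow> real"
  assumes g: "posdef g" and B: "is_onb g B" and L: "linear L"
  shows "g (\<Sum>b\<in>B. L b *\<^sub>R b) z = L z"
proof -
  have "L z = L (\<Sum>b\<in>B. g z b *\<^sub>R b)" using is_onb_expansion[OF g B, of z] by simp
  also have "\<dots> = (\<Sum>b\<in>B. g z b * L b)" by (simp add: linear_sum[OF L] linear_scale[OF L])
  finally show ?thesis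
    by (simp add: bilinear_sum_left[OF posdefD(1)[OF g]] bilinear_lmul[OF posdefD(1)[OF g]]
        posdefD(2)[OF g, of z] mult.commute)
qed

lemma posdef_solve:
  fixes g :: "'e::euclidean_space \<Rightarrow> 'e \<Rightarrow> real"
  assumes g: "posdef g" and L: "linear L"
  shows "\<exists>!w. \<forall>z. g w z = L z"
proof -
  obtain B where B: "is_onb g B" using is_onb_exists[OF g] by blast
  have "\<forall>z. g (\<Sum>b\<in>B. L b *\<^sub>R b) z = L z" using riesz_onb[OF g B L] by blast
  moreover have "w = w'" if "\<forall>z. g w z = L z" "\<forall>z. g w' z = L z" for w w'
    by (rule posdef_eqI[OF g]) (use that in simp)
  ultimately show ?thesis by blast
qed

text \<open>The Koszul formula on coordinate fields, i.e. the Christoffel symbols of the first kind.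
  Solving for the vector with these pairings raises the index and gives
  \<open>lc_symbol\<close>.\<close>

definition koszul_rhs :: "('e::euclidean_space \<Rightarrow> 'e \<Rightarrow> 'e \<Rightarrow> real) \<Rightarrow> 'e \<Rightarrow> 'e \<Rightarrow> 'e \<Rightarrow> 'e \<Rightarrow> real" where
  "koszul_rhs G x u v z =
     (pd (\<lambda>y. G y v z) x u + pd (\<lambda>y. G y u z) x v - pd (\<lambda>y. G y u v) x z) / 2"

definition lc_symbol :: "('e::euclidean_space \<Rightarrow> 'e \<Rightarrow> 'e \<Rightarrow> real) \<Rightarrow> 'e \<Rightarrow> 'e \<Rightarrow> 'e \<Rightarrow> 'e" where
  "lc_symbol G x u v = (THE w. \<forall>z. G x w z = koszul_rhs G x u v z)"

context
  fixes G :: "'e::euclidean_space \<Rightarrow> 'e \<Rightarrow> 'e \<Rightarrow> real" and S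
  assumes G: "smooth_bil G S" and pos: "\<And>x. x \<in> S \<Longrightarrow> posdef (G x)"
begin

lemma linear_koszul_rhs:
  assumes x: "x \<in> S"
  shows "linear (koszul_rhs G x u v)"
    and "linear (\<lambda>u. koszul_rhs G x u v z)"
    and "linear (\<lambda>v. koszul_rhs G x u v z)"
proof -
  have b: "bilinear (\<lambda>v z. pd (\<lambda>y. G y v z) x u)" for u
    by (rule bilinear_pd_smooth_bil[OF G x])
  have l: "linear (pd (\<lambda>y. G y u v) x)" for u v
    by (rule linear_pd[OF smooth_bil_differentiable[OF G x]])
  note r = bilinear_ladd[OF b] bilinear_radd[OF b] bilinear_lmul[OF b] bilinear_rmul[OF b]
    linear_add[OF l] linear_scale[OF l]
  show "linear (koszul_rhs G x u v)" "linear (\<lambda>u. koszul_rhs G x u v z)"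
    "linear (\<lambda>v. koszul_rhs G x u v z)"
    by (auto intro!: linearI simp: koszul_rhs_def r field_simps)
qed

lemma lc_symbol:
  assumes x: "x \<in> S"
  shows "G x (lc_symbol G x u v) z = koszul_rhs G x u v z"
  using theI'[OF posdef_solve[OF pos[OF x] linear_koszul_rhs(1)[OF x, of u v]]]
  unfolding lc_symbol_def by blast

lemma lc_symbol_symmetric:
  assumes x: "x \<in> S"
  shows "lc_symbol G x u v = lc_symbol G x v u"
proof (rule posdef_eqI[OF pos[OF x]])
  have S: "open S" using G by (simp add: smooth_bil_def)
  have "pd (\<lambda>y. G y u v) x z = pd (\<lambda>y. G y v u) x z" for z
    by (rule pd_cong_open[OF S x]) (auto intro: posdefD(2)[OF pos] smooth_bil_differentiable[OF G x])
  then show "G x (lc_symbol G x u v) z = G x (lc_symbol G x v u) z" for z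
    unfolding lc_symbol[OF x] koszul_rhs_def by simp
qed

text \<open>In the Koszul expressions for \<open>(u, v, w)\<close> and \<open>(u, w, v)\<close> the
  derivatives along \<open>v\<close> and \<open>w\<close> have opposite signs, so their sum is the
  derivative along \<open>u\<close>.\<close>

lemma lc_symbol_metric:
  assumes x: "x \<in> S"
  shows "pd (\<lambda>y. G y v w) x u = G x (lc_symbol G x u v) w + G x v (lc_symbol G x u w)"
proof -
  have S: "open S" using G by (simp add: smooth_bil_def)
  have sym: "pd (\<lambda>y. G y u v) x z = pd (\<lambda>y. G y v u) x z" for u v z
    by (rule pd_cong_open[OF S x]) (auto intro: posdefD(2)[OF pos] smooth_bil_differentiable[OF G x])
  have "G x v (lc_symbol G x u w) = koszul_rhs G x u w v"
    using lc_symbol[OF x] posdefD(2)[OF pos[OF x]] by metis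
  then show ?thesis
    unfolding lc_symbol[OF x] by (simp add: koszul_rhs_def sym[of w v] field_simps)
qed

lemma smooth_bil_lc_symbol: "smooth_bil (lc_symbol G) S"
  unfolding smooth_bil_def
proof (intro conjI ballI allI)
  show S: "open S" using G by (simp add: smooth_bil_def)
  show "bilinear (lc_symbol G x)" if x: "x \<in> S" for x
    unfolding bilinear_def
  proof (intro conjI allI linearI)
    note bl = posdefD(1)[OF pos[OF x]]
    note e = posdef_eqI[OF pos[OF x]]
    note r = lc_symbol[OF x] bilinear_ladd[OF bl] bilinear_lmul[OF bl]
      linear_add[OF linear_koszul_rhs(2)[OF x]] linear_scale[OF linear_koszul_rhs(2)[OF x]]
      linear_add[OF linear_koszul_rhs(3)[OF x]] linear_scale[OF linear_koszul_rhs(3)[OF x]]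
    show "lc_symbol G x u (v + w) = lc_symbol G x u v + lc_symbol G x u w" for u v w
      by (rule e) (simp add: r)
    show "lc_symbol G x u (k *\<^sub>R v) = k *\<^sub>R lc_symbol G x u v" for u v k
      by (rule e) (simp add: r)
    show "lc_symbol G x (u + v) w = lc_symbol G x u w + lc_symbol G x v w" for u v w
      by (rule e) (simp add: r)
    show "lc_symbol G x (k *\<^sub>R u) v = k *\<^sub>R lc_symbol G x u v" for u v k
      by (rule e) (simp add: r)
  qed
  fix u v
  \<comment> \<open>The \<open>THE\<close> in \<open>lc_symbol\<close> hides its smoothness; in a
    smooth orthonormal frame the Riesz formula makes it an explicit sum of smooth terms.\<close>
  obtain F :: "'e \<Rightarrow> 'e \<Rightarrow> 'e" where F: "\<And>b. b \<in> Basis \<Longrightarrow> smooth_on (F b) S"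
    "\<And>x. x \<in> S \<Longrightarrow> is_onb (G x) ((\<lambda>b. F b x) ` Basis)"
    "\<And>x. x \<in> S \<Longrightarrow> inj_on (\<lambda>b. F b x) Basis"
    using smooth_orthonormal_frame[of G S] G pos by blast
  show "smooth_on (\<lambda>x. lc_symbol G x u v) S"
  proof (rule smooth_on_cong[OF _ S])
    fix x assume x: "x \<in> S"
    have "(\<Sum>b\<in>(\<lambda>b. F b x) ` Basis. koszul_rhs G x u v b *\<^sub>R b) = lc_symbol G x u v"
      by (rule posdef_eqI[OF pos[OF x]])
         (simp add: lc_symbol[OF x] riesz_onb[OF pos[OF x] F(2)[OF x] linear_koszul_rhs(1)[OF x]])
    then show "(\<Sum>b\<in>Basis. koszul_rhs G x u v (F b x) *\<^sub>R F b x) = lc_symbol G x u v"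
      using sum.reindex[OF F(3)[OF x], of "\<lambda>b. koszul_rhs G x u v b *\<^sub>R b"] by simp
  next
    have k: "smooth_on (\<lambda>x. koszul_rhs G x u v (F b x)) S" if b: "b \<in> Basis" for b
    proof (rule smooth_on_linear_family[OF S linear_koszul_rhs(1) _ F(1)[OF b]])
      have s: "smooth_on (\<lambda>x. G x u v) S" for u v using G by (simp add: smooth_bil_def)
      have "smooth_on (\<lambda>x. (1/2) *\<^sub>R (pd (\<lambda>y. G y v z) x u + pd (\<lambda>y. G y u z) x v - pd (\<lambda>y. G y u v) x z)) S" for z
        by (intro smooth_on_scaleR smooth_on_const S smooth_on_diff smooth_on_add smooth_on_frechet_derivative s)
      then show "smooth_on (\<lambda>x. koszul_rhs G x u v z) S" for z
        by (simp add: koszul_rhs_def)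
    qed auto
    show "smooth_on (\<lambda>x. \<Sum>b\<in>Basis. koszul_rhs G x u v (F b x) *\<^sub>R F b x) S"
      by (intro smooth_on_sum smooth_on_scaleR k F(1) S)
  qed
qed

end

section \<open>Gluing the local symbols to a connection\<close>

context atlas
begin

definition lc_formula :: "('a \<Rightarrow> 'e \<Rightarrow> 'e \<Rightarrow> real) \<Rightarrow> ('a, 'e) chart \<Rightarrow> ('a \<Rightarrow> 'e) \<Rightarrow> ('a \<Rightarrow> 'e) \<Rightarrow> 'e \<Rightarrow> 'e" where
  "lc_formula g c X Y x = pd (field_rep A c Y) x (field_rep A c X x) +
     lc_symbol (metric_rep A g c) x (field_rep A c X x) (field_rep A c Y x)"

text \<open>Each value is computed in the preferred chart of its point. The algebraic laws can be
  checked there, whereas smoothness requires that the formula agree with its version in every fixed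
  chart.\<close>

definition lc_connection :: "('a \<Rightarrow> 'e \<Rightarrow> 'e \<Rightarrow> real) \<Rightarrow> ('a \<Rightarrow> 'e) \<Rightarrow> ('a \<Rightarrow> 'e) \<Rightarrow> 'a \<Rightarrow> 'e" where
  "lc_connection g X Y p = lc_formula g (chart_at A p) X Y (snd (chart_at A p) p)"

text \<open>The left side does not mention the chart. Hence the vector with coordinates
  \<open>lc_formula g c X Y\<close>, being determined by its pairings, is the same for all
  \<open>c\<close>.\<close>

lemma koszul_in_chart:
  assumes g: "riemannian_metric A g" and W: "open_subset A W" "p \<in> W" and c: "c \<in> A" "p \<in> fst c"
    and X: "vector_field A W X" and Y: "vector_field A W Y" and Z: "vector_field A W Z"
  shows "dir_deriv A X (\<lambda>q. g q (Y q) (Z q)) p + dir_deriv A Y (\<lambda>q. g q (X q) (Z q)) p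
      - dir_deriv A Z (\<lambda>q. g q (X q) (Y q)) p + g p (lie_bracket A X Y p) (Z p)
      - g p (lie_bracket A X Z p) (Y p) - g p (lie_bracket A Y Z p) (X p) =
    2 * g p (chart_vec A c p (lc_formula g c X Y (snd c p))) (Z p)"
proof -
  define x where "x = snd c p"
  define G where "G = metric_rep A g c"
  have x: "x \<in> snd c ` fst c" using c by (simp add: x_def)
  note GS = smooth_bil_metric_rep[OF g c(1), folded G_def]
  note Gp = posdef_metric_rep[OF g c(1), folded G_def]
  note bl = posdefD(1)[OF Gp[OF x]]
  note sym = posdefD(2)[OF Gp[OF x]]
  note D = dir_deriv_metric_in_chart[OF g W(2) c, folded x_def G_def]
  note L = lie_bracket_in_chart[OF W _ _ c, folded x_def]
  have gG: "g p v w = G x (vec_coord A c p v) (vec_coord A c p w)" for v w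
    using metric_rep_at(2)[OF c] by (simp add: G_def x_def)
  have f: "vec_coord A c p (U p) = field_rep A c U x" for U
    using c by (simp add: x_def field_rep_at)
  show ?thesis
    unfolding D[OF Y Z] D[OF X Z] D[OF X Y] gG L[OF X Y] L[OF X Z] L[OF Y Z] f[of X] f[of Y] f[of Z]
    using lc_symbol[OF GS Gp x, of "field_rep A c X x" "field_rep A c Y x" "field_rep A c Z x"] c
    by (simp add: x_def[symmetric] lc_formula_def G_def[symmetric] koszul_rhs_def bilinear_ladd[OF bl] bilinear_lsub[OF bl] bilinear_rsub[OF bl]
        sym[of _ "field_rep A c X x"] sym[of "field_rep A c Y x" "pd (field_rep A c Z) x _"] field_simps)
qed

lemma lc_connection_in_chart:
  assumes g: "riemannian_metric A g" and W: "open_subset A W" "p \<in> W" and c: "c \<in> A" "p \<in> fst c"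
    and X: "vector_field A W X" and Y: "vector_field A W Y"
  shows "vec_coord A c p (lc_connection g X Y p) = lc_formula g c X Y (snd c p)"
proof -
  let ?d = "chart_at A p"
  have d: "?d \<in> A" "p \<in> fst ?d" using chart_at_props[OF in_points[OF c]] .
  define W' where "W' = W \<inter> fst c"
  have W': "open_subset A W'" "p \<in> W'"
    using open_subset_Int[OF W(1) open_subset_fst[OF c(1)]] W c by (auto simp: W'_def)
  have X': "vector_field A W' X" and Y': "vector_field A W' Y"
    using X Y vector_field_subset by (auto simp: W'_def)
  have Z: "vector_field A W' (\<lambda>q. chart_vec A c q z)" for z
    by (rule vector_field_subset[OF vector_field_chart_vec_const[OF c(1)]]) (auto simp: W'_def)
  have dv: "chart_vec A ?d p v = v" for v
    using chart_vec_vec_coord[OF d, of v] vec_coord_chart_at[OF in_points[OF c]] by simp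
  have "lc_connection g X Y p = chart_vec A c p (lc_formula g c X Y (snd c p))"
  proof (rule posdef_eqI[OF riemannian_posdef[OF g in_points[OF c]]])
    fix v
    let ?Z = "\<lambda>q. chart_vec A c q (vec_coord A c p v)"
    show "g p (lc_connection g X Y p) v = g p (chart_vec A c p (lc_formula g c X Y (snd c p))) v"
      using koszul_in_chart[OF g W' c X' Y' Z, of "vec_coord A c p v"]
        koszul_in_chart[OF g W' d X' Y' Z, of "vec_coord A c p v"] c
      by (simp add: lc_connection_def dv)
  qed
  then show ?thesis using c by simp
qed

lemma field_rep_add:
  "c \<in> A \<Longrightarrow> x \<in> snd c ` fst c \<Longrightarrow> field_rep A c (\<lambda>q. X q + Y q) x = field_rep A c X x + field_rep A c Y x"
  by (auto simp: field_rep_at linear_add[OF linear_vec_coord])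

lemma field_rep_scaleR:
  "c \<in> A \<Longrightarrow> x \<in> snd c ` fst c \<Longrightarrow>
    field_rep A c (\<lambda>q. f q *\<^sub>R Y q) x = (f \<circ> chart_inv c) x *\<^sub>R field_rep A c Y x"
  by (auto simp: field_rep_at linear_scale[OF linear_vec_coord])

lemma lc_formula_smooth:
  assumes g: "riemannian_metric A g" and W: "open_subset A W" and c: "c \<in> A"
    and X: "vector_field A W X" and Y: "vector_field A W Y"
  shows "smooth_on (lc_formula g c X Y) (snd c ` (W \<inter> fst c))"
proof -
  let ?S = "snd c ` (W \<inter> fst c)"
  have S: "open ?S" by (rule open_subset_image[OF W c])
  note sX = vector_field_smooth_rep[OF X c] and sY = vector_field_smooth_rep[OF Y c]
  have L: "smooth_bil (lc_symbol (metric_rep A g c)) (snd c ` fst c)"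
    by (rule smooth_bil_lc_symbol[OF smooth_bil_metric_rep[OF g c] posdef_metric_rep[OF g c]])
  have L': "smooth_bil (lc_symbol (metric_rep A g c)) ?S"
    by (rule smooth_bil_subset[OF L S]) auto
  have "smooth_on (\<lambda>x. pd (field_rep A c Y) x (field_rep A c X x)) ?S"
    by (rule smooth_on_linear_family[OF S linear_pd[OF smooth_on_differentiable[OF sY]]
          smooth_on_frechet_derivative[OF sY] sX])
  from smooth_on_add[OF this smooth_bil_apply[OF L' sX sY] S]
  show ?thesis by (simp add: lc_formula_def[abs_def])
qed

lemma connection_lc_connection:
  assumes g: "riemannian_metric A g"
  shows "connection A (lc_connection g)"
  unfolding connection_def
proof (intro allI impI conjI ballI; elim conjE)
  fix W X Y Z and f :: "'a \<Rightarrow> real"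
  assume W: "open_subset A W" and X: "vector_field A W X" and Y: "vector_field A W Y"
    and Z: "vector_field A W Z" and f: "smooth_fun A W f"
  show "vector_field A W (lc_connection g X Y)"
    unfolding vector_field_iff
  proof
    fix c assume c: "c \<in> A"
    show "smooth_on (field_rep A c (lc_connection g X Y)) (snd c ` (W \<inter> fst c))"
      by (rule smooth_on_cong[OF lc_formula_smooth[OF g W c X Y] open_subset_image[OF W c]])
         (use c lc_connection_in_chart[OF g W _ c _ X Y] in \<open>auto simp: field_rep_at\<close>)
  qed
  fix p assume p: "p \<in> W"
  let ?c = "chart_at A p"
  have pP: "p \<in> points A" using p W by (auto simp: open_subset_def)
  have c: "?c \<in> A" "p \<in> fst ?c" using chart_at_props[OF pP] .
  let ?x = "snd ?c p"
  let ?L = "lc_symbol (metric_rep A g ?c) ?x"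
  have x: "?x \<in> snd ?c ` fst ?c" using c by simp
  note op = chart_image_open[OF c(1)]
  have bl: "bilinear ?L"
    by (rule smooth_bil_bilinear[OF smooth_bil_lc_symbol[OF smooth_bil_metric_rep[OF g c(1)]
            posdef_metric_rep[OF g c(1)]] x])
  have d: "field_rep A ?c U differentiable (at ?x)" if "vector_field A W U" for U
    by (rule field_rep_differentiable[OF that c(1) p c(2)])
  have df: "(f \<circ> chart_inv ?c) differentiable (at ?x)"
    using f c p unfolding smooth_fun_def by (auto intro: smooth_on_differentiable)
  have pdadd: "pd (field_rep A ?c (\<lambda>q. Y q + Z q)) ?x v =
      pd (field_rep A ?c Y) ?x v + pd (field_rep A ?c Z) ?x v" for v
    by (rule trans[OF pd_cong_open[OF op x field_rep_add[OF c(1)]]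
          pd_eq[OF has_derivative_add[OF d[OF Y, unfolded frechet_derivative_works] d[OF Z, unfolded frechet_derivative_works]]]])
       (auto intro!: differentiable_add d Y Z)
  have pdsc: "pd (field_rep A ?c (\<lambda>q. f q *\<^sub>R Y q)) ?x v =
      (f \<circ> chart_inv ?c) ?x *\<^sub>R pd (field_rep A ?c Y) ?x v +
      pd (f \<circ> chart_inv ?c) ?x v *\<^sub>R field_rep A ?c Y ?x" for v
    by (rule trans[OF pd_cong_open[OF op x field_rep_scaleR[OF c(1)]]
          pd_eq[OF has_derivative_scaleR[OF df[unfolded frechet_derivative_works] d[OF Y, unfolded frechet_derivative_works]]]])
       (assumption, intro differentiable_scaleR d df Y)
  have lin: "linear (pd (field_rep A ?c Y) ?x)" by (rule linear_pd[OF d[OF Y]])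
  show "lc_connection g (\<lambda>q. X q + Z q) Y p = lc_connection g X Y p + lc_connection g Z Y p"
    unfolding lc_connection_def lc_formula_def field_rep_add[OF c(1) x]
    by (simp add: linear_add[OF lin] bilinear_ladd[OF bl])
  show "lc_connection g (\<lambda>q. f q *\<^sub>R X q) Y p = f p *\<^sub>R lc_connection g X Y p"
    unfolding lc_connection_def lc_formula_def field_rep_scaleR[OF c(1) x]
    using c by (simp add: linear_scale[OF lin] bilinear_lmul[OF bl] scaleR_add_right)
  show "lc_connection g X (\<lambda>q. Y q + Z q) p = lc_connection g X Y p + lc_connection g X Z p"
    unfolding lc_connection_def lc_formula_def field_rep_add[OF c(1) x] pdadd
    by (simp add: bilinear_radd[OF bl])
  show "lc_connection g X (\<lambda>q. f q *\<^sub>R Y q) p = dir_deriv A X f p *\<^sub>R Y p + f p *\<^sub>R lc_connection g X Y p"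
    unfolding lc_connection_def lc_formula_def field_rep_scaleR[OF c(1) x] pdsc
      dir_deriv_in_chart[OF c df]
    using c vec_coord_chart_at[OF pP, of "Y p"]
    by (simp add: bilinear_rmul[OF bl] scaleR_add_right field_rep_at)
qed

lemma torsion_free_lc_connection:
  assumes g: "riemannian_metric A g"
  shows "torsion_free A (lc_connection g)"
  unfolding torsion_free_def
proof (intro allI impI ballI; elim conjE)
  fix W X Y p
  assume W: "open_subset A W" and X: "vector_field A W X" and Y: "vector_field A W Y" and p: "p \<in> W"
  let ?c = "chart_at A p"
  have pP: "p \<in> points A" using p W by (auto simp: open_subset_def)
  have c: "?c \<in> A" "p \<in> fst ?c" using chart_at_props[OF pP] .
  have x: "snd ?c p \<in> snd ?c ` fst ?c" using c by simp
  show "lc_connection g X Y p - lc_connection g Y X p = lie_bracket A X Y p"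
    using lie_bracket_in_chart[OF W p X Y c] vec_coord_chart_at[OF pP]
      lc_symbol_symmetric[OF smooth_bil_metric_rep[OF g c(1)] posdef_metric_rep[OF g c(1)] x]
    by (simp add: lc_connection_def lc_formula_def)
qed

lemma metric_connection_lc_connection:
  assumes g: "riemannian_metric A g"
  shows "metric_connection A g (lc_connection g)"
  unfolding metric_connection_def
proof (intro allI impI ballI; elim conjE)
  fix W X Y Z p
  assume W: "open_subset A W" and X: "vector_field A W X" and Y: "vector_field A W Y"
    and Z: "vector_field A W Z" and p: "p \<in> W"
  let ?c = "chart_at A p"
  have pP: "p \<in> points A" using p W by (auto simp: open_subset_def)
  have c: "?c \<in> A" "p \<in> fst ?c" using chart_at_props[OF pP] .
  have x: "snd ?c p \<in> snd ?c ` fst ?c" using c by simp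
  have bl: "bilinear (metric_rep A g ?c (snd ?c p))"
    using posdefD(1)[OF posdef_metric_rep[OF g c(1) x]] .
  show "dir_deriv A X (\<lambda>q. g q (Y q) (Z q)) p =
      g p (lc_connection g X Y p) (Z p) + g p (Y p) (lc_connection g X Z p)"
    unfolding dir_deriv_metric_in_chart[OF g p c Y Z] metric_rep_at(2)[OF c] lc_connection_def lc_formula_def
      lc_symbol_metric[OF smooth_bil_metric_rep[OF g c(1)] posdef_metric_rep[OF g c(1)] x]
      vec_coord_chart_at[OF pP]
    using c vec_coord_chart_at[OF pP]
      lc_symbol_metric[OF smooth_bil_metric_rep[OF g c(1)] posdef_metric_rep[OF g c(1)] x]
    by (simp add: bilinear_ladd[OF bl] bilinear_radd[OF bl] field_rep_at)
qed

text \<open>\<open>levi_civita\<close> is a \<open>SOME\<close>, so its properties become available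
  only through the existence just established.\<close>

lemma levi_civita_props:
  assumes g: "riemannian_metric A g"
  shows "connection A (levi_civita A g)" "torsion_free A (levi_civita A g)"
    "metric_connection A g (levi_civita A g)"
proof -
  have "\<exists>nabla. connection A nabla \<and> torsion_free A nabla \<and> metric_connection A g nabla"
    using connection_lc_connection[OF g] torsion_free_lc_connection[OF g]
      metric_connection_lc_connection[OF g] by blast
  from someI_ex[OF this]
  show "connection A (levi_civita A g)" "torsion_free A (levi_civita A g)"
    "metric_connection A g (levi_civita A g)"
    unfolding levi_civita_def by auto
qed

end

section \<open>The tangent bundle in local coordinates\<close>

definition tchart :: "('a, 'e::euclidean_space) chart set \<Rightarrow> ('a, 'e) chart \<Rightarrow> ('a \<times> 'e, 'e \<times> 'e) chart" where
  "tchart A c = (fst c \<times> UNIV, \<lambda>(p, v). (snd c p, vec_coord A c p v))"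

lemma tangent_atlas_eq: "tangent_atlas A = tchart A ` A"
  by (simp add: tangent_atlas_def tchart_def)

lemma fst_tchart [simp]: "fst (tchart A c) = fst c \<times> UNIV"
  by (simp add: tchart_def)

lemma snd_tchart [simp]: "snd (tchart A c) (p, v) = (snd c p, vec_coord A c p v)"
  by (simp add: tchart_def)

lemma smooth_on_prod_fst:
  fixes f :: "'a::euclidean_space \<Rightarrow> 'c::real_normed_vector"
  assumes "smooth_on f S" "open S"
  shows "smooth_on (\<lambda>z::'a \<times> 'b::euclidean_space. f (fst z)) (S \<times> UNIV)"
  by (rule smooth_on_compose[OF assms(1) smooth_on_fst[OF smooth_on_id]])
     (use assms(2) in \<open>auto intro: open_Times\<close>)

lemma smooth_bil_prod_fst:
  fixes B :: "'a::euclidean_space \<Rightarrow> 'b::euclidean_space \<Rightarrow> 'c::euclidean_space \<Rightarrow> 'd::real_normed_vector"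
  assumes "smooth_bil B S"
  shows "smooth_bil (\<lambda>z::'a \<times> 'f::euclidean_space. B (fst z)) (S \<times> UNIV)"
  unfolding smooth_bil_def
proof (intro conjI ballI allI)
  have S: "open S" using assms by (simp add: smooth_bil_def)
  then show "open (S \<times> (UNIV :: 'f set))" by (simp add: open_Times)
  show "bilinear (B (fst z))" if "z \<in> S \<times> (UNIV :: 'f set)" for z
    using that assms by (auto simp: smooth_bil_def)
  show "smooth_on (\<lambda>z::'a \<times> 'f. B (fst z) u v) (S \<times> UNIV)" for u v
    using smooth_on_prod_fst[of "\<lambda>x. B x u v" S] assms S by (simp add: smooth_bil_def)
qed

context atlas
begin

lemma points_tangent_atlas: "points (tangent_atlas A) = points A \<times> UNIV"
  by (auto simp: points_def tangent_atlas_eq)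

lemma tchart_image:
  assumes c: "c \<in> A" and W: "W \<subseteq> fst c"
  shows "snd (tchart A c) ` (W \<times> UNIV) = (snd c ` W) \<times> UNIV"
proof
  show "(snd c ` W) \<times> UNIV \<subseteq> snd (tchart A c) ` (W \<times> UNIV)"
  proof
    fix z :: "'e \<times> 'e" assume "z \<in> (snd c ` W) \<times> UNIV"
    then obtain q u where q: "q \<in> W" "z = (snd c q, u)" by (cases z) auto
    then have "z = snd (tchart A c) (q, chart_vec A c q u)" using c W by auto
    then show "z \<in> snd (tchart A c) ` (W \<times> UNIV)" using q by blast
  qed
qed auto

lemma tchart_inj:
  assumes c: "c \<in> A"
  shows "inj_on (snd (tchart A c)) (fst (tchart A c))"
proof (rule inj_onI)
  fix P Q assume PQ: "P \<in> fst (tchart A c)" "Q \<in> fst (tchart A c)" "snd (tchart A c) P = snd (tchart A c) Q"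
  obtain p u q v where P: "P = (p, u)" "Q = (q, v)" by (cases P, cases Q)
  have p: "p \<in> fst c" "q \<in> fst c" using PQ P by auto
  have "p = q" using inj_onD[OF chart_inj[OF c] _ p] PQ P by simp
  moreover have "u = v"
    using PQ P \<open>p = q\<close> chart_vec_vec_coord[OF c p(1)] by (metis Pair_inject snd_tchart)
  ultimately show "P = Q" using P by simp
qed

lemma tchart_inv:
  assumes c: "c \<in> A" and x: "x \<in> snd c ` fst c"
  shows "chart_inv (tchart A c) (x, u) = (chart_inv c x, chart_vec A c (chart_inv c x) u)"
proof -
  obtain p where p: "p \<in> fst c" "x = snd c p" using x by auto
  have "snd (tchart A c) (p, chart_vec A c p u) = (x, u)" using c p by simp
  then have "chart_inv (tchart A c) (x, u) = (p, chart_vec A c p u)"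
    unfolding chart_inv_def using p
    by (intro the_inv_into_f_eq[OF tchart_inj[OF c]]) auto
  then show ?thesis using c p by simp
qed

lemma tchart_transition:
  assumes c: "c \<in> A" and d: "d \<in> A" and x: "x \<in> snd c ` (fst c \<inter> fst d)"
  shows "(snd (tchart A d) \<circ> chart_inv (tchart A c)) (x, u) =
    ((snd d \<circ> chart_inv c) x, pd (snd d \<circ> chart_inv c) x u)"
proof -
  obtain p where p: "p \<in> fst c" "p \<in> fst d" "x = snd c p" using x by auto
  then show ?thesis
    using c d tchart_inv[OF c, of x u] vec_coord_change[OF c p(1) d p(2)] by auto
qed

text \<open>The transition maps are a transition map of \<open>M\<close> together with its
  derivative applied to the fibre coordinate; the latter is a smooth family of linear maps evaluated
  at \<open>u\<close>.\<close>

lemma smooth_atlas_tangent_atlas: "smooth_atlas (tangent_atlas A)"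
  unfolding smooth_atlas_def tangent_atlas_eq
proof (intro conjI ballI; elim imageE)
  fix c' c assume "c' = tchart A c" and c: "c \<in> A"
  then show "inj_on (snd c') (fst c')" using tchart_inj by simp
  show "open (snd c' ` fst c')"
    using tchart_image[OF c subset_refl] chart_image_open[OF c] \<open>c' = _\<close> by (auto intro: open_Times)
next
  fix c' c d' d assume c': "c' = tchart A c" and c: "c \<in> A" and d': "d' = tchart A d" and d: "d \<in> A"
  let ?S = "snd c ` (fst c \<inter> fst d)"
  let ?t = "snd d \<circ> chart_inv c"
  have int: "fst c' \<inter> fst d' = (fst c \<inter> fst d) \<times> UNIV" using c' d' by auto
  have im: "snd c' ` (fst c' \<inter> fst d') = ?S \<times> UNIV"
    unfolding int unfolding c' by (rule tchart_image[OF c]) auto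
  have S: "open ?S" by (rule transition_open[OF c d])
  then have S': "open (?S \<times> (UNIV :: 'e set))" by (auto intro: open_Times)
  show "open (snd c' ` (fst c' \<inter> fst d'))" unfolding im by (rule S')
  have t: "smooth_on ?t ?S" by (rule transition_smooth[OF c d])
  have 1: "smooth_on (\<lambda>z::'e \<times> 'e. ?t (fst z)) (?S \<times> UNIV)"
    by (rule smooth_on_prod_fst[OF t S])
  have 2: "smooth_on (\<lambda>z::'e \<times> 'e. pd ?t (fst z) (snd z)) (?S \<times> UNIV)"
  proof (rule smooth_on_linear_family[OF S', where L = "\<lambda>z. pd ?t (fst z)" and h = snd])
    show "linear (pd ?t (fst z))" if "z \<in> ?S \<times> (UNIV :: 'e set)" for z
      using that by (intro linear_pd smooth_on_differentiable[OF t]) auto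
    show "smooth_on (\<lambda>z::'e \<times> 'e. pd ?t (fst z) u) (?S \<times> UNIV)" for u
      by (rule smooth_on_prod_fst[OF smooth_on_frechet_derivative[OF t] S])
    show "smooth_on snd (?S \<times> (UNIV :: 'e set))"
      using smooth_on_snd[OF smooth_on_id[OF S'] S'] by simp
  qed
  show "smooth_on (snd d' \<circ> chart_inv c') (snd c' ` (fst c' \<inter> fst d'))"
    unfolding im
    by (rule smooth_on_cong[OF smooth_on_Pair[OF 1 2 S'] S'])
       (use tchart_transition[OF c d] c' d' in auto)
qed

lemma atlas_tangent_atlas: "atlas (tangent_atlas A)"
  by unfold_locales (rule smooth_atlas_tangent_atlas)

lemma tchart_in: "c \<in> A \<Longrightarrow> tchart A c \<in> tangent_atlas A"
  by (simp add: tangent_atlas_eq)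

section \<open>Vertical and horizontal lifts in induced charts\<close>

interpretation T: atlas "tangent_atlas A"
  by (rule atlas_tangent_atlas)

lemma chart_at_tangent:
  assumes "p \<in> points A"
  obtains d where "d \<in> A" "p \<in> fst d" "chart_at (tangent_atlas A) (p, u) = tchart A d"
proof -
  have "(p, u) \<in> points (tangent_atlas A)" using assms points_tangent_atlas by simp
  from T.chart_at_props[OF this] show ?thesis
    using that unfolding tangent_atlas_eq by auto
qed

text \<open>Induced charts are linear on fibres, so the defining curve is a straight line there; the
  transition map carries its velocity to the preferred chart.\<close>

lemma vertical_lift_in_chart:
  assumes c: "c \<in> A" "p \<in> fst c"
  shows "vertical_lift A (p, u) w = chart_vec (tangent_atlas A) (tchart A c) (p, u) (0, vec_coord A c p w)"
proof -
  obtain d where d: "d \<in> A" "p \<in> fst d" "chart_at (tangent_atlas A) (p, u) = tchart A d"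
    using chart_at_tangent[OF in_points[OF c]] .
  let ?t = "snd (tchart A d) \<circ> chart_inv (tchart A c)"
  let ?z = "(snd c p, vec_coord A c p u)"
  note lin = linear_vec_coord[OF c]
  have "?t differentiable (at ?z)"
    using T.transition_differentiable[OF tchart_in[OF c(1)] tchart_in[OF d(1)], of "(p, u)"] c d by simp
  then have "(?t has_derivative pd ?t ?z) (at (?z + 0 *\<^sub>R (0, vec_coord A c p w)))"
    by (simp add: frechet_derivative_works)
  from has_derivative_along_line[OF this]
  have "((\<lambda>r. ?t (?z + r *\<^sub>R (0, vec_coord A c p w))) has_vector_derivative pd ?t ?z (0, vec_coord A c p w)) (at 0)" .
  moreover have "(\<lambda>r. ?t (?z + r *\<^sub>R (0, vec_coord A c p w))) = (\<lambda>r. snd (tchart A d) (p, u + r *\<^sub>R w))"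
  proof
    fix r :: real
    have "?z + r *\<^sub>R (0, vec_coord A c p w) = snd (tchart A c) (p, u + r *\<^sub>R w)"
      by (simp add: linear_add[OF lin] linear_scale[OF lin])
    then show "?t (?z + r *\<^sub>R (0, vec_coord A c p w)) = snd (tchart A d) (p, u + r *\<^sub>R w)"
      using T.chart_inv_chart[OF tchart_in[OF c(1)], of "(p, u + r *\<^sub>R w)"] c by simp
  qed
  ultimately have "vector_derivative (\<lambda>r. snd (tchart A d) (p, u + r *\<^sub>R w)) (at 0) = pd ?t ?z (0, vec_coord A c p w)"
    using vector_derivative_at by metis
  then show ?thesis
    by (simp add: vertical_lift_def chart_vec_def d(3))
qed

lemma tangent_map_section_in_chart:
  assumes c: "c \<in> A" "p \<in> fst c" and W: "p \<in> W" and Y: "vector_field A W Y"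
  shows "tangent_map A (tangent_atlas A) (\<lambda>q. (q, Y q)) p v =
    chart_vec (tangent_atlas A) (tchart A c) (p, Y p)
      (vec_coord A c p v, pd (field_rep A c Y) (snd c p) (vec_coord A c p v))"
proof -
  obtain d where d: "d \<in> A" "p \<in> fst d" "chart_at (tangent_atlas A) (p, Y p) = tchart A d"
    using chart_at_tangent[OF in_points[OF c]] .
  let ?t = "snd (tchart A d) \<circ> chart_inv (tchart A c)"
  let ?x = "snd c p"
  let ?f = "snd (tchart A d) \<circ> (\<lambda>q. (q, Y q))"
  let ?h = "\<lambda>y. (y, field_rep A c Y y)"
  have hx: "?h ?x = snd (tchart A c) (p, Y p)" using c by (simp add: field_rep_at)
  have "?t differentiable (at (?h ?x))"
    unfolding hx
    using T.transition_differentiable[OF tchart_in[OF c(1)] tchart_in[OF d(1)], of "(p, Y p)"] c d by simp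
  then have t: "(?t has_derivative pd ?t (?h ?x)) (at (?h ?x))" by (simp add: frechet_derivative_works)
  have h: "(?h has_derivative (\<lambda>v. (v, pd (field_rep A c Y) ?x v))) (at ?x)"
    by (rule has_derivative_Pair[OF has_derivative_ident
          field_rep_differentiable[OF Y c(1) W c(2), unfolded frechet_derivative_works]])
  have f: "((?f \<circ> chart_inv c) has_derivative (\<lambda>v. pd ?t (?h ?x) (v, pd (field_rep A c Y) ?x v))) (at ?x)"
  proof (rule has_derivative_transform_within_open[OF has_derivative_compose[OF h t] chart_image_open[OF c(1)]])
    fix y assume "y \<in> snd c ` fst c"
    then obtain q where q: "q \<in> fst c" "y = snd c q" by auto
    then have "?h y = snd (tchart A c) (q, Y q)" using c by (simp add: field_rep_at)
    then show "?t (?h y) = (?f \<circ> chart_inv c) y"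
      using T.chart_inv_chart[OF tchart_in[OF c(1)], of "(q, Y q)"] c q by simp
  qed (use c in simp)
  have "tangent_map A (tangent_atlas A) (\<lambda>q. (q, Y q)) p v = mderiv A ?f p v"
    by (simp add: tangent_map_def d(3))
  also have "\<dots> = pd (?f \<circ> chart_inv c) ?x (vec_coord A c p v)"
    by (rule mderiv_in_chart[OF c differentiableI[OF f]])
  also have "\<dots> = pd ?t (?h ?x) (vec_coord A c p v, pd (field_rep A c Y) ?x (vec_coord A c p v))"
    by (rule pd_eq[OF f])
  finally show ?thesis
    by (simp add: chart_vec_def d(3) hx)
qed

lemma tangent_map_fst_in_chart:
  assumes c: "c \<in> A" "p \<in> fst c"
  shows "tangent_map (tangent_atlas A) A fst (p, u) \<zeta> =
    chart_vec A c p (fst (vec_coord (tangent_atlas A) (tchart A c) (p, u) \<zeta>))"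
proof -
  let ?d = "chart_at A p"
  have d: "?d \<in> A" "p \<in> fst ?d" using chart_at_props[OF in_points[OF c]] .
  let ?t = "snd ?d \<circ> chart_inv c"
  let ?z = "snd (tchart A c) (p, u)"
  let ?f = "snd ?d \<circ> fst"
  have P: "(p, u) \<in> fst (tchart A c)" using c by simp
  have "(?t has_derivative pd ?t (snd c p)) (at (fst ?z))"
    using transition_differentiable[OF c(1) d(1) c(2) d(2)] by (simp add: frechet_derivative_works)
  from has_derivative_compose[OF has_derivative_fst[OF has_derivative_ident] this]
  have 1: "((\<lambda>z. ?t (fst z)) has_derivative (\<lambda>v. pd ?t (snd c p) (fst v))) (at ?z)" .
  have f: "((?f \<circ> chart_inv (tchart A c)) has_derivative (\<lambda>v. pd ?t (snd c p) (fst v))) (at ?z)"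
  proof (rule has_derivative_transform_within_open[OF 1])
    show "open (snd (tchart A c) ` fst (tchart A c))" by (rule T.chart_image_open[OF tchart_in[OF c(1)]])
    show "?z \<in> snd (tchart A c) ` fst (tchart A c)" using c by (intro imageI) simp
    fix z assume "z \<in> snd (tchart A c) ` fst (tchart A c)"
    then obtain Q where "Q \<in> fst (tchart A c)" "z = snd (tchart A c) Q" by auto
    then show "?t (fst z) = (?f \<circ> chart_inv (tchart A c)) z"
      using T.chart_inv_chart[OF tchart_in[OF c(1)], of Q] c by (cases Q) simp
  qed
  have "tangent_map (tangent_atlas A) A fst (p, u) \<zeta> = mderiv (tangent_atlas A) ?f (p, u) \<zeta>"
    by (simp add: tangent_map_def)
  also have "\<dots> = pd (?f \<circ> chart_inv (tchart A c)) ?z (vec_coord (tangent_atlas A) (tchart A c) (p, u) \<zeta>)"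
    by (rule T.mderiv_in_chart[OF tchart_in[OF c(1)] P differentiableI[OF f]])
  also have "\<dots> = pd ?t (snd c p) (fst (vec_coord (tangent_atlas A) (tchart A c) (p, u) \<zeta>))"
    by (rule pd_eq[OF f])
  finally show ?thesis by (simp add: chart_vec_def)
qed

text \<open>Vanishing of \<open>nabla X Y\<close> at \<open>p\<close> forces the derivative of the
  coordinates of \<open>Y\<close> along \<open>X\<close> to be minus the Christoffel term.
  Conversely, a section with that derivative is written down.\<close>

lemma horizontal_space_in_chart:
  assumes N: "connection A nabla" and c: "c \<in> A" "p \<in> fst c"
  defines "x \<equiv> snd c p"
  shows "horizontal_space A nabla (p, u) =
    range (\<lambda>a. chart_vec (tangent_atlas A) (tchart A c) (p, u) (a, - christoffel A nabla c x a (vec_coord A c p u)))"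
    (is "_ = range ?H")
proof
  show "horizontal_space A nabla (p, u) \<subseteq> range ?H"
  proof
    fix \<zeta> assume "\<zeta> \<in> horizontal_space A nabla (p, u)"
    then obtain X Y W where \<zeta>: "\<zeta> = tangent_map A (tangent_atlas A) (\<lambda>q. (q, Y q)) p (X p)"
      and W: "open_subset A W" "p \<in> W" and X: "vector_field A W X" and Y: "vector_field A W Y"
      and Yp: "Y p = u" and n: "nabla X Y p = 0"
      by (auto simp: horizontal_space_def)
    have "0 = pd (field_rep A c Y) x (field_rep A c X x) +
        christoffel A nabla c x (field_rep A c X x) (field_rep A c Y x)"
      using connection_in_chart[OF N W c X Y] n linear_0[OF linear_vec_coord[OF c]] by (simp add: x_def)
    then have "pd (field_rep A c Y) x (vec_coord A c p (X p)) =
        - christoffel A nabla c x (vec_coord A c p (X p)) (vec_coord A c p u)"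
      using c Yp by (simp add: x_def field_rep_at eq_neg_iff_add_eq_0)
    then show "\<zeta> \<in> range ?H"
      using tangent_map_section_in_chart[OF c W(2) Y, of "X p"] \<zeta> Yp by (auto simp: x_def)
  qed
  show "range ?H \<subseteq> horizontal_space A nabla (p, u)"
  proof
    fix \<zeta> assume "\<zeta> \<in> range ?H"
    then obtain a where \<zeta>: "\<zeta> = ?H a" by auto
    let ?u = "vec_coord A c p u"
    have xc: "x \<in> snd c ` fst c" using c by (simp add: x_def)
    have lin: "linear (\<lambda>a. christoffel A nabla c x a ?u)"
      by (rule smooth_bil_linear(2)[OF smooth_bil_christoffel[OF N c(1)] xc])
    \<comment> \<open>The affine map with value \<open>?u\<close> at \<open>x\<close> and the
      derivative there that makes the covariant derivative vanish; it provides the coordinates of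
      the section.\<close>
    define h where "h y = ?u - christoffel A nabla c x (y - x) ?u" for y
    have hsm: "smooth_on h (snd c ` fst c)"
      unfolding h_def
      by (intro smooth_on_diff[OF smooth_on_const] smooth_on_linear[OF _ _ lin] smooth_on_diff[OF smooth_on_id smooth_on_const]
          chart_image_open[OF c(1)])
    have hd: "(h has_derivative (\<lambda>v. - christoffel A nabla c x v ?u)) (at x)"
    proof -
      have "((\<lambda>y. y - x) has_derivative (\<lambda>v. v)) (at x)"
        by (auto intro!: derivative_eq_intros)
      from bounded_linear.has_derivative[OF lin[unfolded linear_conv_bounded_linear] this]
      have "((\<lambda>y. christoffel A nabla c x (y - x) ?u) has_derivative (\<lambda>v. christoffel A nabla c x v ?u)) (at x)" .
      from has_derivative_diff[OF has_derivative_const[of ?u] this] show ?thesis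
        unfolding h_def by simp
    qed
    define X where "X q = chart_vec A c q a" for q
    define Y where "Y q = chart_vec A c q (h (snd c q))" for q
    have X: "vector_field A (fst c) X" unfolding X_def by (rule vector_field_chart_vec_const[OF c(1)])
    have Y: "vector_field A (fst c) Y" unfolding Y_def by (rule vector_field_chart_vec[OF c(1) hsm])
    have Yp: "Y p = u" using c linear_0[OF lin] by (simp add: Y_def h_def x_def)
    have pdY: "pd (field_rep A c Y) x v = - christoffel A nabla c x v ?u" for v
    proof -
      have "pd (field_rep A c Y) x v = pd h x v"
        by (rule pd_cong_open[OF chart_image_open[OF c(1)] xc _ differentiableI[OF hd]])
           (use field_rep_chart_vec[OF c(1), of _ h] in \<open>simp add: Y_def[abs_def]\<close>)
      then show ?thesis using pd_eq[OF hd] by simp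
    qed
    have "vec_coord A c p (nabla X Y p) = 0"
      unfolding connection_in_chart[OF N open_subset_fst[OF c(1)] c(2) c X Y] x_def[symmetric] pdY
      using c Yp by (simp add: x_def field_rep_at X_def)
    then have "nabla X Y p = 0"
      using chart_vec_vec_coord[OF c, of "nabla X Y p"] linear_0[OF linear_chart_vec[OF c]] by simp
    moreover have "\<zeta> = tangent_map A (tangent_atlas A) (\<lambda>q. (q, Y q)) p (X p)"
      using tangent_map_section_in_chart[OF c c(2) Y, of "X p"] \<zeta> Yp c pdY by (simp add: x_def X_def)
    ultimately show "\<zeta> \<in> horizontal_space A nabla (p, u)"
      unfolding horizontal_space_def using open_subset_fst[OF c(1)] c X Y Yp by auto
  qed
qed

lemma horizontal_lift_in_chart:
  assumes N: "connection A nabla" and c: "c \<in> A" "p \<in> fst c"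
  shows "horizontal_lift A nabla (p, u) w = chart_vec (tangent_atlas A) (tchart A c) (p, u)
    (vec_coord A c p w, - christoffel A nabla c (snd c p) (vec_coord A c p w) (vec_coord A c p u))"
proof -
  have P: "(p, u) \<in> fst (tchart A c)" using c by simp
  let ?H = "\<lambda>a. chart_vec (tangent_atlas A) (tchart A c) (p, u) (a, - christoffel A nabla c (snd c p) a (vec_coord A c p u))"
  have H: "tangent_map (tangent_atlas A) A fst (p, u) (?H a) = chart_vec A c p a" for a
    unfolding tangent_map_fst_in_chart[OF c] T.vec_coord_chart_vec[OF tchart_in[OF c(1)] P] by simp
  show ?thesis
    unfolding horizontal_lift_def horizontal_space_in_chart[OF N c]
  proof (rule the_equality)
    show "?H (vec_coord A c p w) \<in> range ?H \<and>
      tangent_map (tangent_atlas A) A fst (p, u) (?H (vec_coord A c p w)) = w"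
      using c by (simp add: H)
    fix \<zeta> assume "\<zeta> \<in> range ?H \<and> tangent_map (tangent_atlas A) A fst (p, u) \<zeta> = w"
    then obtain a where a: "\<zeta> = ?H a" "chart_vec A c p a = w" by (auto simp: H)
    then have "a = vec_coord A c p w" using vec_coord_chart_vec[OF c, of a] by simp
    then show "\<zeta> = ?H (vec_coord A c p w)" using a by simp
  qed
qed

text \<open>Subtracting the horizontal lift of \<open>a\<close> from \<open>(a, b)\<close> leaves
  \<open>b\<close> plus the Christoffel term in the second coordinate, which is the vertical
  part.\<close>

lemma hv_components_in_chart:
  assumes N: "connection A nabla" and c: "c \<in> A" "p \<in> fst c"
  shows "hv_components A nabla (p, u) (chart_vec (tangent_atlas A) (tchart A c) (p, u) (a, b)) =
    (chart_vec A c p a, chart_vec A c p (b + christoffel A nabla c (snd c p) a (vec_coord A c p u)))"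
proof -
  have P: "(p, u) \<in> fst (tchart A c)" using c by simp
  let ?V = "chart_vec (tangent_atlas A) (tchart A c) (p, u)"
  let ?G = "\<lambda>a. christoffel A nabla c (snd c p) a (vec_coord A c p u)"
  have sum: "horizontal_lift A nabla (p, u) v + vertical_lift A (p, u) w =
      ?V (vec_coord A c p v, vec_coord A c p w - ?G (vec_coord A c p v))" for v w
    unfolding horizontal_lift_in_chart[OF N c] vertical_lift_in_chart[OF c]
      linear_add[OF T.linear_chart_vec[OF tchart_in[OF c(1)] P], symmetric] by simp
  have inj: "?V y = ?V z \<longleftrightarrow> y = z" for y z
    using T.vec_coord_chart_vec[OF tchart_in[OF c(1)] P] by metis
  show ?thesis
    unfolding hv_components_def
  proof (rule the_equality)
    show "?V (a, b) = horizontal_lift A nabla (p, u) (fst (chart_vec A c p a, chart_vec A c p (b + ?G a))) +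
        vertical_lift A (p, u) (snd (chart_vec A c p a, chart_vec A c p (b + ?G a)))"
      unfolding sum using c by simp
    fix vw assume "?V (a, b) = horizontal_lift A nabla (p, u) (fst vw) + vertical_lift A (p, u) (snd vw)"
    then have "a = vec_coord A c p (fst vw)" "b + ?G a = vec_coord A c p (snd vw)"
      unfolding sum inj by auto
    then show "vw = (chart_vec A c p a, chart_vec A c p (b + ?G a))"
      using c by (cases vw) simp
  qed
qed

text \<open>With \<open>\<beta> = b + \<Gamma> a\<close>, the horizontal lift
  \<open>(\<beta>, - \<Gamma> \<beta>)\<close> is subtracted from \<open>(0, a)\<close>, whence the
  plus sign in the second component.\<close>

lemma J1_in_chart:
  fixes u :: 'e
  assumes N: "connection A nabla" and c: "c \<in> A" "p \<in> fst c"
  defines "\<Gamma> \<equiv> \<lambda>a. christoffel A nabla c (snd c p) a (vec_coord A c p u)"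
  shows "J1 A nabla (p, u) (chart_vec (tangent_atlas A) (tchart A c) (p, u) (a, b)) =
    chart_vec (tangent_atlas A) (tchart A c) (p, u) (- (b + \<Gamma> a), a + \<Gamma> (b + \<Gamma> a))"
proof -
  have P: "(p, u) \<in> fst (tchart A c)" using c by simp
  show ?thesis
    unfolding J1_def hv_components_in_chart[OF N c] horizontal_lift_in_chart[OF N c] vertical_lift_in_chart[OF c]
      Let_def prod.case linear_diff[OF T.linear_chart_vec[OF tchart_in[OF c(1)] P], symmetric]
    using c by (simp add: \<Gamma>_def)
qed

lemma g1_in_chart:
  fixes u :: 'e and g :: "'a \<Rightarrow> 'e \<Rightarrow> 'e \<Rightarrow> real"
  assumes N: "connection A nabla" and c: "c \<in> A" "p \<in> fst c"
  defines "\<Gamma> \<equiv> \<lambda>a. christoffel A nabla c (snd c p) a (vec_coord A c p u)"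
    and "G \<equiv> metric_rep A g c (snd c p)"
    and "V \<equiv> chart_vec (tangent_atlas A) (tchart A c) (p, u)"
  shows "g1 A nabla g (p, u) (V (a, b)) (V (a', b')) = G a a' + G (b + \<Gamma> a) (b' + \<Gamma> a')"
  unfolding g1_def V_def hv_components_in_chart[OF N c] Let_def prod.case
  using metric_rep_at(1)[OF c, of g] by (simp add: G_def \<Gamma>_def)

end

section \<open>The Lee form as a trace\<close>

text \<open>A coordinate patch of an almost Hermitian manifold. \<open>\<Lambda>\<close> stands for
  the Levi-Civita symbols and is described by symmetry and metric compatibility, which spares an
  explicit formula for the connection of the lifted metric.\<close>

locale almost_hermitian_rep =
  fixes S :: "'f::euclidean_space set" and H :: "'f \<Rightarrow> 'f \<Rightarrow> 'f \<Rightarrow> real" and J :: "'f \<Rightarrow> 'f \<Rightarrow> 'f"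
    and \<Lambda> :: "'f \<Rightarrow> 'f \<Rightarrow> 'f \<Rightarrow> 'f"
  assumes H: "smooth_bil H S" and pos: "\<And>z. z \<in> S \<Longrightarrow> posdef (H z)"
    and J_linear: "\<And>z. z \<in> S \<Longrightarrow> linear (J z)" and J_smooth: "\<And>\<zeta>. smooth_on (\<lambda>z. J z \<zeta>) S"
    and J_square: "\<And>z \<zeta>. z \<in> S \<Longrightarrow> J z (J z \<zeta>) = - \<zeta>"
    and J_isometry: "\<And>z \<zeta> \<eta>. z \<in> S \<Longrightarrow> H z (J z \<zeta>) (J z \<eta>) = H z \<zeta> \<eta>"
    and \<Lambda>: "smooth_bil \<Lambda> S" and \<Lambda>_sym: "\<And>z \<zeta> \<eta>. z \<in> S \<Longrightarrow> \<Lambda> z \<zeta> \<eta> = \<Lambda> z \<eta> \<zeta>"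
    and \<Lambda>_metric: "\<And>z k \<zeta> \<eta>. z \<in> S \<Longrightarrow>
      pd (\<lambda>y. H y \<zeta> \<eta>) z k = H z (\<Lambda> z k \<zeta>) \<eta> + H z \<zeta> (\<Lambda> z k \<eta>)"
begin

definition Om :: "'f \<Rightarrow> 'f \<Rightarrow> 'f \<Rightarrow> real" where
  "Om z \<zeta> \<eta> = H z (J z \<zeta>) \<eta>"

definition dOm :: "'f \<Rightarrow> 'f \<Rightarrow> 'f \<Rightarrow> 'f \<Rightarrow> real" where
  "dOm z \<zeta> \<eta> \<kappa> = pd (\<lambda>y. Om y \<eta> \<kappa>) z \<zeta> + pd (\<lambda>y. Om y \<kappa> \<zeta>) z \<eta> + pd (\<lambda>y. Om y \<zeta> \<eta>) z \<kappa>"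

definition nablaOm :: "'f \<Rightarrow> 'f \<Rightarrow> 'f \<Rightarrow> 'f \<Rightarrow> real" where
  "nablaOm z k \<zeta> \<eta> = pd (\<lambda>y. Om y \<zeta> \<eta>) z k - Om z (\<Lambda> z k \<zeta>) \<eta> - Om z \<zeta> (\<Lambda> z k \<eta>)"

definition nablaJ :: "'f \<Rightarrow> 'f \<Rightarrow> 'f \<Rightarrow> 'f" where
  "nablaJ z k \<zeta> = pd (\<lambda>y. J y \<zeta>) z k + \<Lambda> z k (J z \<zeta>) - J z (\<Lambda> z k \<zeta>)"

lemma S_open: "open S"
  using H by (simp add: smooth_bil_def)

lemma smooth_bil_Om: "smooth_bil Om S"
  unfolding smooth_bil_def
proof (intro conjI ballI allI)
  show "open S" by (rule S_open)
  show "bilinear (Om z)" if z: "z \<in> S" for z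
    unfolding Om_def bilinear_def
    using linear_compose[OF J_linear[OF z] smooth_bil_linear(2)[OF H z]] smooth_bil_linear(1)[OF H z]
    by (auto simp: o_def)
  show "smooth_on (\<lambda>z. Om z \<zeta> \<eta>) S" for \<zeta> \<eta>
    unfolding Om_def by (rule smooth_bil_apply[OF H J_smooth smooth_on_const])
qed

lemma J_skew: "z \<in> S \<Longrightarrow> H z (J z \<zeta>) \<eta> = - H z \<zeta> (J z \<eta>)"
  using J_isometry[of z "J z \<zeta>" \<eta>] J_square[of z \<zeta>]
  by (simp add: bilinear_lneg[OF smooth_bil_bilinear[OF H]])

lemma Om_skew: "z \<in> S \<Longrightarrow> Om z \<zeta> \<eta> = - Om z \<eta> \<zeta>"
  using J_skew[of z \<zeta> \<eta>] posdefD(2)[OF pos, of z \<zeta> "J z \<eta>"] by (simp add: Om_def)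

lemma pd_Om_skew:
  assumes z: "z \<in> S"
  shows "pd (\<lambda>y. Om y \<zeta> \<eta>) z k = - pd (\<lambda>y. Om y \<eta> \<zeta>) z k"
proof -
  note d = smooth_bil_differentiable[OF smooth_bil_Om z, of \<eta> \<zeta>]
  show ?thesis
    by (rule trans[OF pd_cong_open[OF S_open z Om_skew] pd_eq[OF has_derivative_minus[OF d[unfolded frechet_derivative_works]]]])
       (auto intro!: differentiable_minus d)
qed

lemma nablaOm_skew: "z \<in> S \<Longrightarrow> nablaOm z k \<zeta> \<eta> = - nablaOm z k \<eta> \<zeta>"
  using pd_Om_skew[of z \<zeta> \<eta> k] Om_skew[of z "\<Lambda> z k \<zeta>" \<eta>] Om_skew[of z \<zeta> "\<Lambda> z k \<eta>"]
  by (simp add: nablaOm_def)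

text \<open>Compatibility of \<open>\<Lambda>\<close> says that \<open>H\<close> is parallel, so
  only \<open>J\<close> is differentiated.\<close>

lemma nablaOm_eq:
  assumes z: "z \<in> S"
  shows "nablaOm z k \<zeta> \<eta> = H z (nablaJ z k \<zeta>) \<eta>"
proof -
  have "pd (\<lambda>y. Om y \<zeta> \<eta>) z k = pd (\<lambda>y. H y (J z \<zeta>) \<eta>) z k + H z (pd (\<lambda>y. J y \<zeta>) z k) \<eta>"
    unfolding Om_def
    using pd_smooth_bil[OF H z smooth_on_differentiable[OF J_smooth z] differentiable_const, of \<zeta> \<eta> k]
    by (simp add: bilinear_rzero[OF smooth_bil_bilinear[OF H z]])
  then show ?thesis
    unfolding nablaOm_def \<Lambda>_metric[OF z]
    by (simp add: Om_def nablaJ_def bilinear_ladd[OF smooth_bil_bilinear[OF H z]] bilinear_lsub[OF smooth_bil_bilinear[OF H z]])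
qed

text \<open>The relation \<open>J (J \<zeta>) = - \<zeta>\<close> is differentiated by the product
  rule. The \<open>\<Lambda>\<close> part of \<open>nablaJ\<close> is a commutator with
  \<open>J\<close>, and such a commutator anticommutes with \<open>J\<close> because
  \<open>J\<close> squares to minus the identity.\<close>

lemma nablaJ_J:
  assumes z: "z \<in> S"
  shows "nablaJ z k (J z \<zeta>) = - J z (nablaJ z k \<zeta>)"
proof -
  note d = smooth_on_differentiable[OF J_smooth z]
  have "((\<lambda>y. J y (J y \<zeta>)) has_derivative (\<lambda>v. pd (\<lambda>y. J y (J z \<zeta>)) z v + J z (pd (\<lambda>y. J y \<zeta>) z v))) (at z)"
    by (rule has_derivative_linear_family[OF S_open z J_linear d d[unfolded frechet_derivative_works]])
  moreover have "((\<lambda>y. J y (J y \<zeta>)) has_derivative (\<lambda>v. 0)) (at z)"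
    by (rule has_derivative_transform_within_open[OF has_derivative_const[of "- \<zeta>"] S_open z])
       (simp add: J_square)
  ultimately have "(\<lambda>v. pd (\<lambda>y. J y (J z \<zeta>)) z v + J z (pd (\<lambda>y. J y \<zeta>) z v)) = (\<lambda>v. 0)"
    by (rule has_derivative_unique)
  then have "pd (\<lambda>y. J y (J z \<zeta>)) z k + J z (pd (\<lambda>y. J y \<zeta>) z k) = 0" by metis
  then have "pd (\<lambda>y. J y (J z \<zeta>)) z k = - J z (pd (\<lambda>y. J y \<zeta>) z k)"
    by (simp add: eq_neg_iff_add_eq_0)
  then show ?thesis
    by (simp add: nablaJ_def J_square[OF z] linear_add[OF J_linear[OF z]] linear_diff[OF J_linear[OF z]]
        bilinear_rneg[OF smooth_bil_bilinear[OF \<Lambda> z]])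
qed

text \<open>Anticommutation with \<open>J\<close> contributes one sign and skewness of
  \<open>J\<close> another.\<close>

lemma nablaOm_J: "z \<in> S \<Longrightarrow> nablaOm z k (J z \<zeta>) \<eta> = nablaOm z k \<zeta> (J z \<eta>)"
  by (simp add: nablaOm_eq nablaJ_J bilinear_lneg[OF smooth_bil_bilinear[OF H]] J_skew)

text \<open>The symbol terms cancel in pairs by symmetry of \<open>\<Lambda>\<close> and skewness of
  \<open>Om\<close>, as for any torsion-free connection.\<close>

lemma dOm_eq_nablaOm:
  assumes z: "z \<in> S"
  shows "dOm z \<zeta> \<eta> \<kappa> = nablaOm z \<zeta> \<eta> \<kappa> + nablaOm z \<eta> \<kappa> \<zeta> + nablaOm z \<kappa> \<zeta> \<eta>"
  using Om_skew[OF z, of \<eta> "\<Lambda> z \<zeta> \<kappa>"] Om_skew[OF z, of \<kappa> "\<Lambda> z \<eta> \<zeta>"] Om_skew[OF z, of \<zeta> "\<Lambda> z \<kappa> \<eta>"]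
    \<Lambda>_sym[OF z, of \<zeta> \<kappa>] \<Lambda>_sym[OF z, of \<eta> \<zeta>] \<Lambda>_sym[OF z, of \<kappa> \<eta>]
  by (simp add: dOm_def nablaOm_def)

lemma nablaOm_linear:
  assumes z: "z \<in> S"
  shows "linear (\<lambda>k. nablaOm z k \<zeta> \<eta>)" "linear (\<lambda>\<zeta>. nablaOm z k \<zeta> \<eta>)" "linear (\<lambda>\<eta>. nablaOm z k \<zeta> \<eta>)"
proof -
  note l = linear_pd[OF smooth_bil_differentiable[OF smooth_bil_Om z]]
  note b = bilinear_pd_smooth_bil[OF smooth_bil_Om z]
  note o = smooth_bil_bilinear[OF smooth_bil_Om z] and L = smooth_bil_bilinear[OF \<Lambda> z]
  note r = linear_add[OF l] linear_scale[OF l] bilinear_ladd[OF b] bilinear_radd[OF b] bilinear_lmul[OF b] bilinear_rmul[OF b]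
    bilinear_ladd[OF o] bilinear_radd[OF o] bilinear_lmul[OF o] bilinear_rmul[OF o]
    bilinear_ladd[OF L] bilinear_radd[OF L] bilinear_lmul[OF L] bilinear_rmul[OF L]
  show "linear (\<lambda>k. nablaOm z k \<zeta> \<eta>)" "linear (\<lambda>\<zeta>. nablaOm z k \<zeta> \<eta>)" "linear (\<lambda>\<eta>. nablaOm z k \<zeta> \<eta>)"
    by (auto intro!: linearI simp: nablaOm_def r algebra_simps)
qed

lemma is_onb_J:
  assumes z: "z \<in> S" and B: "is_onb (H z) B"
  shows "is_onb (H z) (J z ` B)" "inj_on (J z) B"
  using orthonormal_family_is_onb[of B "H z" "J z"] B J_isometry[OF z] by (auto simp: is_onb_def)

text \<open>Since \<open>\<nabla>\<^sub>k J\<close> anticommutes with \<open>J\<close>, the terms \<open>(\<nabla>\<^sub>\<zeta> \<Omega>)(e, Je)\<close> vanish, and the remaining two traces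
  agree because \<open>J\<close> maps orthonormal bases to orthonormal bases.\<close>

lemma trace_nablaOm:
  assumes z: "z \<in> S" and B: "is_onb (H z) B"
  shows "(\<Sum>e\<in>B. nablaOm z e e (J z \<zeta>)) = (\<Sum>e\<in>B. dOm z e (J z e) \<zeta>) / 2"
proof -
  have v: "nablaOm z \<zeta> e (J z e) = 0" for e
    using nablaOm_J[OF z, of \<zeta> e e] nablaOm_skew[OF z, of \<zeta> e "J z e"] by simp
  have bil: "bilinear (\<lambda>x y. nablaOm z x \<zeta> (J z y))"
    unfolding bilinear_def
    using nablaOm_linear(1)[OF z] linear_compose[OF J_linear[OF z] nablaOm_linear(3)[OF z]]
    by (auto simp: o_def)
  \<comment> \<open>Replacing the basis by its image under \<open>J\<close> moves \<open>J\<close>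
    from the last slot to the first, up to the sign from \<open>J (J e) = - e\<close>.\<close>
  have "(\<Sum>e\<in>B. nablaOm z e \<zeta> (J z e)) = (\<Sum>e\<in>J z ` B. nablaOm z e \<zeta> (J z e))"
    by (rule trace_is_onb_eq[OF pos[OF z] B is_onb_J(1)[OF z B] bil])
  also have "\<dots> = (\<Sum>e\<in>B. - nablaOm z (J z e) \<zeta> e)"
    by (simp add: sum.reindex[OF is_onb_J(2)[OF z B]] o_def J_square[OF z] linear_neg[OF nablaOm_linear(3)[OF z]])
  finally have t: "(\<Sum>e\<in>B. nablaOm z (J z e) \<zeta> e) = (\<Sum>e\<in>B. nablaOm z e e (J z \<zeta>))"
    using nablaOm_J[OF z] nablaOm_skew[OF z, of _ \<zeta>] by (simp add: sum_negf)
  have "(\<Sum>e\<in>B. dOm z e (J z e) \<zeta>) = (\<Sum>e\<in>B. nablaOm z e e (J z \<zeta>)) + (\<Sum>e\<in>B. nablaOm z (J z e) \<zeta> e)"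
    by (simp add: dOm_eq_nablaOm[OF z] v nablaOm_J[OF z] sum.distrib)
  then show ?thesis using t by simp
qed

text \<open>Makes the trace of \<open>dOm z e (J z e) \<zeta>\<close> independent of the orthonormal
  basis, so that a basis adapted to the horizontal and vertical splitting can be used.\<close>

lemma dOm_J_bilinear: "z \<in> S \<Longrightarrow> bilinear (\<lambda>x y. dOm z x (J z y) \<zeta>)"
  unfolding bilinear_def dOm_eq_nablaOm
  by (auto intro!: linearI simp: dOm_eq_nablaOm linear_add[OF nablaOm_linear(1)] linear_add[OF nablaOm_linear(2)] linear_add[OF nablaOm_linear(3)]
      linear_scale[OF nablaOm_linear(1)] linear_scale[OF nablaOm_linear(2)] linear_scale[OF nablaOm_linear(3)]
      linear_add[OF J_linear] linear_scale[OF J_linear] algebra_simps)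

end

section \<open>Local computations on the tangent bundle\<close>

text \<open>A coordinate patch of an affine-Riemann manifold: \<open>\<Gamma>\<close> belongs to the
  flat connection and \<open>\<Delta>\<close> to the Levi-Civita connection of
  \<open>G\<close>.\<close>

locale affine_riemann_rep =
  fixes V :: "'e::euclidean_space set" and G :: "'e \<Rightarrow> 'e \<Rightarrow> 'e \<Rightarrow> real" and \<Gamma> \<Delta> :: "'e \<Rightarrow> 'e \<Rightarrow> 'e \<Rightarrow> 'e"
  assumes G: "smooth_bil G V" and G_pos: "\<And>x. x \<in> V \<Longrightarrow> posdef (G x)"
    and \<Gamma>: "smooth_bil \<Gamma> V" and \<Gamma>_sym: "\<And>x u v. x \<in> V \<Longrightarrow> \<Gamma> x u v = \<Gamma> x v u"
    and \<Gamma>_flat: "\<And>x a b u. x \<in> V \<Longrightarrow>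
      pd (\<lambda>y. \<Gamma> y b u) x a + \<Gamma> x a (\<Gamma> x b u) = pd (\<lambda>y. \<Gamma> y a u) x b + \<Gamma> x b (\<Gamma> x a u)"
    and \<Delta>: "smooth_bil \<Delta> V" and \<Delta>_sym: "\<And>x u v. x \<in> V \<Longrightarrow> \<Delta> x u v = \<Delta> x v u"
    and \<Delta>_metric: "\<And>x u v w. x \<in> V \<Longrightarrow> pd (\<lambda>y. G y v w) x u = G x (\<Delta> x u v) w + G x v (\<Delta> x u w)"
begin

text \<open>In the chart of \<open>TM\<close> induced by a chart of \<open>M\<close>, the point \<open>z\<close> is \<open>(x, u)\<close> and the tangent vector
  \<open>\<zeta> = (a, b)\<close> is the sum of the horizontal lift of \<open>a\<close> and the vertical lift of \<open>vert z \<zeta>\<close>.\<close>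

definition vert :: "'e \<times> 'e \<Rightarrow> 'e \<times> 'e \<Rightarrow> 'e" where
  "vert z \<zeta> = snd \<zeta> + \<Gamma> (fst z) (fst \<zeta>) (snd z)"

text \<open>The derivative of \<open>vert\<close> when the point moves in direction \<open>k\<close>
  and \<open>\<zeta>\<close> keeps its coordinates.\<close>

definition dvert :: "'e \<times> 'e \<Rightarrow> 'e \<times> 'e \<Rightarrow> 'e \<times> 'e \<Rightarrow> 'e" where
  "dvert z \<zeta> k = pd (\<lambda>y. \<Gamma> y (fst \<zeta>) (snd z)) (fst z) (fst k) + \<Gamma> (fst z) (fst \<zeta>) (snd k)"

definition H :: "'e \<times> 'e \<Rightarrow> 'e \<times> 'e \<Rightarrow> 'e \<times> 'e \<Rightarrow> real" where
  "H z \<zeta> \<eta> = G (fst z) (fst \<zeta>) (fst \<eta>) + G (fst z) (vert z \<zeta>) (vert z \<eta>)"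

definition J :: "'e \<times> 'e \<Rightarrow> 'e \<times> 'e \<Rightarrow> 'e \<times> 'e" where
  "J z \<zeta> = (- vert z \<zeta>, fst \<zeta> + \<Gamma> (fst z) (vert z \<zeta>) (snd z))"

definition \<gamma> :: "'e \<Rightarrow> 'e \<Rightarrow> 'e \<Rightarrow> 'e" where
  "\<gamma> x u v = \<Delta> x u v - \<Gamma> x u v"

abbreviation TV :: "('e \<times> 'e) set" where "TV \<equiv> V \<times> UNIV"

lemma V_open: "open V"
  using G by (simp add: smooth_bil_def)

lemma TV_open: "open TV"
  using V_open by (simp add: open_Times)

lemmas G_bil = smooth_bil_bilinear[OF G] and \<Gamma>_bil = smooth_bil_bilinear[OF \<Gamma>]
  and \<Delta>_bil = smooth_bil_bilinear[OF \<Delta>]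
lemmas G_sym = posdefD(2)[OF G_pos]

lemmas G_simps = bilinear_ladd[OF G_bil] bilinear_radd[OF G_bil] bilinear_lsub[OF G_bil] bilinear_rsub[OF G_bil]
  bilinear_lneg[OF G_bil] bilinear_rneg[OF G_bil] bilinear_lmul[OF G_bil] bilinear_rmul[OF G_bil]
  bilinear_lzero[OF G_bil] bilinear_rzero[OF G_bil]
lemmas \<Gamma>_simps = bilinear_ladd[OF \<Gamma>_bil] bilinear_radd[OF \<Gamma>_bil] bilinear_lsub[OF \<Gamma>_bil] bilinear_rsub[OF \<Gamma>_bil]
  bilinear_lneg[OF \<Gamma>_bil] bilinear_rneg[OF \<Gamma>_bil] bilinear_lmul[OF \<Gamma>_bil] bilinear_rmul[OF \<Gamma>_bil]
  bilinear_lzero[OF \<Gamma>_bil] bilinear_rzero[OF \<Gamma>_bil]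
lemmas \<Delta>_simps = bilinear_ladd[OF \<Delta>_bil] bilinear_radd[OF \<Delta>_bil] bilinear_lsub[OF \<Delta>_bil] bilinear_rsub[OF \<Delta>_bil]
  bilinear_lneg[OF \<Delta>_bil] bilinear_rneg[OF \<Delta>_bil] bilinear_lmul[OF \<Delta>_bil] bilinear_rmul[OF \<Delta>_bil]
  bilinear_lzero[OF \<Delta>_bil] bilinear_rzero[OF \<Delta>_bil]

lemma smooth_bil_\<gamma>: "smooth_bil \<gamma> V"
  unfolding smooth_bil_def
proof (intro conjI ballI allI)
  show "bilinear (\<gamma> x)" if "x \<in> V" for x
    unfolding bilinear_def
    by (auto intro!: linearI simp: \<gamma>_def \<Gamma>_simps[OF that] \<Delta>_simps[OF that] algebra_simps)
  show "smooth_on (\<lambda>x. \<gamma> x u v) V" for u v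
    unfolding \<gamma>_def using \<Gamma> \<Delta> by (intro smooth_on_diff) (auto simp: smooth_bil_def)
qed (rule V_open)

lemma \<gamma>_sym: "x \<in> V \<Longrightarrow> \<gamma> x u v = \<gamma> x v u"
  by (simp add: \<gamma>_def \<Gamma>_sym \<Delta>_sym)

lemma vert_linear: "z \<in> TV \<Longrightarrow> linear (vert z)"
  by (auto intro!: linearI simp: vert_def \<Gamma>_simps algebra_simps)

lemma vert_smooth: "smooth_on (\<lambda>z. vert z \<zeta>) TV"
  unfolding vert_def
  by (rule smooth_on_add[OF smooth_on_const smooth_bil_apply[OF smooth_bil_prod_fst[OF \<Gamma>] smooth_on_const
        smooth_on_snd[OF smooth_on_id[OF TV_open] TV_open]] TV_open])

lemma has_derivative_fst_family:
  fixes f :: "'e \<Rightarrow> 'b::real_normed_vector"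
  assumes "f differentiable (at (fst z))"
  shows "((\<lambda>y. f (fst y)) has_derivative (\<lambda>k. pd f (fst z) (fst k))) (at z)"
  by (rule has_derivative_compose[OF has_derivative_fst[OF has_derivative_ident] assms[unfolded frechet_derivative_works]])

lemma has_derivative_bil_fst:
  fixes B :: "'e \<Rightarrow> 'e \<Rightarrow> 'e \<Rightarrow> 'b::real_normed_vector"
  assumes B: "smooth_bil B V" and z: "z \<in> TV"
    and f: "(f has_derivative f') (at z)" and h: "(h has_derivative h') (at z)"
  shows "((\<lambda>y. B (fst y) (f y) (h y)) has_derivative
    (\<lambda>k. pd (\<lambda>y. B y (f z) (h z)) (fst z) (fst k) + B (fst z) (f' k) (h z) + B (fst z) (f z) (h' k))) (at z)"
proof -
  have fz: "fst z \<in> V" using z by auto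
  show ?thesis
    using has_derivative_smooth_bil[OF smooth_bil_prod_fst[OF B] z f h]
      pd_eq[OF has_derivative_fst_family[OF smooth_bil_differentiable[OF B fz]]] by simp
qed

lemma vert_has_derivative:
  assumes z: "z \<in> TV"
  shows "((\<lambda>y. vert y \<zeta>) has_derivative dvert z \<zeta>) (at z)"
proof -
  have fz: "fst z \<in> V" using z by auto
  show ?thesis
    unfolding vert_def
    using has_derivative_add[OF has_derivative_const[of "snd \<zeta>"]
        has_derivative_bil_fst[OF \<Gamma> z has_derivative_const has_derivative_snd[OF has_derivative_ident], of "fst \<zeta>"]]
    by (simp add: dvert_def[abs_def] \<Gamma>_simps[OF fz])
qed

text \<open>The antisymmetric part of \<open>dvert\<close> is the exterior derivative of the
  vertical component. Flatness trades the derivatives of \<open>\<Gamma>\<close> for quadratic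
  terms, and these complete \<open>snd k\<close> and \<open>snd \<zeta>\<close> to vertical
  components.\<close>

lemma dvert_swap:
  assumes z: "z \<in> TV"
  shows "dvert z \<zeta> k = dvert z k \<zeta> + \<Gamma> (fst z) (fst \<zeta>) (vert z k) - \<Gamma> (fst z) (fst k) (vert z \<zeta>)"
proof -
  have fz: "fst z \<in> V" using z by auto
  show ?thesis
    using \<Gamma>_flat[OF fz, of "fst k" "snd z" "fst \<zeta>"]
    by (simp add: dvert_def vert_def \<Gamma>_simps[OF fz] algebra_simps)
qed

lemma vert_J: "z \<in> TV \<Longrightarrow> vert z (J z \<zeta>) = fst \<zeta>"
  by (auto simp: J_def vert_def \<Gamma>_simps)

lemma fst_J: "fst (J z \<zeta>) = - vert z \<zeta>"
  by (simp add: J_def)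

lemma J_square: "z \<in> TV \<Longrightarrow> J z (J z \<zeta>) = - \<zeta>"
  using vert_J[of z \<zeta>] fst_J[of z \<zeta>] by (subst J_def) (auto simp: vert_def prod_eq_iff)

lemma posdef_H:
  assumes z: "z \<in> TV"
  shows "posdef (H z)"
proof -
  have fz: "fst z \<in> V" using z by auto
  note lin = linear_add[OF vert_linear[OF z]] linear_scale[OF vert_linear[OF z]]
  show ?thesis
    unfolding posdef_def
  proof (intro conjI allI impI)
    show "bilinear (H z)"
      unfolding bilinear_def
      by (intro conjI allI linearI; simp add: H_def lin G_simps[OF fz] algebra_simps)
    show "H z \<zeta> \<eta> = H z \<eta> \<zeta>" for \<zeta> \<eta>
      using G_sym[OF fz] by (simp add: H_def)
    fix \<zeta> :: "'e \<times> 'e" assume "\<zeta> \<noteq> 0"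
    have nn: "0 \<le> G (fst z) a a" for a
      using posdefD(3)[OF G_pos[OF fz], of a] G_simps[OF fz] by (cases "a = 0") auto
    show "0 < H z \<zeta> \<zeta>"
    proof (cases "fst \<zeta> = 0")
      case True
      then have "vert z \<zeta> \<noteq> 0" using \<open>\<zeta> \<noteq> 0\<close> by (auto simp: vert_def \<Gamma>_simps[OF fz] prod_eq_iff)
      then show ?thesis using posdefD(3)[OF G_pos[OF fz]] nn by (simp add: H_def add_nonneg_pos)
    next
      case False
      then show ?thesis using posdefD(3)[OF G_pos[OF fz]] nn by (simp add: H_def add_pos_nonneg)
    qed
  qed
qed

lemma smooth_bil_H: "smooth_bil H TV"
  unfolding smooth_bil_def
proof (intro conjI ballI allI)
  show "bilinear (H z)" if "z \<in> TV" for z using posdefD(1)[OF posdef_H[OF that]] .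
  show "smooth_on (\<lambda>z. H z \<zeta> \<eta>) TV" for \<zeta> \<eta>
    unfolding H_def
    by (intro smooth_on_add[OF _ _ TV_open] smooth_bil_apply[OF smooth_bil_prod_fst[OF G]] smooth_on_const vert_smooth)
qed (rule TV_open)

lemma J_isometry: "z \<in> TV \<Longrightarrow> H z (J z \<zeta>) (J z \<eta>) = H z \<zeta> \<eta>"
  by (auto simp: H_def vert_J fst_J G_simps)

lemma J_linear: "z \<in> TV \<Longrightarrow> linear (J z)"
  by (intro linearI; simp add: J_def linear_add[OF vert_linear] linear_scale[OF vert_linear] \<Gamma>_simps mem_Times_iff algebra_simps)

lemma J_smooth: "smooth_on (\<lambda>z. J z \<zeta>) TV"
  unfolding J_def
  by (intro smooth_on_Pair[OF _ _ TV_open] smooth_on_minus[OF _ TV_open] smooth_on_add[OF _ _ TV_open] vert_smooth smooth_on_const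
      smooth_bil_apply[OF smooth_bil_prod_fst[OF \<Gamma>]] smooth_on_snd[OF smooth_on_id[OF TV_open] TV_open])

section \<open>The fundamental form and its exterior derivative\<close>

definition \<Omega> :: "'e \<times> 'e \<Rightarrow> 'e \<times> 'e \<Rightarrow> 'e \<times> 'e \<Rightarrow> real" where
  "\<Omega> z \<zeta> \<eta> = H z (J z \<zeta>) \<eta>"

lemma \<Omega>_eq: "z \<in> TV \<Longrightarrow> \<Omega> z \<zeta> \<eta> = G (fst z) (fst \<zeta>) (vert z \<eta>) - G (fst z) (fst \<eta>) (vert z \<zeta>)"
  using G_sym[of "fst z" "fst \<eta>" "vert z \<zeta>"] by (auto simp: \<Omega>_def H_def fst_J vert_J G_simps)

lemma smooth_bil_\<Omega>: "smooth_bil \<Omega> TV"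
  unfolding smooth_bil_def
proof (intro conjI ballI allI)
  show "bilinear (\<Omega> z)" if z: "z \<in> TV" for z
    unfolding \<Omega>_def bilinear_def
    using linear_compose[OF J_linear[OF z] smooth_bil_linear(2)[OF smooth_bil_H z]] smooth_bil_linear(1)[OF smooth_bil_H z]
    by (auto simp: o_def)
  show "smooth_on (\<lambda>z. \<Omega> z \<zeta> \<eta>) TV" for \<zeta> \<eta>
    unfolding \<Omega>_def by (rule smooth_bil_apply[OF smooth_bil_H J_smooth smooth_on_const])
qed (rule TV_open)

lemma \<Omega>_skew: "z \<in> TV \<Longrightarrow> \<Omega> z \<zeta> \<eta> = - \<Omega> z \<eta> \<zeta>"
  by (simp add: \<Omega>_eq)

definition d\<Omega> :: "'e \<times> 'e \<Rightarrow> 'e \<times> 'e \<Rightarrow> 'e \<times> 'e \<Rightarrow> 'e \<times> 'e \<Rightarrow> real" where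
  "d\<Omega> z \<zeta> \<eta> \<kappa> = pd (\<lambda>y. \<Omega> y \<eta> \<kappa>) z \<zeta> + pd (\<lambda>y. \<Omega> y \<kappa> \<zeta>) z \<eta> + pd (\<lambda>y. \<Omega> y \<zeta> \<eta>) z \<kappa>"

lemma pd_G_vert:
  assumes z: "z \<in> TV"
  defines "x \<equiv> fst z"
  shows "((\<lambda>y. G (fst y) a (vert y \<eta>)) has_derivative (\<lambda>k. G x (\<Delta> x (fst k) a) (vert z \<eta>)
    + G x a (\<Delta> x (fst k) (vert z \<eta>)) + G x a (dvert z \<eta> k))) (at z)"
proof -
  have fz: "x \<in> V" using z by (auto simp: x_def)
  show ?thesis
    using has_derivative_bil_fst[OF G z has_derivative_const vert_has_derivative[OF z], of a \<eta>]
    unfolding x_def[symmetric] by (simp add: \<Delta>_metric[OF fz] G_simps[OF fz])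
qed

lemma pd_\<Omega>:
  assumes z: "z \<in> TV"
  defines "x \<equiv> fst z"
  shows "pd (\<lambda>y. \<Omega> y \<zeta> \<eta>) z k =
    (G x (\<Delta> x (fst k) (fst \<zeta>)) (vert z \<eta>) + G x (fst \<zeta>) (\<Delta> x (fst k) (vert z \<eta>)) + G x (fst \<zeta>) (dvert z \<eta> k)) -
    (G x (\<Delta> x (fst k) (fst \<eta>)) (vert z \<zeta>) + G x (fst \<eta>) (\<Delta> x (fst k) (vert z \<zeta>)) + G x (fst \<eta>) (dvert z \<zeta> k))"
proof -
  note d = has_derivative_diff[OF pd_G_vert[OF z, of "fst \<zeta>" \<eta>] pd_G_vert[OF z, of "fst \<eta>" \<zeta>], folded x_def]
  have "pd (\<lambda>y. \<Omega> y \<zeta> \<eta>) z k = pd (\<lambda>y. G (fst y) (fst \<zeta>) (vert y \<eta>) - G (fst y) (fst \<eta>) (vert y \<zeta>)) z k"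
    by (rule pd_cong_open[OF TV_open z \<Omega>_eq differentiableI[OF d]])
  then show ?thesis using pd_eq[OF d] by simp
qed

text \<open>One \<open>dvert\<close> term of each pair is swapped, after which the
  \<open>dvert\<close> terms cancel. The \<open>\<Delta>\<close> terms with two base components
  cancel by symmetry; those with a vertical component join the \<open>\<Gamma>\<close> terms from
  the swap to form \<open>\<gamma>\<close>.\<close>

lemma d\<Omega>_eq:
  assumes z: "z \<in> TV"
  defines "x \<equiv> fst z"
  shows "d\<Omega> z \<zeta> \<eta> \<kappa> =
    (G x (fst \<eta>) (\<gamma> x (fst \<zeta>) (vert z \<kappa>)) - G x (fst \<zeta>) (\<gamma> x (fst \<eta>) (vert z \<kappa>))) +
    (G x (fst \<kappa>) (\<gamma> x (fst \<eta>) (vert z \<zeta>)) - G x (fst \<eta>) (\<gamma> x (fst \<kappa>) (vert z \<zeta>))) +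
    (G x (fst \<zeta>) (\<gamma> x (fst \<kappa>) (vert z \<eta>)) - G x (fst \<kappa>) (\<gamma> x (fst \<zeta>) (vert z \<eta>)))"
proof -
  have fz: "x \<in> V" using z by (auto simp: x_def)
  show ?thesis
    unfolding d\<Omega>_def pd_\<Omega>[OF z] x_def[symmetric]
      dvert_swap[OF z, of \<kappa> \<zeta>] dvert_swap[OF z, of \<zeta> \<eta>] dvert_swap[OF z, of \<eta> \<kappa>]
      \<Delta>_sym[OF fz, of "fst \<eta>" "fst \<zeta>"] \<Delta>_sym[OF fz, of "fst \<kappa>" "fst \<zeta>"] \<Delta>_sym[OF fz, of "fst \<kappa>" "fst \<eta>"]
    by (simp add: \<gamma>_def G_simps[OF fz])
qed

text \<open>Prepares the smoothness of \<open>Pi_field\<close>, a trace over bases chosen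
  independently at each point. Here the trace is computed in a smooth frame and its dual given by
  the Riesz formula; the second clause characterises this dual through an arbitrary basis.\<close>

lemma smooth_theta_dual:
  obtains \<rho> where "smooth_on \<rho> V"
    "\<And>x E a. x \<in> V \<Longrightarrow> is_onb (G x) E \<Longrightarrow>
      G x (\<rho> x) a = (\<Sum>e\<in>E. G x e (\<gamma> x a e) - G x a (\<gamma> x e e))"
proof -
  obtain F :: "'e \<Rightarrow> 'e \<Rightarrow> 'e" where F: "\<And>b. b \<in> Basis \<Longrightarrow> smooth_on (F b) V"
    "\<And>x. x \<in> V \<Longrightarrow> is_onb (G x) ((\<lambda>b. F b x) ` Basis)"
    "\<And>x. x \<in> V \<Longrightarrow> inj_on (\<lambda>b. F b x) Basis"
    using smooth_orthonormal_frame[of G V] G G_pos by blast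
  define h where "h x a e e' = G x e (\<gamma> x a e') - G x a (\<gamma> x e e')" for x a e e'
  define t where "t x a = (\<Sum>b\<in>Basis. h x a (F b x) (F b x))" for x a
  have \<gamma>_bil: "bilinear (\<gamma> x)" if "x \<in> V" for x by (rule smooth_bil_bilinear[OF smooth_bil_\<gamma> that])
  note \<gamma>_simps = bilinear_ladd[OF \<gamma>_bil] bilinear_radd[OF \<gamma>_bil] bilinear_lmul[OF \<gamma>_bil] bilinear_rmul[OF \<gamma>_bil]
  have h: "bilinear (h x a)" if "x \<in> V" for x a
    unfolding bilinear_def
    by (intro conjI allI linearI; simp add: h_def G_simps[OF that] \<gamma>_simps[OF that] algebra_simps)
  have tE: "t x a = (\<Sum>e\<in>E. h x a e e)" if x: "x \<in> V" and E: "is_onb (G x) E" for x a E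
    unfolding t_def
    using trace_is_onb_eq[OF G_pos[OF x] F(2)[OF x] E h[OF x]] sum.reindex[OF F(3)[OF x], of "\<lambda>e. h x a e e"]
    by simp
  have tlin: "linear (t x)" if x: "x \<in> V" for x
    by (intro linearI; simp add: t_def h_def G_simps[OF x] \<gamma>_simps[OF x] sum.distrib sum_distrib_left algebra_simps sum_subtractf)
  have tsm: "smooth_on (\<lambda>x. t x a) V" for a
    unfolding t_def h_def
    by (intro smooth_on_sum smooth_on_diff smooth_bil_apply[OF G] smooth_bil_apply[OF smooth_bil_\<gamma>] smooth_on_const F(1) V_open)
  define \<rho> where "\<rho> x = (\<Sum>b\<in>Basis. t x (F b x) *\<^sub>R F b x)" for x
  have "smooth_on \<rho> V"
    unfolding \<rho>_def
    by (intro smooth_on_sum smooth_on_scaleR smooth_on_linear_family[OF V_open tlin tsm] F(1) V_open)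
  moreover have "G x (\<rho> x) a = (\<Sum>e\<in>E. G x e (\<gamma> x a e) - G x a (\<gamma> x e e))"
    if x: "x \<in> V" and E: "is_onb (G x) E" for x a E
    using riesz_onb[OF G_pos[OF x] F(2)[OF x] tlin[OF x], of a] tE[OF x E, of a]
      sum.reindex[OF F(3)[OF x], of "\<lambda>b. t x b *\<^sub>R b"]
    by (simp add: \<rho>_def h_def)
  ultimately show ?thesis using that by blast
qed

context
  fixes \<Lambda> :: "'e \<times> 'e \<Rightarrow> 'e \<times> 'e \<Rightarrow> 'e \<times> 'e \<Rightarrow> 'e \<times> 'e"
  assumes \<Lambda>: "smooth_bil \<Lambda> TV" and \<Lambda>_sym: "\<And>z \<zeta> \<eta>. z \<in> TV \<Longrightarrow> \<Lambda> z \<zeta> \<eta> = \<Lambda> z \<eta> \<zeta>"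
    and \<Lambda>_metric: "\<And>z k \<zeta> \<eta>. z \<in> TV \<Longrightarrow>
      pd (\<lambda>y. H y \<zeta> \<eta>) z k = H z (\<Lambda> z k \<zeta>) \<eta> + H z \<zeta> (\<Lambda> z k \<eta>)"
begin

text \<open>The trace formula is evaluated on the horizontal and vertical lifts of \<open>E\<close>.
  The pairs \<open>(hor e, ver e)\<close> and \<open>(ver e, - hor e)\<close> contribute equally,
  which absorbs the factor 1/2.\<close>

lemma lee_trace:
  assumes z: "z \<in> TV" and B: "is_onb (H z) B" and E: "is_onb (G (fst z)) E"
  defines "x \<equiv> fst z"
  shows "(\<Sum>e\<in>B. pd (\<lambda>y. \<Omega> y e (J z \<zeta>)) z e - \<Omega> z (\<Lambda> z e e) (J z \<zeta>) - \<Omega> z e (\<Lambda> z e (J z \<zeta>))) =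
    (\<Sum>e\<in>E. G x e (\<gamma> x (fst \<zeta>) e) - G x (fst \<zeta>) (\<gamma> x e e))"
proof -
  interpret ah: almost_hermitian_rep TV H J \<Lambda>
    by (rule almost_hermitian_rep.intro)
       (fact smooth_bil_H posdef_H J_linear J_smooth J_square J_isometry \<Lambda> \<Lambda>_sym \<Lambda>_metric)+
  have Om: "ah.Om = \<Omega>" by (simp add: fun_eq_iff ah.Om_def \<Omega>_def)
  have dOm: "ah.dOm = d\<Omega>" by (simp add: fun_eq_iff ah.dOm_def d\<Omega>_def Om)
  have fz: "x \<in> V" using z by (auto simp: x_def)
  have finE: "finite E" and cardE: "card E = DIM('e)"
    and onE: "\<And>b c. b \<in> E \<Longrightarrow> c \<in> E \<Longrightarrow> G x b c = (if b = c then 1 else 0)"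
    using E by (auto simp: is_onb_def x_def)
  define hor where "hor e = (e, - \<Gamma> x e (snd z))" for e
  define ver where "ver e = (0 :: 'e, e :: 'e)" for e
  have hor: "fst (hor e) = e" "vert z (hor e) = 0" for e by (auto simp: hor_def vert_def x_def)
  have ver: "fst (ver e) = 0" "vert z (ver e) = e" for e
    by (auto simp: ver_def vert_def x_def[symmetric] \<Gamma>_simps[OF fz])
  have Jh: "J z (hor e) = ver e" and Jv: "J z (ver e) = - hor e" for e
    unfolding J_def hor ver by (auto simp: ver_def hor_def x_def[symmetric] \<Gamma>_simps[OF fz])
  \<comment> \<open>Indexing by a disjoint sum keeps the two copies of \<open>E\<close> apart, so
    that the count of basis vectors is twice the dimension.\<close>
  define F where "F i = (case i of Inl e \<Rightarrow> hor e | Inr e \<Rightarrow> ver e)" for i :: "'e + 'e"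
  have fin: "finite (E <+> E)" and card: "card (E <+> E) = DIM('e \<times> 'e)"
    using finE cardE by (auto simp: card_Plus)
  have on: "H z (F b) (F c) = (if b = c then 1 else 0)" if "b \<in> E <+> E" "c \<in> E <+> E" for b c
    using that onE by (auto simp: F_def H_def hor ver x_def[symmetric] G_simps[OF fz] split: if_splits)
  have F: "is_onb (H z) (F ` (E <+> E))" by (rule orthonormal_family_is_onb(1)[OF fin card on])
  have inj: "inj_on F (E <+> E)" by (rule orthonormal_family_is_onb(2)[OF fin card on])
  have "(\<Sum>e\<in>B. ah.nablaOm z e e (J z \<zeta>)) = (\<Sum>e\<in>B. d\<Omega> z e (J z e) \<zeta>) / 2"
    using ah.trace_nablaOm[OF z B] by (simp add: dOm)
  also have "(\<Sum>e\<in>B. d\<Omega> z e (J z e) \<zeta>) = (\<Sum>e\<in>F ` (E <+> E). d\<Omega> z e (J z e) \<zeta>)"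
    using trace_is_onb_eq[OF posdef_H[OF z] B F ah.dOm_J_bilinear[OF z]] by (simp add: dOm)
  also have "\<dots> = (\<Sum>e\<in>E. d\<Omega> z (hor e) (ver e) \<zeta>) + (\<Sum>e\<in>E. d\<Omega> z (ver e) (- hor e) \<zeta>)"
    unfolding sum.reindex[OF inj] using finE by (simp add: sum.Plus F_def Jh Jv)
  also have "\<dots> = (\<Sum>e\<in>E. 2 * (G x e (\<gamma> x (fst \<zeta>) e) - G x (fst \<zeta>) (\<gamma> x e e)))"
    unfolding sum.distrib[symmetric]
  proof (rule sum.cong[OF refl])
    fix e
    note gz = bilinear_lzero[OF smooth_bil_bilinear[OF smooth_bil_\<gamma> fz]]
      bilinear_rzero[OF smooth_bil_bilinear[OF smooth_bil_\<gamma> fz]]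
      bilinear_lneg[OF smooth_bil_bilinear[OF smooth_bil_\<gamma> fz]]
    show "d\<Omega> z (hor e) (ver e) \<zeta> + d\<Omega> z (ver e) (- hor e) \<zeta> =
      2 * (G x e (\<gamma> x (fst \<zeta>) e) - G x (fst \<zeta>) (\<gamma> x e e))"
      unfolding d\<Omega>_eq[OF z] x_def[symmetric]
      by (simp add: hor ver linear_neg[OF vert_linear[OF z]] gz G_simps[OF fz])
  qed
  finally show ?thesis
    unfolding sum_distrib_left[symmetric] ah.nablaOm_def Om by simp
qed

text \<open>The pullback of the form dual to \<open>\<rho>\<close> is, at \<open>z\<close>, dual
  under \<open>H z\<close> to the horizontal lift \<open>T\<close> of \<open>\<rho>\<close>. The
  symbol thus occurs only as \<open>H z T (\<Lambda> z k \<eta>)\<close>, and the Koszul formula on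
  constant coordinate vectors replaces it by derivatives of \<open>H\<close>.\<close>

lemma nabla_theta:
  assumes z: "z \<in> TV" and \<rho>: "smooth_on \<rho> V"
  defines "x \<equiv> fst z"
  shows "pd (\<lambda>y. G (fst y) (\<rho> (fst y)) (fst \<eta>)) z k - G x (\<rho> x) (fst (\<Lambda> z k \<eta>)) =
    G x (pd \<rho> x (fst k) + \<Delta> x (fst k) (\<rho> x)) (fst \<eta>) +
    (G x (\<gamma> x (\<rho> x) (vert z k)) (vert z \<eta>) + G x (vert z k) (\<gamma> x (\<rho> x) (vert z \<eta>))) / 2"
proof -
  have fz: "x \<in> V" using z by (auto simp: x_def)
  define T where "T = (\<rho> x, - \<Gamma> x (\<rho> x) (snd z))"
  have T: "fst T = \<rho> x" "vert z T = 0" by (auto simp: T_def vert_def x_def)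
  have pH: "pd (\<lambda>y. H y \<zeta> \<eta>) z k = G x (\<Delta> x (fst k) (fst \<zeta>)) (fst \<eta>) + G x (fst \<zeta>) (\<Delta> x (fst k) (fst \<eta>))
      + G x (\<Delta> x (fst k) (vert z \<zeta>)) (vert z \<eta>) + G x (vert z \<zeta>) (\<Delta> x (fst k) (vert z \<eta>))
      + G x (dvert z \<zeta> k) (vert z \<eta>) + G x (vert z \<zeta>) (dvert z \<eta> k)" for \<zeta> \<eta> k
  proof -
    note d1 = has_derivative_fst_family[OF smooth_bil_differentiable[OF G fz, unfolded x_def], of "fst \<zeta>" "fst \<eta>", folded x_def]
    note d2 = has_derivative_bil_fst[OF G z vert_has_derivative[OF z] vert_has_derivative[OF z], of \<zeta> \<eta>, folded x_def]
    show ?thesis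
      unfolding H_def using pd_eq[OF has_derivative_add[OF d1 d2], of k] by (simp add: \<Delta>_metric[OF fz])
  qed
  \<comment> \<open>The derivative of the vertical part of \<open>T\<close> along \<open>k\<close>
    becomes that of \<open>k\<close> along \<open>T\<close>, which cancels in the last Koszul term.
    As \<open>T\<close> is horizontal, a single \<open>\<Gamma>\<close> term remains and combines
    with \<open>\<Delta>\<close> to \<open>\<gamma>\<close>.\<close>
  have Tzero: "dvert z T k = dvert z k T + \<Gamma> x (\<rho> x) (vert z k)" for k
    using dvert_swap[OF z, of T k] by (simp add: T x_def[symmetric] \<Gamma>_simps[OF fz])
  have HT: "G x (\<rho> x) (fst \<xi>) = H z T \<xi>" for \<xi>
    by (simp add: H_def T x_def[symmetric] G_simps[OF fz])
  note Hsym = posdefD(2)[OF posdef_H[OF z]]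
  have "2 * H z T (\<Lambda> z k \<eta>) = pd (\<lambda>y. H y \<eta> T) z k + pd (\<lambda>y. H y k T) z \<eta> - pd (\<lambda>y. H y k \<eta>) z T"
    unfolding \<Lambda>_metric[OF z]
    using \<Lambda>_sym[OF z, of k \<eta>] \<Lambda>_sym[OF z, of k T] \<Lambda>_sym[OF z, of \<eta> T] Hsym[of T "\<Lambda> z \<eta> k"]
      Hsym[of \<eta> "\<Lambda> z T k"] Hsym[of k "\<Lambda> z T \<eta>"] by simp
  also have "\<dots> = 2 * G x (\<rho> x) (\<Delta> x (fst k) (fst \<eta>)) -
      (G x (\<gamma> x (\<rho> x) (vert z k)) (vert z \<eta>) + G x (vert z k) (\<gamma> x (\<rho> x) (vert z \<eta>)))"
    unfolding pH T Tzero
    using \<Delta>_sym[OF fz, of "fst \<eta>" "fst k"] \<Delta>_sym[OF fz, of "\<rho> x"]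
      G_sym[OF fz, of "\<Delta> x (fst k) (fst \<eta>)" "\<rho> x"] G_sym[OF fz, of "fst \<eta>"]
      G_sym[OF fz, of "vert z \<eta>"]
    by (simp add: \<gamma>_def G_simps[OF fz] \<Delta>_simps[OF fz] algebra_simps)
  finally have L: "2 * G x (\<rho> x) (fst (\<Lambda> z k \<eta>)) = \<dots>" unfolding HT .
  have dG: "((\<lambda>y. G y (\<rho> y) (fst \<eta>)) has_derivative (\<lambda>v. pd (\<lambda>y. G y (\<rho> x) (fst \<eta>)) x v +
      G x (pd \<rho> x v) (fst \<eta>) + G x (\<rho> x) 0)) (at x)"
    using has_derivative_smooth_bil[OF G fz smooth_on_has_derivative[OF \<rho> fz] has_derivative_const, of "fst \<eta>"] .
  have "pd (\<lambda>y. G (fst y) (\<rho> (fst y)) (fst \<eta>)) z k = pd (\<lambda>y. G y (\<rho> y) (fst \<eta>)) x (fst k)"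
    using pd_eq[OF has_derivative_fst_family[OF differentiableI[OF dG[unfolded x_def]]]] by (simp add: x_def)
  also have "\<dots> = G x (\<Delta> x (fst k) (\<rho> x)) (fst \<eta>) + G x (\<rho> x) (\<Delta> x (fst k) (fst \<eta>)) + G x (pd \<rho> x (fst k)) (fst \<eta>)"
    using pd_eq[OF dG] by (simp add: \<Delta>_metric[OF fz] G_simps[OF fz])
  finally show ?thesis using L by (simp add: G_simps[OF fz] field_simps)
qed

end

end

section \<open>Affine-Riemann manifolds\<close>

locale affine_riemann = atlas A for A :: "('a, 'e::euclidean_space) chart set" +
  fixes nabla :: "('a \<Rightarrow> 'e) \<Rightarrow> ('a \<Rightarrow> 'e) \<Rightarrow> 'a \<Rightarrow> 'e" and g :: "'a \<Rightarrow> 'e \<Rightarrow> 'e \<Rightarrow> real"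
  assumes affine_riemann: "affine_riemann_manifold A nabla g"
begin

lemma hausdorff: "Hausdorff_space (manifold_topology A)"
  and N: "connection A nabla" and flat: "flat_connection A nabla" and torsion: "torsion_free A nabla"
  and g: "riemannian_metric A g"
  using affine_riemann by (auto simp: affine_riemann_manifold_def smooth_manifold_def)

abbreviation D where "D \<equiv> levi_civita A g"
abbreviation TA where "TA \<equiv> tangent_atlas A"
abbreviation gT where "gT \<equiv> g1 A nabla g"
abbreviation JT where "JT \<equiv> J1 A nabla"
abbreviation DT where "DT \<equiv> levi_civita TA gT"
abbreviation ch where "ch c \<equiv> tchart A c"

lemmas D_props = levi_civita_props[OF g]

interpretation T: atlas "tangent_atlas A"
  by (rule atlas_tangent_atlas)

lemma rep:
  assumes c: "c \<in> A"
  shows "affine_riemann_rep (snd c ` fst c) (metric_rep A g c) (christoffel A nabla c) (christoffel A D c)"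
  by (rule affine_riemann_rep.intro)
     (fact smooth_bil_metric_rep[OF g c] posdef_metric_rep[OF g c] smooth_bil_christoffel[OF N c]
        christoffel_symmetric[OF N torsion c] christoffel_flat[OF N flat c] smooth_bil_christoffel[OF D_props(1) c]
        christoffel_symmetric[OF D_props(1,2) c] metric_christoffel[OF D_props(1,3) g c])+

abbreviation G where "G c \<equiv> metric_rep A g c"
abbreviation \<Gamma> where "\<Gamma> c \<equiv> christoffel A nabla c"
abbreviation \<Delta> where "\<Delta> c \<equiv> christoffel A D c"
abbreviation vertc where "vertc c \<equiv> affine_riemann_rep.vert (\<Gamma> c)"
abbreviation Hc where "Hc c \<equiv> affine_riemann_rep.H (G c) (\<Gamma> c)"
abbreviation Jc where "Jc c \<equiv> affine_riemann_rep.J (\<Gamma> c)"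
abbreviation Oc where "Oc c \<equiv> affine_riemann_rep.\<Omega> (G c) (\<Gamma> c)"
abbreviation dOc where "dOc c \<equiv> affine_riemann_rep.d\<Omega> (G c) (\<Gamma> c)"
abbreviation gam where "gam c \<equiv> affine_riemann_rep.\<gamma> (\<Gamma> c) (\<Delta> c)"

lemma ch_image: "c \<in> A \<Longrightarrow> snd (ch c) ` fst (ch c) = (snd c ` fst c) \<times> UNIV"
  using tchart_image[of c "fst c"] by simp

lemma ch_point: "c \<in> A \<Longrightarrow> P \<in> fst (ch c) \<Longrightarrow> snd (ch c) P \<in> (snd c ` fst c) \<times> UNIV"
  using ch_image by blast

section \<open>The Hermitian structure of the tangent bundle in induced charts\<close>

lemma g1_rep:
  assumes c: "c \<in> A" and P: "P \<in> fst (ch c)"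
  shows "gT P \<zeta> \<eta> = Hc c (snd (ch c) P) (vec_coord TA (ch c) P \<zeta>) (vec_coord TA (ch c) P \<eta>)"
proof -
  interpret R: affine_riemann_rep "snd c ` fst c" "G c" "\<Gamma> c" "\<Delta> c" by (rule rep[OF c])
  obtain p u where P': "P = (p, u)" "p \<in> fst c" using P by (cases P) auto
  have "gT P (chart_vec TA (ch c) P \<zeta>') (chart_vec TA (ch c) P \<eta>') = R.H (snd (ch c) P) \<zeta>' \<eta>'" for \<zeta>' \<eta>'
    using g1_in_chart[OF N c P'(2), of g u "fst \<zeta>'" "snd \<zeta>'" "fst \<eta>'" "snd \<eta>'"]
    by (simp add: P' R.H_def R.vert_def)
  from this[of "vec_coord TA (ch c) P \<zeta>" "vec_coord TA (ch c) P \<eta>"] show ?thesis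
    using T.chart_vec_vec_coord[OF tchart_in[OF c] P] by simp
qed

lemma J1_rep:
  assumes c: "c \<in> A" and P: "P \<in> fst (ch c)"
  shows "vec_coord TA (ch c) P (JT P \<zeta>) = Jc c (snd (ch c) P) (vec_coord TA (ch c) P \<zeta>)"
proof -
  interpret R: affine_riemann_rep "snd c ` fst c" "G c" "\<Gamma> c" "\<Delta> c" by (rule rep[OF c])
  obtain p u where P': "P = (p, u)" "p \<in> fst c" using P by (cases P) auto
  have "JT P (chart_vec TA (ch c) P \<zeta>') = chart_vec TA (ch c) P (R.J (snd (ch c) P) \<zeta>')" for \<zeta>'
    using J1_in_chart[OF N c P'(2), of u "fst \<zeta>'" "snd \<zeta>'"] by (simp add: P' R.J_def R.vert_def)
  from this[of "vec_coord TA (ch c) P \<zeta>"] show ?thesis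
    using T.chart_vec_vec_coord[OF tchart_in[OF c] P] T.vec_coord_chart_vec[OF tchart_in[OF c] P] by simp
qed

lemma form_rep:
  assumes c: "c \<in> A" and P: "P \<in> fst (ch c)"
  shows "fundamental_form JT gT P \<zeta> \<eta> =
    Oc c (snd (ch c) P) (vec_coord TA (ch c) P \<zeta>) (vec_coord TA (ch c) P \<eta>)"
proof -
  interpret R: affine_riemann_rep "snd c ` fst c" "G c" "\<Gamma> c" "\<Delta> c" by (rule rep[OF c])
  show ?thesis unfolding fundamental_form_def g1_rep[OF c P] J1_rep[OF c P] R.\<Omega>_def ..
qed

lemma TA_chart: "d \<in> TA \<Longrightarrow> \<exists>c\<in>A. d = ch c"
  by (auto simp: tangent_atlas_eq)

lemma TA_point:
  assumes "P \<in> points TA"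
  obtains c where "c \<in> A" "P \<in> fst (ch c)" "ch c = chart_at TA P"
  using T.chart_at_props[OF assms] TA_chart by metis

text \<open>Required for the existence of a Levi-Civita connection of \<open>gT\<close>, and hence
  for every property of \<open>DT\<close>.\<close>

lemma g1_riemannian: "riemannian_metric TA gT"
  unfolding riemannian_metric_def
proof (rule conjI)
  show "\<forall>P\<in>points TA. bilinear (gT P) \<and> (\<forall>u v. gT P u v = gT P v u) \<and> (\<forall>u. u \<noteq> 0 \<longrightarrow> 0 < gT P u u)"
  proof
    fix P assume "P \<in> points TA"
    then obtain c where c: "c \<in> A" "P \<in> fst (ch c)" "ch c = chart_at TA P" by (rule TA_point)
    interpret R: affine_riemann_rep "snd c ` fst c" "G c" "\<Gamma> c" "\<Delta> c" by (rule rep[OF c(1)])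
    have "gT P = R.H (snd (ch c) P)"
      using T.vec_coord_chart_at[OF \<open>P \<in> points TA\<close>] g1_rep[OF c(1,2)] by (simp add: c(3) fun_eq_iff)
    then show "bilinear (gT P) \<and> (\<forall>u v. gT P u v = gT P v u) \<and> (\<forall>u. u \<noteq> 0 \<longrightarrow> 0 < gT P u u)"
      using R.posdef_H[OF ch_point[OF c(1,2)]] by (simp add: posdef_def)
  qed
  show "\<forall>W X Y. open_subset TA W \<and> vector_field TA W X \<and> vector_field TA W Y \<longrightarrow> smooth_fun TA W (\<lambda>p. gT p (X p) (Y p))"
  proof (intro allI impI; elim conjE)
    fix W X Y assume W: "open_subset TA W" and X: "vector_field TA W X" and Y: "vector_field TA W Y"
    show "smooth_fun TA W (\<lambda>p. gT p (X p) (Y p))"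
      unfolding smooth_fun_def
    proof
      fix d assume d: "d \<in> TA"
      then obtain c where c: "c \<in> A" "d = ch c" using TA_chart by blast
      interpret R: affine_riemann_rep "snd c ` fst c" "G c" "\<Gamma> c" "\<Delta> c" by (rule rep[OF c(1)])
      let ?S = "snd d ` (W \<inter> fst d)"
      have S: "open ?S" by (rule T.open_subset_image[OF W d])
      have sub: "?S \<subseteq> (snd c ` fst c) \<times> UNIV" using ch_image[OF c(1)] c(2) by blast
      have H: "smooth_bil R.H ?S"
        by (rule smooth_bil_subset[OF R.smooth_bil_H S sub])
      show "smooth_on ((\<lambda>p. gT p (X p) (Y p)) \<circ> chart_inv d) ?S"
      proof (rule smooth_on_cong[OF smooth_bil_apply[OF H T.vector_field_smooth_rep[OF X d] T.vector_field_smooth_rep[OF Y d]] S])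
        fix z assume "z \<in> ?S"
        then obtain Q where Q: "Q \<in> fst d" "z = snd d Q" by auto
        then show "R.H z (field_rep TA d X z) (field_rep TA d Y z) = ((\<lambda>p. gT p (X p) (Y p)) \<circ> chart_inv d) z"
          using g1_rep[OF c(1), of Q] d c by (simp add: T.field_rep_at)
      qed
    qed
  qed
qed

lemmas DT_props = T.levi_civita_props[OF g1_riemannian]

abbreviation \<Lambda> where "\<Lambda> c \<equiv> christoffel TA DT (ch c)"

lemma \<Lambda>_props:
  assumes c: "c \<in> A"
  shows "smooth_bil (\<Lambda> c) ((snd c ` fst c) \<times> UNIV)"
    and "z \<in> (snd c ` fst c) \<times> UNIV \<Longrightarrow> \<Lambda> c z \<zeta> \<eta> = \<Lambda> c z \<eta> \<zeta>"
    and "z \<in> (snd c ` fst c) \<times> UNIV \<Longrightarrow>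
      pd (\<lambda>y. Hc c y \<zeta> \<eta>) z k = Hc c z (\<Lambda> c z k \<zeta>) \<eta> + Hc c z \<zeta> (\<Lambda> c z k \<eta>)"
proof -
  interpret R: affine_riemann_rep "snd c ` fst c" "G c" "\<Gamma> c" "\<Delta> c" by (rule rep[OF c])
  have tc: "ch c \<in> TA" by (rule tchart_in[OF c])
  show "smooth_bil (\<Lambda> c) ((snd c ` fst c) \<times> UNIV)"
    using T.smooth_bil_christoffel[OF DT_props(1) tc] by (simp only: ch_image[OF c])
  show "\<Lambda> c z \<zeta> \<eta> = \<Lambda> c z \<eta> \<zeta>" if "z \<in> (snd c ` fst c) \<times> UNIV"
    using T.christoffel_symmetric[OF DT_props(1,2) tc, unfolded ch_image[OF c], OF that] .
  have m: "metric_rep TA gT (ch c) z \<zeta> \<eta> = R.H z \<zeta> \<eta>" if "z \<in> (snd c ` fst c) \<times> UNIV" for z \<zeta> \<eta>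
  proof -
    have "z \<in> snd (ch c) ` fst (ch c)" using that by (simp only: ch_image[OF c])
    then obtain P where P: "P \<in> fst (ch c)" "z = snd (ch c) P" by (elim imageE)
    show ?thesis
      unfolding P(2) T.metric_rep_at(1)[OF tc P(1)] g1_rep[OF c P(1)] T.vec_coord_chart_vec[OF tc P(1)] ..
  qed
  assume z: "z \<in> (snd c ` fst c) \<times> UNIV"
  have "pd (\<lambda>y. R.H y \<zeta> \<eta>) z k = pd (\<lambda>y. metric_rep TA gT (ch c) y \<zeta> \<eta>) z k"
    by (rule pd_cong_open[OF R.TV_open z])
       (use m smooth_bil_differentiable[OF T.smooth_bil_metric_rep[OF g1_riemannian tc, unfolded ch_image[OF c]] z] in auto)
  then show "pd (\<lambda>y. Hc c y \<zeta> \<eta>) z k = Hc c z (\<Lambda> c z k \<zeta>) \<eta> + Hc c z \<zeta> (\<Lambda> c z k \<eta>)"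
    using T.metric_christoffel[OF DT_props(1,3) g1_riemannian tc, unfolded ch_image[OF c], OF z, of \<zeta> \<eta> k] m[OF z] by simp
qed

lemma ext_deriv_rep:
  assumes c: "c \<in> A" and P: "P \<in> fst (ch c)"
    and X: "vector_field TA (points TA) X" and Y: "vector_field TA (points TA) Y" and Z: "vector_field TA (points TA) Z"
  defines "z \<equiv> snd (ch c) P"
  shows "ext_deriv_2form TA (fundamental_form JT gT) X Y Z P =
    dOc c z (vec_coord TA (ch c) P (X P)) (vec_coord TA (ch c) P (Y P)) (vec_coord TA (ch c) P (Z P))"
proof -
  interpret R: affine_riemann_rep "snd c ` fst c" "G c" "\<Gamma> c" "\<Delta> c" by (rule rep[OF c])
  have tc: "ch c \<in> TA" by (rule tchart_in[OF c])
  have B: "smooth_bil R.\<Omega> (snd (ch c) ` fst (ch c))"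
    using R.smooth_bil_\<Omega> by (simp only: ch_image[OF c])
  note skew = R.\<Omega>_skew[OF ch_point[OF c P]]
  show ?thesis
    unfolding R.d\<Omega>_def z_def T.field_rep_at[OF tc P, symmetric]
    by (rule T.ext_deriv_2form_in_chart[OF T.open_subset_points T.in_points[OF tc P] tc P B skew form_rep[OF c] X Y Z])
qed

text \<open>The fields \<open>const_ext\<close> have constant coordinates in the preferred chart but
  not in \<open>c\<close>. Their derivatives in \<open>c\<close> enter both connections equally and
  cancel in the difference.\<close>

lemma difference_tensor_rep:
  assumes c: "c \<in> A" "p \<in> fst c"
  shows "vec_coord A c p (difference_tensor A nabla g p u v) = gam c (snd c p) (vec_coord A c p u) (vec_coord A c p v)"
proof -
  interpret R: affine_riemann_rep "snd c ` fst c" "G c" "\<Gamma> c" "\<Delta> c" by (rule rep[OF c(1)])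
  let ?d = "chart_at A p"
  have d: "?d \<in> A" "p \<in> fst ?d" using chart_at_props[OF in_points[OF c]] .
  have cv: "vector_field A (fst ?d) (const_ext A p u)" for u
    unfolding const_ext_eq by (rule vector_field_chart_vec_const[OF d(1)])
  have val: "const_ext A p u p = u" for u
    using chart_vec_vec_coord[OF d, of u] vec_coord_chart_at[OF in_points[OF c]] by (simp add: const_ext_eq)
  show ?thesis
    unfolding difference_tensor_def linear_diff[OF linear_vec_coord[OF c]]
      connection_in_chart[OF N open_subset_fst[OF d(1)] d(2) c cv cv]
      connection_in_chart[OF D_props(1) open_subset_fst[OF d(1)] d(2) c cv cv]
    using c by (simp add: field_rep_at val R.\<gamma>_def)
qed

lemma difference_tensor_linear:
  assumes p: "p \<in> points A"
  shows "linear (difference_tensor A nabla g p u)"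
proof -
  let ?c = "chart_at A p"
  have c: "?c \<in> A" "p \<in> fst ?c" using chart_at_props[OF p] .
  interpret R: affine_riemann_rep "snd ?c ` fst ?c" "G ?c" "\<Gamma> ?c" "\<Delta> ?c" by (rule rep[OF c(1)])
  have "difference_tensor A nabla g p u = R.\<gamma> (snd ?c p) u"
    using difference_tensor_rep[OF c, of u] vec_coord_chart_at[OF p] by (simp add: fun_eq_iff)
  then show ?thesis using smooth_bil_linear(1)[OF R.smooth_bil_\<gamma>] c by simp
qed

lemma difference_tensor_adj:
  assumes p: "p \<in> points A"
  shows "g p (difference_tensor_adj A nabla g p u v) z = g p v (difference_tensor A nabla g p u z)"
proof -
  note P = riemannian_posdef[OF g p]
  have "linear (\<lambda>z. g p v (difference_tensor A nabla g p u z))"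
    using linear_compose[OF difference_tensor_linear[OF p], of "g p v"] posdefD(1)[OF P]
    by (auto simp: o_def bilinear_def)
  from theI'[OF posdef_solve[OF P this]] show ?thesis
    unfolding difference_tensor_adj_def by blast
qed

lemma theta0_eq:
  assumes p: "p \<in> points A"
  shows "theta0 A nabla g p v = (\<Sum>e\<in>onb g p. g p e (difference_tensor A nabla g p e v) -
    g p (difference_tensor A nabla g p e e) v)"
  by (simp add: theta0_def koszul_alpha_def koszul_xi_def metric_trace_def difference_tensor_adj[OF p]
      bilinear_sum_left[OF posdefD(1)[OF riemannian_posdef[OF g p]]] sum_subtractf)

lemma Pi_field_dual:
  assumes p: "p \<in> points A"
  shows "g p (Pi_field A nabla g p) v = theta0 A nabla g p v"
  by (simp add: theta0_eq[OF p] Pi_field_def metric_trace_def difference_tensor_adj[OF p]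
      bilinear_sum_left[OF posdefD(1)[OF riemannian_posdef[OF g p]]]
      bilinear_lsub[OF posdefD(1)[OF riemannian_posdef[OF g p]]])

lemma onb_rep:
  assumes c: "c \<in> A" "p \<in> fst c"
  shows "is_onb (G c (snd c p)) (vec_coord A c p ` onb g p)" "inj_on (vec_coord A c p) (onb g p)"
proof -
  have p: "p \<in> points A" by (rule in_points[OF c])
  note o = is_onb_onb[of g p, OF riemannian_posdef[OF g p], unfolded is_onb_def]
  have *: "finite (onb g p)" "card (onb g p) = DIM('e)" using o by auto
  have "G c (snd c p) (vec_coord A c p b) (vec_coord A c p b') = (if b = b' then 1 else 0)"
    if "b \<in> onb g p" "b' \<in> onb g p" for b b'
    using o that metric_rep_at(2)[OF c, of g] by simp
  note on = this
  show "is_onb (G c (snd c p)) (vec_coord A c p ` onb g p)"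
    by (rule orthonormal_family_is_onb(1)[of _ "G c (snd c p)" "vec_coord A c p"]) (fact * on)+
  show "inj_on (vec_coord A c p) (onb g p)"
    by (rule orthonormal_family_is_onb(2)[of _ "G c (snd c p)" "vec_coord A c p"]) (fact * on)+
qed

lemma theta0_rep:
  assumes c: "c \<in> A" "p \<in> fst c"
  defines "x \<equiv> snd c p"
  shows "theta0 A nabla g p v = (\<Sum>e\<in>vec_coord A c p ` onb g p.
    G c x e (gam c x (vec_coord A c p v) e) - G c x (vec_coord A c p v) (gam c x e e))"
proof -
  interpret R: affine_riemann_rep "snd c ` fst c" "G c" "\<Gamma> c" "\<Delta> c" by (rule rep[OF c(1)])
  have x: "x \<in> snd c ` fst c" using c by (simp add: x_def)
  show ?thesis
    unfolding theta0_eq[OF in_points[OF c]] metric_rep_at(2)[OF c] difference_tensor_rep[OF c] x_def[symmetric]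
    using R.\<gamma>_sym[OF x] R.G_sym[OF x] by (simp add: sum.reindex[OF onb_rep(2)[OF c]])
qed

abbreviation \<rho> where "\<rho> c \<equiv> field_rep A c (Pi_field A nabla g)"

lemma \<rho>_dual:
  assumes c: "c \<in> A" "p \<in> fst c"
  shows "theta0 A nabla g p v = G c (snd c p) (\<rho> c (snd c p)) (vec_coord A c p v)"
  using Pi_field_dual[OF in_points[OF c], of v] metric_rep_at(2)[OF c, of g] c by (simp add: field_rep_at)

text \<open>\<open>\<rho> c\<close> has the same pairings as the smooth field of
  \<open>smooth_theta_dual\<close>, hence equals it; the uncontrolled choice of \<open>onb\<close>
  does no harm.\<close>

lemma \<rho>_smooth:
  assumes c: "c \<in> A"
  shows "smooth_on (\<rho> c) (snd c ` fst c)"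
proof -
  interpret R: affine_riemann_rep "snd c ` fst c" "G c" "\<Gamma> c" "\<Delta> c" by (rule rep[OF c])
  show ?thesis
  proof (rule R.smooth_theta_dual)
    fix \<rho>' assume \<rho>': "smooth_on \<rho>' (snd c ` fst c)"
      "\<And>x E a. x \<in> snd c ` fst c \<Longrightarrow> is_onb (G c x) E \<Longrightarrow>
        G c x (\<rho>' x) a = (\<Sum>e\<in>E. G c x e (R.\<gamma> x a e) - G c x a (R.\<gamma> x e e))"
    show ?thesis
    proof (rule smooth_on_cong[OF \<rho>'(1) R.V_open])
      fix x assume x: "x \<in> snd c ` fst c"
      then obtain p where p: "p \<in> fst c" "x = snd c p" by auto
      show "\<rho>' x = \<rho> c x"
      proof (rule posdef_eqI[OF R.G_pos[OF x]])
        show "G c x (\<rho>' x) a = G c x (\<rho> c x) a" for a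
          using \<rho>'(2)[OF x, of "vec_coord A c p ` onb g p" a] onb_rep(1)[OF c p(1)]
            theta0_rep[OF c p(1), of "chart_vec A c p a"] \<rho>_dual[OF c p(1), of "chart_vec A c p a"] c p by simp
      qed
    qed
  qed
qed

lemma vector_field_Pi: "vector_field A (points A) (Pi_field A nabla g)"
proof -
  have "points A \<inter> fst c = fst c" if "c \<in> A" for c using that in_points by blast
  then show ?thesis using \<rho>_smooth by (simp add: vector_field_iff)
qed

end

section \<open>The Lee form and its covariant derivative\<close>

context affine_riemann
begin

interpretation T: atlas "tangent_atlas A"
  by (rule atlas_tangent_atlas)

text \<open>Computed in the preferred chart at \<open>P\<close>, where the fields
  \<open>const_ext\<close> have constant coordinates and vectors are their own coordinates. The
  result no longer refers to that chart and can be expressed in all others.\<close>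

lemma lee_form_eq:
  assumes P: "P \<in> points TA"
  shows "lee_form TA JT gT P \<zeta> = theta0 A nabla g (fst P) (tangent_map TA A fst P \<zeta>)"
proof -
  obtain c where c: "c \<in> A" "P \<in> fst (ch c)" "ch c = chart_at TA P" using P by (rule TA_point)
  obtain p u where P': "P = (p, u)" "p \<in> fst c" using c(2) by (cases P) auto
  interpret R: affine_riemann_rep "snd c ` fst c" "G c" "\<Gamma> c" "\<Delta> c" by (rule rep[OF c(1)])
  have tc: "ch c \<in> TA" by (rule tchart_in[OF c(1)])
  let ?z = "snd (ch c) P"
  have z: "?z \<in> (snd c ` fst c) \<times> UNIV" by (rule ch_point[OF c(1,2)])
  have vc: "vec_coord TA (ch c) P \<eta> = \<eta>" for \<eta> using T.vec_coord_chart_at[OF P] by (simp add: c(3))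
  have om: "fundamental_form JT gT P \<eta> \<kappa> = R.\<Omega> ?z \<eta> \<kappa>" for \<eta> \<kappa>
    using form_rep[OF c(1,2)] vc by simp
  have ext: "const_ext TA P \<eta> = (\<lambda>Q. chart_vec TA (ch c) Q \<eta>)" for \<eta> by (simp add: const_ext_eq c(3))
  have cv: "vector_field TA (fst (ch c)) (\<lambda>Q. chart_vec TA (ch c) Q \<eta>)" for \<eta>
    by (rule T.vector_field_chart_vec_const[OF tc])
  have zi: "?z \<in> snd (ch c) ` fst (ch c)" using c(2) by blast
  have B: "smooth_bil R.\<Omega> (snd (ch c) ` fst (ch c))"
    using R.smooth_bil_\<Omega> by (simp only: ch_image[OF c(1)])
  have cov: "cov_deriv_2form TA DT (fundamental_form JT gT) (const_ext TA P \<eta>) (const_ext TA P \<kappa>) (const_ext TA P \<mu>) P =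
      pd (\<lambda>y. R.\<Omega> y \<kappa> \<mu>) ?z \<eta> - R.\<Omega> ?z (\<Lambda> c ?z \<eta> \<kappa>) \<mu> - R.\<Omega> ?z \<kappa> (\<Lambda> c ?z \<eta> \<mu>)" for \<eta> \<kappa> \<mu>
  proof -
    have val: "chart_vec TA (ch c) P \<eta> = \<eta>" for \<eta>
      using T.chart_vec_vec_coord[OF tc c(2), of \<eta>] vc by simp
    have chr: "DT (\<lambda>Q. chart_vec TA (ch c) Q \<eta>) (\<lambda>Q. chart_vec TA (ch c) Q \<kappa>) P = \<Lambda> c ?z \<eta> \<kappa>" for \<eta> \<kappa>
      using T.christoffel_at[OF tc c(2), of DT \<eta> \<kappa>] vc by simp
    have "dir_deriv TA (\<lambda>Q. chart_vec TA (ch c) Q \<eta>) (\<lambda>q. fundamental_form JT gT q (chart_vec TA (ch c) q \<kappa>) (chart_vec TA (ch c) q \<mu>)) P =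
        pd (\<lambda>y. R.\<Omega> y \<kappa> \<mu>) ?z \<eta>"
      using T.dir_deriv_tensor_in_chart[OF c(2) tc c(2) B form_rep[OF c(1)] cv cv, of "\<lambda>Q. chart_vec TA (ch c) Q \<eta>" \<kappa> \<mu>]
      by (simp only: T.pd_field_rep_chart_vec[OF tc zi] T.field_rep_chart_vec_const[OF tc zi]
          bilinear_lzero[OF smooth_bil_bilinear[OF B zi]] bilinear_rzero[OF smooth_bil_bilinear[OF B zi]] add_0_right)
    then show ?thesis
      unfolding cov_deriv_2form_def ext om val chr by simp
  qed
  have gH: "gT P = R.H ?z" using g1_rep[OF c(1,2)] vc by (simp add: fun_eq_iff)
  have onb: "is_onb (R.H ?z) (onb gT P)"
    using is_onb_onb[of gT P] R.posdef_H[OF z] by (simp add: gH)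
  have JR: "JT P \<zeta> = R.J ?z \<zeta>" using J1_rep[OF c(1,2)] vc by simp
  have fz: "fst ?z = snd c p" by (simp add: P')
  have "lee_form TA JT gT P \<zeta> = (\<Sum>e\<in>onb gT P. pd (\<lambda>y. R.\<Omega> y e (R.J ?z \<zeta>)) ?z e - R.\<Omega> ?z (\<Lambda> c ?z e e) (R.J ?z \<zeta>)
      - R.\<Omega> ?z e (\<Lambda> c ?z e (R.J ?z \<zeta>)))"
    by (simp only: lee_form_def codiff_2form_def cov JR minus_minus)
  also have "\<dots> = (\<Sum>e\<in>vec_coord A c p ` onb g p. G c (snd c p) e (R.\<gamma> (snd c p) (fst \<zeta>) e) - G c (snd c p) (fst \<zeta>) (R.\<gamma> (snd c p) e e))"
    using R.lee_trace[OF \<Lambda>_props[OF c(1)] z onb onb_rep(1)[OF c(1) P'(2), folded fz]] unfolding fz .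
  also have "\<dots> = theta0 A nabla g p (chart_vec A c p (fst \<zeta>))"
    using theta0_rep[OF c(1) P'(2), of "chart_vec A c p (fst \<zeta>)"] c P' by simp
  also have "chart_vec A c p (fst \<zeta>) = tangent_map TA A fst P \<zeta>"
    using tangent_map_fst_in_chart[OF c(1) P'(2), of u \<zeta>] vc by (simp add: P')
  finally show ?thesis by (simp add: P')
qed

lemma lee_form_rep:
  assumes c: "c \<in> A" and P: "P \<in> fst (ch c)"
  defines "x \<equiv> fst (snd (ch c) P)"
  shows "lee_form TA JT gT P \<zeta> = G c x (\<rho> c x) (fst (vec_coord TA (ch c) P \<zeta>))"
proof -
  obtain p u where P': "P = (p, u)" "p \<in> fst c" using P by (cases P) auto
  show ?thesis
    unfolding lee_form_eq[OF T.in_points[OF tchart_in[OF c] P]]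
    using tangent_map_fst_in_chart[OF c P'(2), of u \<zeta>] \<rho>_dual[OF c P'(2)] c P'
    by (simp add: x_def)
qed

text \<open>The derivative of the coordinates of \<open>Y\<close> occurs once in the derivative of
  the pairing and once in \<open>DT X Y\<close>, and cancels; what remains is
  \<open>nabla_theta\<close>.\<close>

lemma cov_deriv_lee_rep:
  assumes c: "c \<in> A" and P: "P \<in> fst (ch c)"
    and X: "vector_field TA (points TA) X" and Y: "vector_field TA (points TA) Y"
  defines "z \<equiv> snd (ch c) P"
  defines "x \<equiv> fst z" and "k \<equiv> vec_coord TA (ch c) P (X P)" and "\<eta> \<equiv> vec_coord TA (ch c) P (Y P)"
  shows "cov_deriv_1form TA DT (lee_form TA JT gT) X Y P =
    G c x (pd (\<rho> c) x (fst k) + \<Delta> c x (fst k) (\<rho> c x)) (fst \<eta>) +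
    (G c x (gam c x (\<rho> c x) (vertc c z k)) (vertc c z \<eta>) + G c x (vertc c z k) (gam c x (\<rho> c x) (vertc c z \<eta>))) / 2"
proof -
  interpret R: affine_riemann_rep "snd c ` fst c" "G c" "\<Gamma> c" "\<Delta> c" by (rule rep[OF c])
  have tc: "ch c \<in> TA" by (rule tchart_in[OF c])
  have z: "z \<in> R.TV" unfolding z_def by (rule ch_point[OF c P])
  have PT: "P \<in> points TA" by (rule T.in_points[OF tc P])
  define L where "L y \<kappa> = G c (fst y) (\<rho> c (fst y)) (fst \<kappa>)" for y \<kappa> :: "'e \<times> 'e"
  let ?Y = "field_rep TA (ch c) Y"
  have kX: "field_rep TA (ch c) X z = k" and \<eta>Y: "?Y z = \<eta>"
    using T.field_rep_at[OF tc P] by (auto simp: z_def k_def \<eta>_def)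
  have dY: "(?Y has_derivative pd ?Y z) (at z)"
    using T.field_rep_differentiable[OF Y tc PT P] by (simp add: z_def frechet_derivative_works)
  have Ll: "linear (L y)" if "y \<in> R.TV" for y
    using that by (auto intro!: linearI simp: L_def R.G_simps)
  have Lsm: "smooth_on (\<lambda>y. L y \<kappa>) R.TV" for \<kappa>
    unfolding L_def
    by (rule smooth_bil_apply[OF smooth_bil_prod_fst[OF R.G] smooth_on_prod_fst[OF \<rho>_smooth[OF c] R.V_open] smooth_on_const])
  have d: "((\<lambda>y. L y (?Y y)) has_derivative (\<lambda>v. pd (\<lambda>y. L y (?Y z)) z v + L z (pd ?Y z v))) (at z)"
    by (rule has_derivative_linear_family[OF R.TV_open z Ll smooth_on_differentiable[OF Lsm z] dY])
  have eq: "((\<lambda>Q. lee_form TA JT gT Q (Y Q)) \<circ> chart_inv (ch c)) y = L y (?Y y)" if "y \<in> R.TV" for y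
  proof -
    have "y \<in> snd (ch c) ` fst (ch c)" using that by (simp only: ch_image[OF c])
    then obtain Q where Q: "Q \<in> fst (ch c)" "y = snd (ch c) Q" by (elim imageE)
    show ?thesis
      unfolding Q(2) o_def T.chart_inv_chart[OF tc Q(1)] lee_form_rep[OF c Q(1)] T.field_rep_at[OF tc Q(1)] L_def ..
  qed
  have "dir_deriv TA X (\<lambda>Q. lee_form TA JT gT Q (Y Q)) P =
      pd ((\<lambda>Q. lee_form TA JT gT Q (Y Q)) \<circ> chart_inv (ch c)) z k"
    unfolding kX[symmetric] z_def
    by (rule T.dir_deriv_in_chart[OF tc P], rule differentiable_cong_open[OF R.TV_open _ eq])
       (use z differentiableI[OF d] in \<open>auto simp: z_def\<close>)
  also have "\<dots> = pd (\<lambda>y. L y (?Y y)) z k"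
    by (rule pd_cong_open[OF R.TV_open z eq differentiableI[OF d]])
  also have "\<dots> = pd (\<lambda>y. L y \<eta>) z k + L z (pd ?Y z k)"
    using pd_eq[OF d] by (simp add: \<eta>Y)
  finally have 1: "dir_deriv TA X (\<lambda>Q. lee_form TA JT gT Q (Y Q)) P = \<dots>" .
  have 2: "lee_form TA JT gT P (DT X Y P) = L z (pd ?Y z k + \<Lambda> c z k \<eta>)"
    unfolding lee_form_rep[OF c P] T.connection_in_chart[OF DT_props(1) T.open_subset_points PT tc P X Y] L_def
      z_def[symmetric] kX \<eta>Y ..
  have "cov_deriv_1form TA DT (lee_form TA JT gT) X Y P = pd (\<lambda>y. L y \<eta>) z k - L z (\<Lambda> c z k \<eta>)"
    unfolding cov_deriv_1form_def 1 2 linear_add[OF Ll[OF z]] by simp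
  also have "\<dots> = G c x (pd (\<rho> c) x (fst k) + \<Delta> c x (fst k) (\<rho> c x)) (fst \<eta>) +
    (G c x (gam c x (\<rho> c x) (vertc c z k)) (vertc c z \<eta>) + G c x (vertc c z k) (gam c x (\<rho> c x) (vertc c z \<eta>))) / 2"
    unfolding L_def x_def by (rule R.nabla_theta[OF \<Lambda>_props[OF c] z \<rho>_smooth[OF c]])
  finally show ?thesis .
qed

text \<open>Cutting off on the tangent bundle itself would call for its Hausdorff property. Instead
  the horizontal and vertical components of \<open>\<zeta>\<close> are extended to global fields on
  \<open>M\<close>, and the lifts of these are added.\<close>

lemma global_field_TA:
  assumes P: "P \<in> points TA"
  obtains X where "vector_field TA (points TA) X" "X P = \<zeta>"
proof -
  obtain c where c: "c \<in> A" "P \<in> fst (ch c)" "ch c = chart_at TA P" using P by (rule TA_point)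
  obtain p u where P': "P = (p, u)" "p \<in> fst c" using c(2) by (cases P) auto
  interpret R: affine_riemann_rep "snd c ` fst c" "G c" "\<Gamma> c" "\<Delta> c" by (rule rep[OF c(1)])
  have tc: "ch c \<in> TA" by (rule tchart_in[OF c(1)])
  let ?w = "vec_coord TA (ch c) P \<zeta>"
  note p = in_points[OF c(1) P'(2)]
  obtain X where X: "vector_field A (points A) X" "X p = chart_vec A c p (fst ?w)"
    using global_field_through[OF hausdorff p] .
  obtain Y where Y: "vector_field A (points A) Y" "Y p = chart_vec A c p (R.vert (snd (ch c) P) ?w)"
    using global_field_through[OF hausdorff p] .
  define Z where "Z Q = horizontal_lift A nabla Q (X (fst Q)) + vertical_lift A Q (Y (fst Q))" for Q
  have Zrep: "vec_coord TA (ch d) (q, v) (Z (q, v)) =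
      (vec_coord A d q (X q), - \<Gamma> d (snd d q) (vec_coord A d q (X q)) (vec_coord A d q v) + vec_coord A d q (Y q))"
    if d: "d \<in> A" "q \<in> fst d" for d q v
  proof -
    have Q: "(q, v) \<in> fst (ch d)" using d by simp
    show ?thesis
      unfolding Z_def fst_conv linear_add[OF T.linear_vec_coord[OF tchart_in[OF d(1)] Q]]
        horizontal_lift_in_chart[OF N d] vertical_lift_in_chart[OF d] T.vec_coord_chart_vec[OF tchart_in[OF d(1)] Q]
      by simp
  qed
  have "vector_field TA (points TA) Z"
    unfolding vector_field_iff
  proof
    fix d' assume d': "d' \<in> TA"
    then obtain d where d: "d \<in> A" "d' = ch d" using TA_chart by blast
    let ?V = "snd d ` fst d"
    have op: "open ?V" by (rule chart_image_open[OF d(1)])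
    then have opT: "open (?V \<times> (UNIV :: 'e set))" by (simp add: open_Times)
    have "points TA \<inter> fst (ch d) = fst (ch d)" using T.in_points[OF tchart_in[OF d(1)]] by blast
    then have im: "snd d' ` (points TA \<inter> fst d') = ?V \<times> UNIV"
      using ch_image[OF d(1)] d(2) by simp
    have "points A \<inter> fst d = fst d" using in_points[OF d(1)] by blast
    then have sX: "smooth_on (field_rep A d X) ?V" and sY: "smooth_on (field_rep A d Y) ?V"
      using vector_field_smooth_rep[OF X(1) d(1)] vector_field_smooth_rep[OF Y(1) d(1)] by auto
    note sX' = smooth_on_prod_fst[OF sX op, where 'b = 'e] and sY' = smooth_on_prod_fst[OF sY op, where 'b = 'e]
    have sm: "smooth_on (\<lambda>z::'e \<times> 'e. (field_rep A d X (fst z), - \<Gamma> d (fst z) (field_rep A d X (fst z)) (snd z) + field_rep A d Y (fst z))) (?V \<times> UNIV)"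
      by (rule smooth_on_Pair[OF sX' smooth_on_add[OF smooth_on_minus[OF smooth_bil_apply[OF
              smooth_bil_prod_fst[OF smooth_bil_christoffel[OF N d(1)]] sX' smooth_on_snd[OF smooth_on_id[OF opT] opT]] opT] sY' opT] opT])
    show "smooth_on (field_rep TA d' Z) (snd d' ` (points TA \<inter> fst d'))"
      unfolding im
    proof (rule smooth_on_cong[OF sm opT])
      fix z :: "'e \<times> 'e" assume "z \<in> ?V \<times> UNIV"
      then have "z \<in> snd (ch d) ` fst (ch d)" by (simp only: ch_image[OF d(1)])
      then obtain q v where q: "(q, v) \<in> fst (ch d)" "z = snd (ch d) (q, v)" by auto
      then have qd: "q \<in> fst d" by simp
      show "(field_rep A d X (fst z), - \<Gamma> d (fst z) (field_rep A d X (fst z)) (snd z) + field_rep A d Y (fst z)) = field_rep TA d' Z z"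
        unfolding q(2) d(2) T.field_rep_at[OF tchart_in[OF d(1)] q(1)] Zrep[OF d(1) qd]
        using field_rep_at[OF d(1) qd] by simp
    qed
  qed
  moreover have "Z P = \<zeta>"
  proof -
    have "vec_coord TA (ch c) P (Z P) = ?w"
      using Zrep[OF c(1) P'(2), of u] X(2) Y(2) c(1) P' by (simp add: R.vert_def)
    then show ?thesis using T.chart_vec_vec_coord[OF tc c(2)] by metis
  qed
  ultimately show ?thesis using that by blast
qed

text \<open>The star identity in coordinates after pairing with a third vector \<open>w\<close>,
  with \<open>\<theta>\<^sub>0\<close> expressed through its dual \<open>\<rho>\<close>.\<close>

definition star_at :: "('a, 'e) chart \<Rightarrow> 'e \<Rightarrow> bool" where
  "star_at c x \<longleftrightarrow> (\<forall>a b w. (real DIM('e) - 1) * (G c x b (gam c x a w) - G c x a (gam c x b w)) =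
     G c x (\<rho> c x) a * G c x b w - G c x (\<rho> c x) b * G c x a w)"

text \<open>Global fields realise every pair of vectors at a point, and by nondegeneracy a vector
  identity is the same as its pairings with all \<open>w\<close>.\<close>

lemma star_identity_iff:
  "(\<forall>X Y. vector_field A (points A) X \<and> vector_field A (points A) Y \<longrightarrow> star_identity A nabla g X Y) \<longleftrightarrow>
   (\<forall>c\<in>A. \<forall>x\<in>snd c ` fst c. star_at c x)" (is "?L \<longleftrightarrow> ?R")
proof -
  let ?n = "real DIM('e) - 1"
  let ?adj = "difference_tensor_adj A nabla g" and ?th = "theta0 A nabla g"
  have key: "(\<forall>v w. ?n *\<^sub>R (?adj p v w - ?adj p w v) = ?th p v *\<^sub>R w - ?th p w *\<^sub>R v) \<longleftrightarrow> star_at c (snd c p)"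
    if c: "c \<in> A" "p \<in> fst c" for c p
  proof -
    note p = in_points[OF c] and P = riemannian_posdef[OF g in_points[OF c]]
    note bl = posdefD(1)[OF P]
    have "?n *\<^sub>R (?adj p v w - ?adj p w v) = ?th p v *\<^sub>R w - ?th p w *\<^sub>R v \<longleftrightarrow>
      (\<forall>y. ?n * (g p w (difference_tensor A nabla g p v y) - g p v (difference_tensor A nabla g p w y)) =
        ?th p v * g p w y - ?th p w * g p v y)" (is "?l = ?r \<longleftrightarrow> _") for v w
    proof -
      have "?l = ?r \<longleftrightarrow> (\<forall>y. g p ?l y = g p ?r y)" using posdef_eqI[OF P] by metis
      then show ?thesis
        by (simp add: bilinear_lmul[OF bl] bilinear_lsub[OF bl] difference_tensor_adj[OF p])
    qed
    then have "(\<forall>v w. ?n *\<^sub>R (?adj p v w - ?adj p w v) = ?th p v *\<^sub>R w - ?th p w *\<^sub>R v) \<longleftrightarrow>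
      (\<forall>v w y. ?n * (g p w (difference_tensor A nabla g p v y) - g p v (difference_tensor A nabla g p w y)) =
        ?th p v * g p w y - ?th p w * g p v y)" by simp
    also have "\<dots> \<longleftrightarrow> star_at c (snd c p)"
      unfolding star_at_def metric_rep_at(2)[OF c, of g] difference_tensor_rep[OF c] \<rho>_dual[OF c]
      using vec_coord_chart_vec[OF c] by metis
    finally show ?thesis .
  qed
  show ?thesis
  proof
    assume L: ?L
    show ?R
    proof (intro ballI)
      fix c x assume c: "c \<in> A" and "x \<in> snd c ` fst c"
      then obtain p where p: "p \<in> fst c" "x = snd c p" by auto
      have "?n *\<^sub>R (?adj p v w - ?adj p w v) = ?th p v *\<^sub>R w - ?th p w *\<^sub>R v" for v w
      proof -
        obtain X where X: "vector_field A (points A) X" "X p = v"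
          using global_field_through[OF hausdorff in_points[OF c p(1)]] .
        obtain Y where Y: "vector_field A (points A) Y" "Y p = w"
          using global_field_through[OF hausdorff in_points[OF c p(1)]] .
        show ?thesis using L X Y in_points[OF c p(1)] unfolding star_identity_def by blast
      qed
      then show "star_at c x" using key[OF c p(1)] p by blast
    qed
  next
    assume R: ?R
    show ?L
      unfolding star_identity_def
    proof (intro allI impI ballI)
      fix X Y p assume p: "p \<in> points A"
      have "star_at (chart_at A p) (snd (chart_at A p) p)" using R chart_at_props[OF p] by blast
      then show "?n *\<^sub>R (?adj p (X p) (Y p) - ?adj p (Y p) (X p)) = ?th p (X p) *\<^sub>R Y p - ?th p (Y p) *\<^sub>R X p"
        using key[OF chart_at_props[OF p]] by blast
    qed
  qed
qed

text \<open>After multiplication by \<open>?n\<close> the condition equates two cyclic sums of the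
  expressions compared in \<open>star_at\<close>, with base components in the first two slots and a
  vertical component in the third. Two horizontal arguments and a vertical one leave a single
  summand of each.\<close>

lemma lck_iff:
  assumes n: "DIM('e) \<ge> 2"
  shows "locally_conformally_kaehler TA JT gT \<longleftrightarrow> (\<forall>c\<in>A. \<forall>x\<in>snd c ` fst c. star_at c x)" (is "?L \<longleftrightarrow> ?R")
proof -
  let ?n = "real DIM('e) - 1"
  have n0: "?n > 0" using n by simp
  \<comment> \<open>The real dimension of the tangent bundle is twice that of \<open>M\<close>, so
    the constant of the definition is \<open>1 / ?n\<close>.\<close>
  have dim: "1 / (real DIM('e \<times> 'e) / 2 - 1) = 1 / ?n" by simp
  let ?om = "fundamental_form JT gT" and ?th = "lee_form TA JT gT"
  have ext: "ext_deriv_2form TA ?om X Y Z P = 1 / ?n * wedge12 (?th P) (?om P) (X P) (Y P) (Z P) \<longleftrightarrow>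
      (let x = fst (snd (ch c) P); v = vertc c (snd (ch c) P);
        X' = vec_coord TA (ch c) P (X P); Y' = vec_coord TA (ch c) P (Y P); Z' = vec_coord TA (ch c) P (Z P);
        s = (\<lambda>a b w. ?n * (G c x b (gam c x a w) - G c x a (gam c x b w)));
        t = (\<lambda>a b w. G c x (\<rho> c x) a * G c x b w - G c x (\<rho> c x) b * G c x a w)
       in s (fst X') (fst Y') (v Z') + s (fst Y') (fst Z') (v X') + s (fst Z') (fst X') (v Y') =
          t (fst X') (fst Y') (v Z') + t (fst Y') (fst Z') (v X') + t (fst Z') (fst X') (v Y'))"
    if c: "c \<in> A" "P \<in> fst (ch c)" and X: "vector_field TA (points TA) X"
      and Y: "vector_field TA (points TA) Y" and Z: "vector_field TA (points TA) Z" for c P X Y Z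
  proof -
    interpret R: affine_riemann_rep "snd c ` fst c" "G c" "\<Gamma> c" "\<Delta> c" by (rule rep[OF c(1)])
    have z: "snd (ch c) P \<in> R.TV" by (rule ch_point[OF c])
    have eq: "d = 1 / ?n * w \<longleftrightarrow> ?n * d = w" for d w :: real using n0 by (simp add: field_simps)
    show ?thesis
      unfolding eq ext_deriv_rep[OF c X Y Z] R.d\<Omega>_eq[OF z] wedge12_def lee_form_rep[OF c] form_rep[OF c] R.\<Omega>_eq[OF z] Let_def
      by (simp add: algebra_simps)
  qed
  show ?thesis
  proof
    assume L: ?L
    show ?R
    proof (intro ballI)
      fix c x assume c: "c \<in> A" and x: "x \<in> snd c ` fst c"
      then obtain p where p: "p \<in> fst c" "x = snd c p" by auto
      interpret R: affine_riemann_rep "snd c ` fst c" "G c" "\<Gamma> c" "\<Delta> c" by (rule rep[OF c])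
      \<comment> \<open>At a zero vector the Christoffel term of \<open>vert\<close> vanishes, so
        \<open>(a, 0)\<close> is horizontal and \<open>(0, w)\<close> is vertical.\<close>
      define P where "P = (p, 0 :: 'e)"
      have P: "P \<in> fst (ch c)" using p by (simp add: P_def)
      note tc = tchart_in[OF c]
      have PT: "P \<in> points TA" by (rule T.in_points[OF tc P])
      have fP: "fst (snd (ch c) P) = x" and sP: "snd (snd (ch c) P) = 0"
        using linear_0[OF linear_vec_coord[OF c p(1)]] by (auto simp: P_def p)
      have v: "R.vert (snd (ch c) P) (a, b) = b" for a b
        by (simp add: R.vert_def fP sP R.\<Gamma>_simps[OF x])
      show "star_at c x"
        unfolding star_at_def
      proof (intro allI)
        fix a b w
        obtain X where X: "vector_field TA (points TA) X" "X P = chart_vec TA (ch c) P (a, 0)"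
          using global_field_TA[OF PT] .
        obtain Y where Y: "vector_field TA (points TA) Y" "Y P = chart_vec TA (ch c) P (b, 0)"
          using global_field_TA[OF PT] .
        obtain Z where Z: "vector_field TA (points TA) Z" "Z P = chart_vec TA (ch c) P (0, w)"
          using global_field_TA[OF PT] .
        have "ext_deriv_2form TA ?om X Y Z P = 1 / ?n * wedge12 (?th P) (?om P) (X P) (Y P) (Z P)"
          using L X(1) Y(1) Z(1) PT unfolding locally_conformally_kaehler_def dim by blast
        then show "?n * (G c x b (gam c x a w) - G c x a (gam c x b w)) =
            G c x (\<rho> c x) a * G c x b w - G c x (\<rho> c x) b * G c x a w"
          unfolding ext[OF c P X(1) Y(1) Z(1)] unfolding X(2) Y(2) Z(2) T.vec_coord_chart_vec[OF tc P] Let_def fP v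
          by (simp add: R.G_simps[OF x] bilinear_rzero[OF smooth_bil_bilinear[OF R.smooth_bil_\<gamma> x]])
      qed
    qed
  next
    assume R: ?R
    show ?L
      unfolding locally_conformally_kaehler_def dim
    proof (intro allI impI ballI; elim conjE)
      fix X Y Z P
      assume X: "vector_field TA (points TA) X" and Y: "vector_field TA (points TA) Y"
        and Z: "vector_field TA (points TA) Z" and PT: "P \<in> points TA"
      obtain c where c: "c \<in> A" "P \<in> fst (ch c)" using TA_point[OF PT] by blast
      have "star_at c (fst (snd (ch c) P))" using R c ch_point[OF c] by (auto simp: mem_Times_iff)
      then show "ext_deriv_2form TA ?om X Y Z P = 1 / ?n * wedge12 (?th P) (?om P) (X P) (Y P) (Z P)"
        unfolding ext[OF c X Y Z] star_at_def Let_def by simp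
    qed
  qed
qed

text \<open>Stated for an arbitrary connection because it is applied to both \<open>D\<close> and
  \<open>nabla\<close>.\<close>

lemma parallel_Pi_iff:
  assumes C: "connection A C"
  shows "parallel_field A C (Pi_field A nabla g) \<longleftrightarrow>
    (\<forall>c\<in>A. \<forall>x\<in>snd c ` fst c. \<forall>a. pd (\<rho> c) x a + christoffel A C c x a (\<rho> c x) = 0)" (is "?L \<longleftrightarrow> ?R")
proof -
  have key: "C X (Pi_field A nabla g) p = 0 \<longleftrightarrow>
      pd (\<rho> c) (snd c p) (vec_coord A c p (X p)) + christoffel A C c (snd c p) (vec_coord A c p (X p)) (\<rho> c (snd c p)) = 0"
    if c: "c \<in> A" "p \<in> fst c" and X: "vector_field A (points A) X" for c p X
  proof -
    have "C X (Pi_field A nabla g) p = 0 \<longleftrightarrow> vec_coord A c p (C X (Pi_field A nabla g) p) = 0"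
      using chart_vec_vec_coord[OF c] linear_0[OF linear_chart_vec[OF c]] linear_0[OF linear_vec_coord[OF c]] by metis
    then show ?thesis
      using connection_in_chart[OF C open_subset_points in_points[OF c] c X vector_field_Pi] c
      by (simp add: field_rep_at)
  qed
  show ?thesis
  proof
    assume L: ?L
    show ?R
    proof (intro ballI allI)
      fix c x a assume c: "c \<in> A" and "x \<in> snd c ` fst c"
      then obtain p where p: "p \<in> fst c" "x = snd c p" by auto
      obtain X where X: "vector_field A (points A) X" "X p = chart_vec A c p a"
        using global_field_through[OF hausdorff in_points[OF c p(1)]] .
      have "C X (Pi_field A nabla g) p = 0" using L X in_points[OF c p(1)] by (simp add: parallel_field_def)
      then show "pd (\<rho> c) x a + christoffel A C c x a (\<rho> c x) = 0"
        using key[OF c p(1) X(1)] X(2) c p by simp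
    qed
  next
    assume R: ?R
    show ?L
      unfolding parallel_field_def
    proof (intro allI impI ballI)
      fix X p assume X: "vector_field A (points A) X" and p: "p \<in> points A"
      show "C X (Pi_field A nabla g) p = 0"
        using key[OF chart_at_props[OF p] X] R chart_at_props[OF p] by blast
    qed
  qed
qed

text \<open>The covariant derivative is a sum of one term in the base components and one in the
  vertical components. At a zero vector, arguments with only one kind of component show that both
  terms vanish.\<close>

lemma nabla_lee_iff:
  "(\<forall>X Y. vector_field TA (points TA) X \<and> vector_field TA (points TA) Y \<longrightarrow>
      (\<forall>P\<in>points TA. cov_deriv_1form TA DT (lee_form TA JT gT) X Y P = 0)) \<longleftrightarrow>
   (\<forall>c\<in>A. \<forall>x\<in>snd c ` fst c. (\<forall>a. pd (\<rho> c) x a + \<Delta> c x a (\<rho> c x) = 0) \<and>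
      (\<forall>v w. G c x (gam c x (\<rho> c x) v) w + G c x v (gam c x (\<rho> c x) w) = 0))" (is "?L \<longleftrightarrow> ?R")
proof
  assume L: ?L
  show ?R
  proof (intro ballI)
    fix c x assume c: "c \<in> A" and x: "x \<in> snd c ` fst c"
    then obtain p where p: "p \<in> fst c" "x = snd c p" by auto
    interpret R: affine_riemann_rep "snd c ` fst c" "G c" "\<Gamma> c" "\<Delta> c" by (rule rep[OF c])
    define P where "P = (p, 0 :: 'e)"
    have P: "P \<in> fst (ch c)" using p by (simp add: P_def)
    note tc = tchart_in[OF c]
    have PT: "P \<in> points TA" by (rule T.in_points[OF tc P])
    have fP: "fst (snd (ch c) P) = x" and sP: "snd (snd (ch c) P) = 0"
      using linear_0[OF linear_vec_coord[OF c p(1)]] by (auto simp: P_def p)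
    have v: "R.vert (snd (ch c) P) (a, b) = b" for a b
      by (simp add: R.vert_def fP sP R.\<Gamma>_simps[OF x])
    note g0 = bilinear_rzero[OF smooth_bil_bilinear[OF R.smooth_bil_\<gamma> x]]
    have key: "G c x (pd (\<rho> c) x a + \<Delta> c x a (\<rho> c x)) a' +
        (G c x (gam c x (\<rho> c x) b) b' + G c x b (gam c x (\<rho> c x) b')) / 2 = 0" for a b a' b'
    proof -
      obtain X where X: "vector_field TA (points TA) X" "X P = chart_vec TA (ch c) P (a, b)"
        using global_field_TA[OF PT] .
      obtain Y where Y: "vector_field TA (points TA) Y" "Y P = chart_vec TA (ch c) P (a', b')"
        using global_field_TA[OF PT] .
      have "cov_deriv_1form TA DT (lee_form TA JT gT) X Y P = 0" using L X Y PT by blast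
      then show ?thesis
        unfolding cov_deriv_lee_rep[OF c P X(1) Y(1)] X(2) Y(2) T.vec_coord_chart_vec[OF tc P] fP v fst_conv .
    qed
    have "pd (\<rho> c) x a + \<Delta> c x a (\<rho> c x) = 0" for a
      by (rule posdef_eqI[OF R.G_pos[OF x]]) (use key[of a _ 0 0] in \<open>simp add: g0 R.G_simps[OF x]\<close>)
    moreover have "G c x (gam c x (\<rho> c x) v) w + G c x v (gam c x (\<rho> c x) w) = 0" for v w
      using key[of 0 0 v w] by (simp add: R.G_simps[OF x])
    ultimately show "(\<forall>a. pd (\<rho> c) x a + \<Delta> c x a (\<rho> c x) = 0) \<and>
      (\<forall>v w. G c x (gam c x (\<rho> c x) v) w + G c x v (gam c x (\<rho> c x) w) = 0)" by blast
  qed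
next
  assume R: ?R
  show ?L
  proof (intro allI impI ballI; elim conjE)
    fix X Y P
    assume X: "vector_field TA (points TA) X" and Y: "vector_field TA (points TA) Y" and PT: "P \<in> points TA"
    obtain c where c: "c \<in> A" "P \<in> fst (ch c)" using TA_point[OF PT] by blast
    interpret R: affine_riemann_rep "snd c ` fst c" "G c" "\<Gamma> c" "\<Delta> c" by (rule rep[OF c(1)])
    have x: "fst (snd (ch c) P) \<in> snd c ` fst c" using ch_point[OF c] by (simp add: mem_Times_iff)
    show "cov_deriv_1form TA DT (lee_form TA JT gT) X Y P = 0"
      unfolding cov_deriv_lee_rep[OF c X Y]
      using bspec[OF bspec[OF R c(1)] x] by (simp add: bilinear_lzero[OF R.G_bil[OF x]])
  qed
qed

text \<open>Pairing the star identity for \<open>\<rho>\<close> with a third vector shows that \<open>\<gamma>\<^sub>\<rho>\<close> is self-adjoint; being also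
  skew-adjoint it vanishes.\<close>

lemma gam_\<rho>_zero_iff:
  assumes n: "DIM('e) \<ge> 2" and c: "c \<in> A" and x: "x \<in> snd c ` fst c" and star: "star_at c x"
  shows "(\<forall>v w. G c x (gam c x (\<rho> c x) v) w + G c x v (gam c x (\<rho> c x) w) = 0) \<longleftrightarrow> (\<forall>v. gam c x (\<rho> c x) v = 0)"
    (is "?L \<longleftrightarrow> ?R")
proof
  interpret R: affine_riemann_rep "snd c ` fst c" "G c" "\<Gamma> c" "\<Delta> c" by (rule rep[OF c])
  let ?n = "real DIM('e) - 1"
  have n0: "?n > 0" using n by simp
  let ?r = "\<rho> c x"
  show ?R if L: ?L
  proof
    fix v
    show "gam c x ?r v = 0"
    proof (rule posdef_eqI[OF R.G_pos[OF x]])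
      fix w
      \<comment> \<open>Two instances with \<open>v\<close> and \<open>w\<close> exchanged: the
        right sides and the terms with \<open>?r\<close> in the first slot of \<open>G\<close> agree
        by symmetry, so the remaining terms agree as well.\<close>
      have "?n * (G c x w (gam c x ?r v) - G c x ?r (gam c x w v)) = G c x ?r ?r * G c x w v - G c x ?r w * G c x ?r v"
        "?n * (G c x v (gam c x ?r w) - G c x ?r (gam c x v w)) = G c x ?r ?r * G c x v w - G c x ?r v * G c x ?r w"
        using star unfolding star_at_def by blast+
      then have "?n * G c x w (gam c x ?r v) = ?n * G c x v (gam c x ?r w)"
        using R.\<gamma>_sym[OF x, of v w] R.G_sym[OF x, of v w] by (simp add: algebra_simps)
      then have "G c x w (gam c x ?r v) = G c x v (gam c x ?r w)" using n0 by simp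
      moreover have "G c x (gam c x ?r v) w + G c x v (gam c x ?r w) = 0" using L by blast
      ultimately show "G c x (gam c x ?r v) w = G c x 0 w"
        using R.G_sym[OF x, of w] by (simp add: R.G_simps[OF x])
    qed
  qed
  show ?L if ?R using that by (simp add: R.G_simps[OF x])
qed

text \<open>The coordinate conditions for \<open>D\<close> and \<open>nabla\<close> differ by
  \<open>\<gamma>\<^sub>\<rho>\<close>, so for a \<open>D\<close>-parallel field being
  \<open>nabla\<close>-parallel means that \<open>\<gamma>\<^sub>\<rho>\<close> vanishes. The
  comparison \<open>eq\<close> may assume the star identity, since that occurs on both
  sides.\<close>

lemma vaisman_iff:
  assumes n: "DIM('e) \<ge> 2"
  shows "vaisman TA JT gT \<longleftrightarrow> (\<forall>c\<in>A. \<forall>x\<in>snd c ` fst c. star_at c x) \<and>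
    parallel_field A D (Pi_field A nabla g) \<and> parallel_field A nabla (Pi_field A nabla g)"
proof -
  have eq: "((\<forall>a. pd (\<rho> c) x a + \<Delta> c x a (\<rho> c x) = 0) \<and>
      (\<forall>v w. G c x (gam c x (\<rho> c x) v) w + G c x v (gam c x (\<rho> c x) w) = 0)) \<longleftrightarrow>
    (\<forall>a. pd (\<rho> c) x a + \<Delta> c x a (\<rho> c x) = 0) \<and> (\<forall>a. pd (\<rho> c) x a + \<Gamma> c x a (\<rho> c x) = 0)"
    if c: "c \<in> A" and x: "x \<in> snd c ` fst c" and star: "star_at c x" for c x
  proof -
    interpret R: affine_riemann_rep "snd c ` fst c" "G c" "\<Gamma> c" "\<Delta> c" by (rule rep[OF c])
    have "gam c x (\<rho> c x) a = 0 \<longleftrightarrow> pd (\<rho> c) x a + \<Gamma> c x a (\<rho> c x) = 0"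
      if "pd (\<rho> c) x a + \<Delta> c x a (\<rho> c x) = 0" for a
    proof -
      have "pd (\<rho> c) x a + \<Gamma> c x a (\<rho> c x) = - gam c x (\<rho> c x) a"
        using that R.\<gamma>_sym[OF x, of "\<rho> c x" a] by (simp add: R.\<gamma>_def add_eq_0_iff)
      then show ?thesis by simp
    qed
    then show ?thesis unfolding gam_\<rho>_zero_iff[OF n c x star] by blast
  qed
  show ?thesis
    unfolding vaisman_def lck_iff[OF n] nabla_lee_iff parallel_Pi_iff[OF N] parallel_Pi_iff[OF D_props(1)]
    using eq by blast
qed

end

theorem proposition3p6:
  fixes A :: "('a, 'e::euclidean_space) chart set"
    and nabla :: "('a \<Rightarrow> 'e) \<Rightarrow> ('a \<Rightarrow> 'e) \<Rightarrow> 'a \<Rightarrow> 'e"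
    and g :: "'a \<Rightarrow> 'e \<Rightarrow> 'e \<Rightarrow> real"
  assumes "affine_riemann_manifold A nabla g"
    and "DIM('e) \<ge> 2"
  shows "(locally_conformally_kaehler (tangent_atlas A) (J1 A nabla) (g1 A nabla g) \<longleftrightarrow>
         (\<forall>X Y. vector_field A (points A) X \<and> vector_field A (points A) Y \<longrightarrow>
           star_identity A nabla g X Y)) \<and>
    (vaisman (tangent_atlas A) (J1 A nabla) (g1 A nabla g) \<longleftrightarrow>
         (\<forall>X Y. vector_field A (points A) X \<and> vector_field A (points A) Y \<longrightarrow>
           star_identity A nabla g X Y) \<and>
         parallel_field A (levi_civita A g) (Pi_field A nabla g) \<and>
         parallel_field A nabla (Pi_field A nabla g))"
proof -
  interpret affine_riemann A nabla g
    using assms(1) by unfold_locales (auto simp: affine_riemann_manifold_def smooth_manifold_def)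
  show ?thesis
    unfolding star_identity_iff lck_iff[OF assms(2)] vaisman_iff[OF assms(2)] by simp
qed

end
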